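(* Let $(G,\Psi)$ be a supergraph with totally ordered finite or countably infinite vertex set $I$. The set $\{\Lambda(E): E\in\mathcal H(I,\zeta)\text{ is a super Lyndon heap}\}$ forms a basis of the free partially commutative Lie superalgebra $\mathcal{LS}(G,\Psi)$.
   Context: Base field $\mathbb C$. A supergraph $(G,\Psi)$ is a simple graph $G$ with vertex set $I$ (finite or countably infinite) and a subset $\Psi\subseteq I$ of odd vertices. $\mathcal{LS}(G,\Psi)$ is the quotient of the free Lie superalgebra on generators $e_i$ ($i\in I$; odd iff $i\in\Psi$) by the ideal generated by $[e_i,e_j]$ for all non-adjacent $i\ne j$; the generator $e_i$ is also written $i$. Heaps. $\mathcal H(I,\zeta)$ is the monoid of heaps over $G$ (product: superposition $\circ$), which is identified with the free partially commutative monoid $M(I,G,\Psi)=I^*/\!\sim$, where $I^*$ is the free monoid and $\sim$ is generated by $ab\sim ba$ for distinct non-adjacent $a,b\in I$; thus heaps are equivalence classes of words, and $0$ denotes the empty heap. A heap is odd (in $\mathcal H_1(I,\zeta)$) if it contains an odd number of letters from $\Psi$, otherwise even. The standard word $\operatorname{st}(E)$ is the lexicographically largest word in the class $E$; heaps are totally ordered by $E<F\iff\operatorname{st}(E)<\operatorname{st}(F)$ lexicographically (a proper prefix being smaller). A heap $E$ is primitive if $E=U\circ V=V\circ U$ implies $U=0$ or $V=0$. If $E=U\circ V$ then $V\circ U$ is a transpose of $E$; conjugacy of heaps is the transitive closure of transposition. A non-empty heap is Lyndon if it is primitive and minimal in its conjugacy class. A heap $E$ is super Lyndon if it is Lyndon,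 or $E=F\circ F$ with $F$ an odd Lyndon heap. Standard factorization. For a Lyndon heap $E$ with at least two pieces, $\Sigma(E)=(F,N)$ where $E=F\circ N$, $F\ne0$, $N$ is Lyndon, and $N$ is minimal in the total order among all such; then $F$ is also Lyndon. For $E=F\circ F$ with $F$ odd Lyndon, $\Sigma(E)=(F,F)$. For a super Lyndon heap $E$, the element $\Lambda(E)\in\mathcal{LS}(G,\Psi)$ is defined by $\Lambda(E)=E$ if $E\in I$, and $\Lambda(E)=[\Lambda(F_1),\Lambda(F_2)]$ if $\Sigma(E)=(F_1,F_2)$. *)

theory Defs
  imports
    "Jordan_Normal_Form.VS_Connect"
    "HOL-Algebra.QuotRing"
    "HOL-Library.Poly_Mapping"
    "HOL-Library.List_Lexorder"
    "HOL-Library.Countable"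
begin

section \<open>Quotients of non-associative algebras\<close>

text \<open>
  An algebra with bilinear product (in particular a Lie superalgebra) is represented by a record
  of type \<^typ>\<open>(complex, 'a) module\<close>: the field \<^const>\<open>mult\<close> is the product (the bracket), which is
  neither assumed associative nor unital.  The field \<^const>\<open>one\<close>, which the record type forces
  upon us, carries no meaning; it is set to zero.
\<close>

definition algebra_ideal :: "(complex, 'a) module \<Rightarrow> 'a set \<Rightarrow> bool" where
  "algebra_ideal L J \<longleftrightarrow> submodule class_ring J L \<and>
     (\<forall>x\<in>carrier L. \<forall>y\<in>J. x \<otimes>\<^bsub>L\<^esub> y \<in> J \<and> y \<otimes>\<^bsub>L\<^esub> x \<in> J)"

definition generated_ideal :: "(complex, 'a) module \<Rightarrow> 'a set \<Rightarrow> 'a set" where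
  "generated_ideal L S = \<Inter>{J. algebra_ideal L J \<and> S \<subseteq> J}"

definition quotient_algebra :: "(complex, 'a) module \<Rightarrow> 'a set \<Rightarrow> (complex, 'a set) module" where
  "quotient_algebra L J =
     \<lparr>carrier = a_rcosets\<^bsub>L\<^esub> J, mult = rcoset_mult L J, one = J, zero = J, add = set_add L,
      smult = (\<lambda>c A. \<Union>a\<in>A. J +>\<^bsub>L\<^esub> (c \<odot>\<^bsub>L\<^esub> a))\<rparr>"


section \<open>The free Lie superalgebra\<close>

datatype 'i magma = Gen 'i | Br "'i magma" "'i magma"

definition magma_mult ::
    "('i magma \<Rightarrow>\<^sub>0 complex) \<Rightarrow> ('i magma \<Rightarrow>\<^sub>0 complex) \<Rightarrow> ('i magma \<Rightarrow>\<^sub>0 complex)" where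
  "magma_mult x y = (\<Sum>s\<in>Poly_Mapping.keys x. \<Sum>t\<in>Poly_Mapping.keys y.
     Poly_Mapping.single (Br s t) (Poly_Mapping.lookup x s * Poly_Mapping.lookup y t))"

definition free_algebra :: "(complex, 'i magma \<Rightarrow>\<^sub>0 complex) module" where
  "free_algebra = \<lparr>carrier = UNIV, mult = magma_mult, one = 0, zero = 0, add = (+),
     smult = (\<lambda>c. Poly_Mapping.map ((*) c))\<rparr>"

text \<open>Parities are truth values, \<^const>\<open>True\<close> standing for odd.\<close>

primrec magma_parity :: "'i set \<Rightarrow> 'i magma \<Rightarrow> bool" where
  "magma_parity \<Psi> (Gen i) \<longleftrightarrow> i \<in> \<Psi>"
| "magma_parity \<Psi> (Br s t) \<longleftrightarrow> magma_parity \<Psi> s \<noteq> magma_parity \<Psi> t"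

definition homogeneous :: "'i set \<Rightarrow> bool \<Rightarrow> ('i magma \<Rightarrow>\<^sub>0 complex) \<Rightarrow> bool" where
  "homogeneous \<Psi> p x \<longleftrightarrow> (\<forall>t\<in>Poly_Mapping.keys x. magma_parity \<Psi> t = p)"

definition super_sign :: "bool \<Rightarrow> bool \<Rightarrow> ('i magma \<Rightarrow>\<^sub>0 complex) \<Rightarrow> ('i magma \<Rightarrow>\<^sub>0 complex)" where
  "super_sign p q x = (if p \<and> q then - x else x)"

text \<open>
  Super skew symmetry \<open>[x,y] = -(-1)\<^sup>|\<^sup>x\<^sup>|\<^sup>|\<^sup>y\<^sup>| [y,x]\<close> and the super Jacobi identity
  \<open>[x,[y,z]] = [[x,y],z] + (-1)\<^sup>|\<^sup>x\<^sup>|\<^sup>|\<^sup>y\<^sup>| [y,[x,z]]\<close>, for homogeneous arguments.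
\<close>

definition lie_superalgebra_relations :: "'i set \<Rightarrow> ('i magma \<Rightarrow>\<^sub>0 complex) set" where
  "lie_superalgebra_relations \<Psi> =
     {magma_mult x y + super_sign p q (magma_mult y x) | x y p q.
        homogeneous \<Psi> p x \<and> homogeneous \<Psi> q y} \<union>
     {magma_mult x (magma_mult y z) - magma_mult (magma_mult x y) z
        - super_sign p q (magma_mult y (magma_mult x z)) | x y z p q r.
        homogeneous \<Psi> p x \<and> homogeneous \<Psi> q y \<and> homogeneous \<Psi> r z}"

definition lie_superalgebra_ideal :: "'i set \<Rightarrow> ('i magma \<Rightarrow>\<^sub>0 complex) set" where
  "lie_superalgebra_ideal \<Psi> = generated_ideal free_algebra (lie_superalgebra_relations \<Psi>)"

definition FLS :: "'i set \<Rightarrow> (complex, ('i magma \<Rightarrow>\<^sub>0 complex) set) module" where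
  "FLS \<Psi> = quotient_algebra free_algebra (lie_superalgebra_ideal \<Psi>)"

definition FLS_gen :: "'i set \<Rightarrow> 'i \<Rightarrow> ('i magma \<Rightarrow>\<^sub>0 complex) set" where
  "FLS_gen \<Psi> i = lie_superalgebra_ideal \<Psi> +>\<^bsub>free_algebra\<^esub> Poly_Mapping.single (Gen i) 1"


section \<open>The free partially commutative Lie superalgebra\<close>

definition commutation_ideal ::
    "('i \<Rightarrow> 'i \<Rightarrow> bool) \<Rightarrow> 'i set \<Rightarrow> ('i magma \<Rightarrow>\<^sub>0 complex) set set" where
  "commutation_ideal adj \<Psi> = generated_ideal (FLS \<Psi>)
     {FLS_gen \<Psi> i \<otimes>\<^bsub>FLS \<Psi>\<^esub> FLS_gen \<Psi> j | i j. i \<noteq> j \<and> \<not> adj i j}"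

definition LS ::
    "('i \<Rightarrow> 'i \<Rightarrow> bool) \<Rightarrow> 'i set \<Rightarrow> (complex, ('i magma \<Rightarrow>\<^sub>0 complex) set set) module" where
  "LS adj \<Psi> = quotient_algebra (FLS \<Psi>) (commutation_ideal adj \<Psi>)"

definition LS_gen ::
    "('i \<Rightarrow> 'i \<Rightarrow> bool) \<Rightarrow> 'i set \<Rightarrow> 'i \<Rightarrow> ('i magma \<Rightarrow>\<^sub>0 complex) set set" where
  "LS_gen adj \<Psi> i = commutation_ideal adj \<Psi> +>\<^bsub>FLS \<Psi>\<^esub> FLS_gen \<Psi> i"


subsection \<open>\<open>LS\<close> is a vector space\<close>

definition bilinear_algebra :: "(complex, 'a) module \<Rightarrow> bool" where
  "bilinear_algebra L \<longleftrightarrow> module class_ring L \<and>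
     (\<forall>x\<in>carrier L. \<forall>y\<in>carrier L. x \<otimes>\<^bsub>L\<^esub> y \<in> carrier L) \<and>
     (\<forall>x\<in>carrier L. \<forall>y\<in>carrier L. \<forall>z\<in>carrier L. (x \<oplus>\<^bsub>L\<^esub> y) \<otimes>\<^bsub>L\<^esub> z = x \<otimes>\<^bsub>L\<^esub> z \<oplus>\<^bsub>L\<^esub> y \<otimes>\<^bsub>L\<^esub> z) \<and>
     (\<forall>x\<in>carrier L. \<forall>y\<in>carrier L. \<forall>z\<in>carrier L. z \<otimes>\<^bsub>L\<^esub> (x \<oplus>\<^bsub>L\<^esub> y) = z \<otimes>\<^bsub>L\<^esub> x \<oplus>\<^bsub>L\<^esub> z \<otimes>\<^bsub>L\<^esub> y) \<and>
     (\<forall>c. \<forall>x\<in>carrier L. \<forall>y\<in>carrier L. (c \<odot>\<^bsub>L\<^esub> x) \<otimes>\<^bsub>L\<^esub> y = c \<odot>\<^bsub>L\<^esub> (x \<otimes>\<^bsub>L\<^esub> y)) \<and>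
     (\<forall>c. \<forall>x\<in>carrier L. \<forall>y\<in>carrier L. x \<otimes>\<^bsub>L\<^esub> (c \<odot>\<^bsub>L\<^esub> y) = c \<odot>\<^bsub>L\<^esub> (x \<otimes>\<^bsub>L\<^esub> y))"

lemma lookup_smult: "Poly_Mapping.lookup (Poly_Mapping.map ((*) c) x) t = c * Poly_Mapping.lookup x t"
  for c :: complex
  by (transfer, auto simp: when_def)

lemma magma_mult_superset:
  assumes "finite A" "finite B" "Poly_Mapping.keys x \<subseteq> A" "Poly_Mapping.keys y \<subseteq> B"
  shows "magma_mult x y = (\<Sum>s\<in>A. \<Sum>t\<in>B.
     Poly_Mapping.single (Br s t) (Poly_Mapping.lookup x s * Poly_Mapping.lookup y t))"
proof -
  have "magma_mult x y = (\<Sum>s\<in>Poly_Mapping.keys x. \<Sum>t\<in>B.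
     Poly_Mapping.single (Br s t) (Poly_Mapping.lookup x s * Poly_Mapping.lookup y t))"
    unfolding magma_mult_def using assms
    by (intro sum.cong refl sum.mono_neutral_left) (auto simp: in_keys_iff)
  also have "\<dots> = (\<Sum>s\<in>A. \<Sum>t\<in>B.
     Poly_Mapping.single (Br s t) (Poly_Mapping.lookup x s * Poly_Mapping.lookup y t))"
    using assms by (intro sum.mono_neutral_left) (auto simp: in_keys_iff)
  finally show ?thesis .
qed

lemma magma_mult_add_left: "magma_mult (x + y) z = magma_mult x z + magma_mult y z"
proof -
  let ?A = "Poly_Mapping.keys x \<union> Poly_Mapping.keys y" and ?B = "Poly_Mapping.keys z"
  have "Poly_Mapping.keys (x + y) \<subseteq> ?A" by (rule Poly_Mapping.keys_add)
  then show ?thesis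
    by (simp add: magma_mult_superset[of ?A ?B] lookup_add distrib_right single_add sum.distrib)
qed

lemma magma_mult_add_right: "magma_mult z (x + y) = magma_mult z x + magma_mult z y"
proof -
  let ?A = "Poly_Mapping.keys x \<union> Poly_Mapping.keys y" and ?B = "Poly_Mapping.keys z"
  have "Poly_Mapping.keys (x + y) \<subseteq> ?A" by (rule Poly_Mapping.keys_add)
  then show ?thesis
    by (simp add: magma_mult_superset[of ?B ?A] lookup_add distrib_left single_add sum.distrib)
qed

lemma smult_hom_sum: "Poly_Mapping.map ((*) (c::complex)) (sum f A) = (\<Sum>a\<in>A. Poly_Mapping.map ((*) c) (f a))"
  by (intro poly_mapping_eqI) (simp add: lookup_smult lookup_sum sum_distrib_left)

lemma smult_single: "Poly_Mapping.map ((*) (c::complex)) (Poly_Mapping.single t a) = Poly_Mapping.single t (c * a)"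
  by (intro poly_mapping_eqI) (simp add: lookup_smult lookup_single when_def)

lemma keys_smult: "Poly_Mapping.keys (Poly_Mapping.map ((*) (c::complex)) x) \<subseteq> Poly_Mapping.keys x"
  by (auto simp: in_keys_iff lookup_smult)

lemma magma_mult_smult_left:
  "magma_mult (Poly_Mapping.map ((*) c) x) y = Poly_Mapping.map ((*) c) (magma_mult x y)"
  using keys_smult[of c x]
  by (simp add: magma_mult_superset[of "Poly_Mapping.keys x" "Poly_Mapping.keys y"] lookup_smult
     smult_hom_sum smult_single mult.assoc)

lemma magma_mult_smult_right:
  "magma_mult x (Poly_Mapping.map ((*) c) y) = Poly_Mapping.map ((*) c) (magma_mult x y)"
  using keys_smult[of c y]
  by (simp add: magma_mult_superset[of "Poly_Mapping.keys x" "Poly_Mapping.keys y"] lookup_smult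
     smult_hom_sum smult_single mult.left_commute)

lemma field_class_ring: "field (class_ring :: complex ring)"
  by (rule class_field.field_axioms)

lemma cring_class_ring: "cring (class_ring :: complex ring)"
  using field_class_ring by (rule fieldE)

lemma bilinear_algebra_free_algebra: "bilinear_algebra free_algebra"
proof -
  have "module class_ring (free_algebra :: (complex, 'a magma \<Rightarrow>\<^sub>0 complex) module)"
  proof (rule moduleI)
    show "abelian_group (free_algebra :: (complex, 'a magma \<Rightarrow>\<^sub>0 complex) module)"
      by (rule abelian_groupI) (auto simp: free_algebra_def algebra_simps intro: exI[of _ "- _"])
  qed (auto simp: cring_class_ring free_algebra_def lookup_smult lookup_add algebra_simps
        intro!: poly_mapping_eqI)
  then show ?thesis
    by (simp add: bilinear_algebra_def)
       (simp add: free_algebra_def magma_mult_add_left magma_mult_add_right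
         magma_mult_smult_left magma_mult_smult_right)
qed

lemma generated_ideal_is_ideal:
  assumes L: "bilinear_algebra L" and S: "S \<subseteq> carrier L"
  shows "algebra_ideal L (generated_ideal L S)"
proof -
  interpret Module.module class_ring L using L by (simp add: bilinear_algebra_def)
  have "algebra_ideal L (carrier L)"
    using L by (auto simp: algebra_ideal_def bilinear_algebra_def submodule_def)
  then have "generated_ideal L S \<subseteq> carrier L"
    using S by (auto simp: generated_ideal_def)
  moreover have "module class_ring L" by (rule module_axioms)
  ultimately show ?thesis
    unfolding algebra_ideal_def submodule_def
    by (auto simp: generated_ideal_def algebra_ideal_def submodule_def)
qed

lemma bilinear_algebra_quotient:
  assumes L: "bilinear_algebra L" and J: "algebra_ideal L J"
  shows "bilinear_algebra (quotient_algebra L J)"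
proof -
  interpret Module.module class_ring L using L by (simp add: bilinear_algebra_def)
  interpret J: LinearCombinations.submodule class_ring J L using J by (simp add: algebra_ideal_def)
  have neg: "\<ominus>\<^bsub>L\<^esub> x = (- 1) \<odot>\<^bsub>L\<^esub> x" if "x \<in> carrier L" for x
    using smult_l_minus[of 1 x] smult_one[of x] that class_ring_simps
    by (metis UNIV_I a_inv_def)
  have ne: "J \<noteq> {}" using J.zero_closed by blast
  have "subgroup J (add_monoid L)"
  proof (rule group.subgroupI[OF a_group])
    fix a assume a: "a \<in> J"
    have "\<ominus>\<^bsub>L\<^esub> a \<in> J" using neg[of a] J.subset a J.smult_closed[of "-1" a] by auto
    then show "inv\<^bsub>add_monoid L\<^esub> a \<in> J" by (simp add: a_inv_def)
  qed (use J.subset ne in auto)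
  then interpret A: abelian_subgroup J L
    by (intro abelian_subgroupI3 additive_subgroup.intro abelian_group_axioms)

  let ?Q = "quotient_algebra L J"
  have sm: "c \<odot>\<^bsub>?Q\<^esub> (J +>\<^bsub>L\<^esub> x) = J +>\<^bsub>L\<^esub> (c \<odot>\<^bsub>L\<^esub> x)" if x: "x \<in> carrier L" for c x
  proof -
    have "J +>\<^bsub>L\<^esub> (c \<odot>\<^bsub>L\<^esub> a) = J +>\<^bsub>L\<^esub> (c \<odot>\<^bsub>L\<^esub> x)" if a: "a \<in> J +>\<^bsub>L\<^esub> x" for a
    proof -
      obtain j where j: "j \<in> J" "a = j \<oplus>\<^bsub>L\<^esub> x" using a by (auto simp: a_r_coset_def')
      have "c \<odot>\<^bsub>L\<^esub> a = c \<odot>\<^bsub>L\<^esub> j \<oplus>\<^bsub>L\<^esub> c \<odot>\<^bsub>L\<^esub> x"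
        using j x J.subset by (auto intro: smult_r_distr)
      moreover have "c \<odot>\<^bsub>L\<^esub> j \<in> J" using j by (intro J.smult_closed) auto
      ultimately have "c \<odot>\<^bsub>L\<^esub> a \<in> J +>\<^bsub>L\<^esub> (c \<odot>\<^bsub>L\<^esub> x)"
        by (auto simp: a_r_coset_def')
      then show ?thesis using a_repr_independence[of "c \<odot>\<^bsub>L\<^esub> a" J "c \<odot>\<^bsub>L\<^esub> x"] x A.a_subgroup by auto
    qed
    then have "c \<odot>\<^bsub>?Q\<^esub> (J +>\<^bsub>L\<^esub> x) = (\<Union>a\<in>J +>\<^bsub>L\<^esub> x. J +>\<^bsub>L\<^esub> (c \<odot>\<^bsub>L\<^esub> x))"
      unfolding quotient_algebra_def module.simps by (intro SUP_cong refl)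
    then show ?thesis using A.a_rcos_self[OF x] by (metis SUP_const empty_iff)
  qed
  have mu: "(J +>\<^bsub>L\<^esub> x) \<otimes>\<^bsub>?Q\<^esub> (J +>\<^bsub>L\<^esub> y) = J +>\<^bsub>L\<^esub> (x \<otimes>\<^bsub>L\<^esub> y)"
    if x: "x \<in> carrier L" and y: "y \<in> carrier L" for x y
  proof -
    have "J +>\<^bsub>L\<^esub> (a \<otimes>\<^bsub>L\<^esub> b) = J +>\<^bsub>L\<^esub> (x \<otimes>\<^bsub>L\<^esub> y)"
      if ab: "a \<in> J +>\<^bsub>L\<^esub> x" "b \<in> J +>\<^bsub>L\<^esub> y" for a b
    proof -
      obtain j where j: "j \<in> J" "a = j \<oplus>\<^bsub>L\<^esub> x" using ab by (auto simp: a_r_coset_def')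
      obtain k where k: "k \<in> J" "b = k \<oplus>\<^bsub>L\<^esub> y" using ab by (auto simp: a_r_coset_def')
      have jc: "j \<in> carrier L" "k \<in> carrier L" using j k J.subset by auto
      have cl: "u \<otimes>\<^bsub>L\<^esub> v \<in> carrier L" if "u \<in> carrier L" "v \<in> carrier L" for u v
        using L that by (auto simp: bilinear_algebra_def)
      have b: "b \<in> carrier L" using k jc y by simp
      have "a \<otimes>\<^bsub>L\<^esub> b = j \<otimes>\<^bsub>L\<^esub> b \<oplus>\<^bsub>L\<^esub> x \<otimes>\<^bsub>L\<^esub> b"
        unfolding j(2) using L jc b x by (auto simp: bilinear_algebra_def)
      also have "x \<otimes>\<^bsub>L\<^esub> b = x \<otimes>\<^bsub>L\<^esub> k \<oplus>\<^bsub>L\<^esub> x \<otimes>\<^bsub>L\<^esub> y"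
        unfolding k(2) using L jc x y by (auto simp: bilinear_algebra_def)
      also have "j \<otimes>\<^bsub>L\<^esub> b \<oplus>\<^bsub>L\<^esub> (x \<otimes>\<^bsub>L\<^esub> k \<oplus>\<^bsub>L\<^esub> x \<otimes>\<^bsub>L\<^esub> y) =
          (j \<otimes>\<^bsub>L\<^esub> b \<oplus>\<^bsub>L\<^esub> x \<otimes>\<^bsub>L\<^esub> k) \<oplus>\<^bsub>L\<^esub> x \<otimes>\<^bsub>L\<^esub> y"
        by (rule a_assoc[symmetric]) (intro cl jc b x y)+
      finally have "a \<otimes>\<^bsub>L\<^esub> b = (j \<otimes>\<^bsub>L\<^esub> b \<oplus>\<^bsub>L\<^esub> x \<otimes>\<^bsub>L\<^esub> k) \<oplus>\<^bsub>L\<^esub> x \<otimes>\<^bsub>L\<^esub> y" .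
      moreover have "j \<otimes>\<^bsub>L\<^esub> b \<oplus>\<^bsub>L\<^esub> x \<otimes>\<^bsub>L\<^esub> k \<in> J"
        using J j(1) k(1) b x by (intro J.m_closed) (auto simp: algebra_ideal_def)
      ultimately have "a \<otimes>\<^bsub>L\<^esub> b \<in> J +>\<^bsub>L\<^esub> (x \<otimes>\<^bsub>L\<^esub> y)"
        by (auto simp: a_r_coset_def')
      then show ?thesis
        using a_repr_independence[of "a \<otimes>\<^bsub>L\<^esub> b" J "x \<otimes>\<^bsub>L\<^esub> y"] cl[OF x y] A.a_subgroup by auto
    qed
    then have "(J +>\<^bsub>L\<^esub> x) \<otimes>\<^bsub>?Q\<^esub> (J +>\<^bsub>L\<^esub> y) =
        (\<Union>a\<in>J +>\<^bsub>L\<^esub> x. \<Union>b\<in>J +>\<^bsub>L\<^esub> y. J +>\<^bsub>L\<^esub> (x \<otimes>\<^bsub>L\<^esub> y))"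
      unfolding quotient_algebra_def monoid.simps rcoset_mult_def by (intro SUP_cong refl)
    then show ?thesis using A.a_rcos_self[OF x] A.a_rcos_self[OF y] by (metis SUP_const empty_iff)
  qed
  have ad: "(J +>\<^bsub>L\<^esub> x) \<oplus>\<^bsub>?Q\<^esub> (J +>\<^bsub>L\<^esub> y) = J +>\<^bsub>L\<^esub> (x \<oplus>\<^bsub>L\<^esub> y)"
    if "x \<in> carrier L" and "y \<in> carrier L" for x y
    using that by (simp add: quotient_algebra_def A.a_rcos_sum)
  have ca: "carrier ?Q = (\<lambda>x. J +>\<^bsub>L\<^esub> x) ` carrier L"
    by (auto simp: quotient_algebra_def A_RCOSETS_def')
  have ze: "\<zero>\<^bsub>?Q\<^esub> = J +>\<^bsub>L\<^esub> \<zero>\<^bsub>L\<^esub>"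
    using a_coset_join2[OF zero_closed A.a_subgroup J.zero_closed] by (simp add: quotient_algebra_def)
  have "abelian_group ?Q"
  proof (rule abelian_groupI)
    fix X assume "X \<in> carrier ?Q"
    then obtain x where x: "x \<in> carrier L" "X = J +>\<^bsub>L\<^esub> x" by (auto simp: ca)
    then have "(J +>\<^bsub>L\<^esub> (\<ominus>\<^bsub>L\<^esub> x)) \<oplus>\<^bsub>?Q\<^esub> X = \<zero>\<^bsub>?Q\<^esub>" by (simp add: ad ze l_neg)
    then show "\<exists>Y\<in>carrier ?Q. Y \<oplus>\<^bsub>?Q\<^esub> X = \<zero>\<^bsub>?Q\<^esub>" using x by (auto simp: ca)
  qed (auto simp: ca ad ze a_ac)
  then have "Module.module class_ring ?Q"
  proof (rule moduleI[OF cring_class_ring], goal_cases)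
    case (1 c X) then show ?case using smult_closed by (auto simp: ca sm)
  next
    case (2 c d X) then show ?case using smult_l_distr[of c d] smult_closed by (auto simp: ca sm ad)
  next
    case (3 c X Y) then show ?case using smult_r_distr[of c] smult_closed by (auto simp: ca sm ad)
  next
    case (4 c d X) then show ?case using smult_assoc1[of c d] smult_closed by (auto simp: ca sm)
  next
    case (5 X) then show ?case using smult_one by (auto simp: ca sm)
  qed
  moreover have
    "\<And>x y. x \<in> carrier L \<Longrightarrow> y \<in> carrier L \<Longrightarrow> x \<otimes>\<^bsub>L\<^esub> y \<in> carrier L" and
    "\<And>x y z. x \<in> carrier L \<Longrightarrow> y \<in> carrier L \<Longrightarrow> z \<in> carrier L \<Longrightarrow>
       (x \<oplus>\<^bsub>L\<^esub> y) \<otimes>\<^bsub>L\<^esub> z = x \<otimes>\<^bsub>L\<^esub> z \<oplus>\<^bsub>L\<^esub> y \<otimes>\<^bsub>L\<^esub> z" and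
    "\<And>x y z. x \<in> carrier L \<Longrightarrow> y \<in> carrier L \<Longrightarrow> z \<in> carrier L \<Longrightarrow>
       z \<otimes>\<^bsub>L\<^esub> (x \<oplus>\<^bsub>L\<^esub> y) = z \<otimes>\<^bsub>L\<^esub> x \<oplus>\<^bsub>L\<^esub> z \<otimes>\<^bsub>L\<^esub> y" and
    "\<And>c x y. x \<in> carrier L \<Longrightarrow> y \<in> carrier L \<Longrightarrow> (c \<odot>\<^bsub>L\<^esub> x) \<otimes>\<^bsub>L\<^esub> y = c \<odot>\<^bsub>L\<^esub> (x \<otimes>\<^bsub>L\<^esub> y)" and
    "\<And>c x y. x \<in> carrier L \<Longrightarrow> y \<in> carrier L \<Longrightarrow> x \<otimes>\<^bsub>L\<^esub> (c \<odot>\<^bsub>L\<^esub> y) = c \<odot>\<^bsub>L\<^esub> (x \<otimes>\<^bsub>L\<^esub> y)" and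
    "\<And>c x. x \<in> carrier L \<Longrightarrow> c \<odot>\<^bsub>L\<^esub> x \<in> carrier L"
    using L smult_closed by (auto simp: bilinear_algebra_def)
  ultimately show ?thesis
    unfolding bilinear_algebra_def ca ball_simps
    by (intro conjI allI ballI) (simp_all add: sm ad mu)
qed

lemma bilinear_algebra_FLS: "bilinear_algebra (FLS \<Psi>)"
  unfolding FLS_def lie_superalgebra_ideal_def
  by (intro bilinear_algebra_quotient bilinear_algebra_free_algebra generated_ideal_is_ideal)
     (simp add: free_algebra_def)

lemma FLS_gen_closed: "FLS_gen \<Psi> i \<in> carrier (FLS \<Psi>)"
  by (auto simp: FLS_gen_def FLS_def quotient_algebra_def A_RCOSETS_def' free_algebra_def)

lemma vectorspace_LS: "vectorspace class_ring (LS adj \<Psi>)"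
proof -
  have "bilinear_algebra (LS adj \<Psi>)"
    unfolding LS_def commutation_ideal_def
    using bilinear_algebra_FLS[of \<Psi>] FLS_gen_closed[of \<Psi>]
    by (intro bilinear_algebra_quotient generated_ideal_is_ideal) (auto simp: bilinear_algebra_def)
  then show ?thesis
    by (simp add: vectorspace_def bilinear_algebra_def field_class_ring)
qed


section \<open>Heaps\<close>

text \<open>A heap is the set of all words representing it.\<close>

definition swap :: "('i \<Rightarrow> 'i \<Rightarrow> bool) \<Rightarrow> 'i list \<Rightarrow> 'i list \<Rightarrow> bool" where
  "swap adj v w \<longleftrightarrow> (\<exists>x y a b. a \<noteq> b \<and> \<not> adj a b \<and> v = x @ [a, b] @ y \<and> w = x @ [b, a] @ y)"

definition heap_of :: "('i \<Rightarrow> 'i \<Rightarrow> bool) \<Rightarrow> 'i list \<Rightarrow> 'i list set" where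
  "heap_of adj w = {v. equivclp (swap adj) w v}"

definition heaps :: "('i \<Rightarrow> 'i \<Rightarrow> bool) \<Rightarrow> 'i list set set" where
  "heaps adj = range (heap_of adj)"

definition empty_heap :: "('i \<Rightarrow> 'i \<Rightarrow> bool) \<Rightarrow> 'i list set" where
  "empty_heap adj = heap_of adj []"

definition superpose :: "('i \<Rightarrow> 'i \<Rightarrow> bool) \<Rightarrow> 'i list set \<Rightarrow> 'i list set \<Rightarrow> 'i list set" where
  "superpose adj E F = (\<Union>u\<in>E. \<Union>v\<in>F. heap_of adj (u @ v))"

definition odd_heap :: "'i set \<Rightarrow> 'i list set \<Rightarrow> bool" where
  "odd_heap \<Psi> E \<longleftrightarrow> (\<exists>w\<in>E. odd (length (filter (\<lambda>i. i \<in> \<Psi>) w)))"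

text \<open>The order on lists is the lexicographic one in which a proper prefix is smaller.\<close>

definition standard_word :: "'i::linorder list set \<Rightarrow> 'i list" where
  "standard_word E = Max E"

definition heap_le :: "'i::linorder list set \<Rightarrow> 'i list set \<Rightarrow> bool" where
  "heap_le E F \<longleftrightarrow> standard_word E \<le> standard_word F"

definition primitive_heap :: "('i \<Rightarrow> 'i \<Rightarrow> bool) \<Rightarrow> 'i list set \<Rightarrow> bool" where
  "primitive_heap adj E \<longleftrightarrow> (\<forall>U\<in>heaps adj. \<forall>V\<in>heaps adj.
     E = superpose adj U V \<and> E = superpose adj V U \<longrightarrow> U = empty_heap adj \<or> V = empty_heap adj)"

definition transpose_heap :: "('i \<Rightarrow> 'i \<Rightarrow> bool) \<Rightarrow> 'i list set \<Rightarrow> 'i list set \<Rightarrow> bool" where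
  "transpose_heap adj E F \<longleftrightarrow> (\<exists>U\<in>heaps adj. \<exists>V\<in>heaps adj.
     E = superpose adj U V \<and> F = superpose adj V U)"

definition conjugate_heap :: "('i \<Rightarrow> 'i \<Rightarrow> bool) \<Rightarrow> 'i list set \<Rightarrow> 'i list set \<Rightarrow> bool" where
  "conjugate_heap adj = (transpose_heap adj)\<^sup>+\<^sup>+"

definition lyndon_heap :: "('i::linorder \<Rightarrow> 'i \<Rightarrow> bool) \<Rightarrow> 'i list set \<Rightarrow> bool" where
  "lyndon_heap adj E \<longleftrightarrow> E \<in> heaps adj \<and> E \<noteq> empty_heap adj \<and> primitive_heap adj E \<and>
     (\<forall>F. conjugate_heap adj E F \<longrightarrow> heap_le E F)"

definition super_lyndon_heap ::
    "('i::linorder \<Rightarrow> 'i \<Rightarrow> bool) \<Rightarrow> 'i set \<Rightarrow> 'i list set \<Rightarrow> bool" where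
  "super_lyndon_heap adj \<Psi> E \<longleftrightarrow> lyndon_heap adj E \<or>
     (\<exists>F. lyndon_heap adj F \<and> odd_heap \<Psi> F \<and> E = superpose adj F F)"


section \<open>Standard factorization and the elements \<open>\<Lambda>(E)\<close>\<close>

definition lyndon_split ::
    "('i::linorder \<Rightarrow> 'i \<Rightarrow> bool) \<Rightarrow> 'i list set \<Rightarrow> 'i list set \<Rightarrow> 'i list set \<Rightarrow> bool" where
  "lyndon_split adj E F N \<longleftrightarrow>
     F \<in> heaps adj \<and> F \<noteq> empty_heap adj \<and> lyndon_heap adj N \<and> E = superpose adj F N"

text \<open>
  \<open>standard_factorization adj \<Psi> E F N\<close> means \<open>\<Sigma>(E) = (F,N)\<close>.  In the first rule \<open>E\<close> automatically
  has at least two pieces, since \<open>F\<close> and \<open>N\<close> are both non-empty.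
\<close>

inductive standard_factorization ::
    "('i::linorder \<Rightarrow> 'i \<Rightarrow> bool) \<Rightarrow> 'i set \<Rightarrow> 'i list set \<Rightarrow> 'i list set \<Rightarrow> 'i list set \<Rightarrow> bool"
  for adj \<Psi> where
  lyndon: "lyndon_heap adj E \<Longrightarrow> lyndon_split adj E F N \<Longrightarrow>
     (\<And>F' N'. lyndon_split adj E F' N' \<Longrightarrow> heap_le N N') \<Longrightarrow> standard_factorization adj \<Psi> E F N"
| square: "lyndon_heap adj F \<Longrightarrow> odd_heap \<Psi> F \<Longrightarrow>
     standard_factorization adj \<Psi> (superpose adj F F) F F"

text \<open>The graph of \<open>\<Lambda>\<close>.\<close>

inductive Lambda_graph ::
    "('i::linorder \<Rightarrow> 'i \<Rightarrow> bool) \<Rightarrow> 'i set \<Rightarrow> 'i list set \<Rightarrow>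
     ('i magma \<Rightarrow>\<^sub>0 complex) set set \<Rightarrow> bool"
  for adj \<Psi> where
  piece: "Lambda_graph adj \<Psi> (heap_of adj [i]) (LS_gen adj \<Psi> i)"
| bracket: "standard_factorization adj \<Psi> E F N \<Longrightarrow>
     Lambda_graph adj \<Psi> F x \<Longrightarrow> Lambda_graph adj \<Psi> N y \<Longrightarrow>
     Lambda_graph adj \<Psi> E (x \<otimes>\<^bsub>LS adj \<Psi>\<^esub> y)"

definition Lambda ::
    "('i::linorder \<Rightarrow> 'i \<Rightarrow> bool) \<Rightarrow> 'i set \<Rightarrow> 'i list set \<Rightarrow> ('i magma \<Rightarrow>\<^sub>0 complex) set set" where
  "Lambda adj \<Psi> E = (THE x. Lambda_graph adj \<Psi> E x)"

end

theory Submission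
  imports Defs "HOL-Library.Sublist" "HOL-Library.Multiset"
begin

text \<open>
  Lyndon heaps are exactly the heaps whose standard word \<open>w\<close> is a Lyndon word, and then \<open>\<Sigma>\<close> is given
  by the factorization \<open>w = uv\<close> with \<open>v\<close> the smallest proper suffix.  So \<open>\<Lambda>(E)\<close> is the class of the
  usual Lyndon bracketing \<open>[w]\<close> of \<open>w = st(E)\<close>.

  Spanning: the Jacobi identity shows that all \<open>[w]\<close>, \<open>w\<close> a super Lyndon word, span the free Lie
  superalgebra, and in the free associative algebra \<open>[w]\<close> is a multiple of \<open>w\<close> plus larger words.  A
  non-standard Lyndon word has a factor \<open>a u b\<close> with \<open>a < b\<close> and \<open>b\<close> commuting with \<open>a u\<close>; as
  \<open>[[a u], b]\<close> vanishes in the partially commutative quotient, Shirshov's special bracketing produces an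
  element of the kernel with leading word \<open>w\<close>, which rewrites \<open>[w]\<close> in terms of larger words.

  Independence: the coefficient sum over a heap, weighted with the sign of sorting the odd letters,
  is a functional on the quotient, and \<open>[w]\<close> is triangular with respect to these functionals for
  standard \<open>w\<close>, because \<open>w\<close> is the largest word of its heap.
\<close>

section \<open>Lyndon words\<close>

text \<open>\<open>LS\<close> is a quotient of a quotient of the free magma algebra, so identities
  are read as membership in subspaces of tree combinations; \<open>null_ideal\<close>, the kernel of
  the composite projection, replaces computation with cosets. No enveloping algebra and no
  Poincare-Birkhoff-Witt theorem enters: trees are mapped to coefficient functions on words, and
  what matters is that this map respects the relations. The lexicographic order is not well-founded
  (\<open>b > ab > aab > ...\<close>), and ascending chains need not stop either. The descents
  terminate because brackets respect the multiset of letters: a single multidegree contains only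
  finitely many words, for an infinite alphabet too. The squares come from the signs. For odd
  \<open>k\<close> the two products in \<open>[k,k]\<close> add up to a leading term
  \<open>2 kk\<close>, for even \<open>k\<close> they cancel. No higher power appears, since
  \<open>3 [k,[k,k]] = 0\<close> for odd \<open>k\<close>; dividing by 2 and 3 is where the
  characteristic of the field enters.\<close>

definition lex_below :: "'i::linorder list \<Rightarrow> 'i list \<Rightarrow> bool" where
  "lex_below u v \<longleftrightarrow> (\<exists>x a b u' v'. u = x @ a # u' \<and> v = x @ b # v' \<and> a < b)"

lemma list_less_cases: "u < v \<longleftrightarrow> lex_below u v \<or> (\<exists>t. t \<noteq> [] \<and> v = u @ t)" for u v :: "'i::linorder list"
  unfolding list_less_def lexord_def lex_below_def by (auto simp: neq_Nil_conv) blast+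

text \<open>The reason for separating \<open>lex_below\<close> from \<open><\<close>: a comparison
  decided at a differing letter survives arbitrary extensions, one decided by a proper prefix may be
  reversed by them.\<close>

lemma lex_below_append: "lex_below u v \<Longrightarrow> lex_below (u @ x) (v @ y)"
  unfolding lex_below_def by fastforce

lemma lex_below_less: "lex_below u v \<Longrightarrow> u < v"
  by (simp add: list_less_cases)

lemma lex_below_append_less: "lex_below u v \<Longrightarrow> u @ x < v @ y"
  by (simp add: lex_below_append lex_below_less)

lemma lex_belowI: "u < v \<Longrightarrow> length v \<le> length u \<Longrightarrow> lex_below u v"
  by (auto simp: list_less_cases)

lemma append_less_append [simp]: "x @ u < x @ v \<longleftrightarrow> u < v" for x u v :: "'i::linorder list"
  by (induction x) auto

lemma append_le_append [simp]: "x @ u \<le> x @ v \<longleftrightarrow> u \<le> v" for x u v :: "'i::linorder list"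
  by (induction x) auto

lemma less_append [simp]: "u < u @ t \<longleftrightarrow> t \<noteq> []" for u t :: "'i::linorder list"
  using append_less_append[of u "[]" t] by (cases t) auto

lemma le_append [simp]: "u \<le> u @ t" for u t :: "'i::linorder list"
  using append_le_append[of u "[]" t] by (cases t) auto

lemma less_append_same_length:
  "u < v \<Longrightarrow> length u = length v \<Longrightarrow> u @ x < v @ y" for u v :: "'i::linorder list"
  by (simp add: lex_belowI lex_below_append_less)

definition lyndon_word :: "'i::linorder list \<Rightarrow> bool" where
  "lyndon_word w \<longleftrightarrow> w \<noteq> [] \<and> (\<forall>p s. w = p @ s \<and> p \<noteq> [] \<and> s \<noteq> [] \<longrightarrow> w < s)"

lemma lyndon_wordD: "lyndon_word (p @ s) \<Longrightarrow> p \<noteq> [] \<Longrightarrow> s \<noteq> [] \<Longrightarrow> p @ s < s"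
  by (auto simp: lyndon_word_def)

text \<open>A proper suffix is shorter than the word, so it cannot extend it; the comparison must be
  decided at a differing letter.\<close>

lemma lyndon_word_below: "lyndon_word (p @ s) \<Longrightarrow> p \<noteq> [] \<Longrightarrow> s \<noteq> [] \<Longrightarrow> lex_below (p @ s) s"
  by (simp add: lyndon_wordD lex_belowI)

lemma lyndon_word_suffix_ge: "lyndon_word (p @ s) \<Longrightarrow> s \<noteq> [] \<Longrightarrow> p @ s \<le> s"
  by (cases "p = []") (auto dest: lyndon_wordD)

lemma lyndon_word_singleton [simp]: "lyndon_word [a]"
  by (auto simp: lyndon_word_def dest: sym simp: append_eq_Cons_conv)

lemma lyndon_word_hd_le: "lyndon_word w \<Longrightarrow> a \<in> set w \<Longrightarrow> hd w \<le> a"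
proof -
  assume w: "lyndon_word w" and "a \<in> set w"
  then obtain p s where ps: "w = p @ a # s" by (meson split_list)
  then have "w \<le> a # s" using lyndon_word_suffix_ge[of p "a # s"] w by simp
  then show ?thesis using w by (cases w) (auto simp: lyndon_word_def)
qed

text \<open>A suffix that cuts through \<open>u\<close> begins with a suffix of \<open>u\<close>,
  which exceeds \<open>u\<close> at a differing letter. A suffix inside \<open>v\<close> is at least
  \<open>v\<close>, so it suffices that \<open>u @ v < v\<close>; if \<open>u\<close> is a prefix of
  \<open>v\<close>, this follows from comparing \<open>v\<close> with its own suffix
  \<open>t\<close>.\<close>

lemma lyndon_word_append:
  assumes u: "lyndon_word u" and v: "lyndon_word v" and "u < v"
  shows "lyndon_word (u @ v)"
proof -
  have ne: "u \<noteq> []" "v \<noteq> []" using u v by (auto simp: lyndon_word_def)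
  have uv: "u @ v < v"
  proof (cases "lex_below u v")
    case True then show ?thesis using lex_below_append_less[of u v v "[]"] by simp
  next
    case False
    then obtain t where t: "t \<noteq> []" "v = u @ t" using \<open>u < v\<close> by (auto simp: list_less_cases)
    then have "v < t" using v ne lyndon_wordD by blast
    then show ?thesis using t by simp
  qed
  have "u @ v < s" if ps: "u @ v = p @ s" "p \<noteq> []" "s \<noteq> []" for p s
  proof -
    consider t where "t \<noteq> []" "u = p @ t" "s = t @ v" | t where "p = u @ t" "v = t @ s"
      using ps(1) unfolding append_eq_append_conv2
      by (metis append.right_neutral append_Nil)
    then show ?thesis
    proof cases
      case 1
      then have "lex_below u t" using lyndon_word_below u ps(2) by blast
      then show ?thesis using 1 lex_below_append_less[of u t v v] by simp
    next
      case 2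
      then have "v \<le> s" using lyndon_word_suffix_ge v ps(3) by blast
      then show ?thesis using uv by simp
    qed
  qed
  then show ?thesis using ne by (auto simp: lyndon_word_def)
qed

lemma lyndon_word_swap:
  assumes "lyndon_word (p @ s)" "p \<noteq> []" "s \<noteq> []" shows "p @ s < s @ p"
  using lex_below_append_less[OF lyndon_word_below[OF assms], of "[]" p] by simp

text \<open>The delicate case is a smaller suffix that is also a prefix,
  \<open>w = p s = s t\<close> with \<open>p\<close> and \<open>t\<close> of equal length: the
  rotation \<open>s p\<close> forces \<open>t < p\<close>, and the rotation \<open>t s\<close>
  forces \<open>p s < t s\<close>, a contradiction.\<close>

lemma lyndon_word_if_rotations:
  assumes ne: "w \<noteq> []" and rot: "\<And>p s. w = p @ s \<Longrightarrow> p \<noteq> [] \<Longrightarrow> s \<noteq> [] \<Longrightarrow> w < s @ p"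
  shows "lyndon_word w"
proof -
  have "w < s" if ps: "w = p @ s" "p \<noteq> []" "s \<noteq> []" for p s
  proof (rule ccontr)
    assume "\<not> w < s"
    moreover have "s \<noteq> w" using ps by auto
    ultimately have "s < w" by (simp add: not_less)
    then consider "lex_below s w" | t where "w = s @ t" "t \<noteq> []" by (auto simp: list_less_cases)
    then show False
    proof cases
      case 1
      then show False using lex_below_append_less[of s w p "[]"] rot[OF ps] by simp
    next
      case (2 t)
      have "s @ t < s @ p" using rot[OF ps] 2 by simp
      then have "t < p" by simp
      have len: "length t = length p" using 2 ps by (metis add.commute add_left_cancel length_append)
      have "p @ s < t @ s" using rot[OF 2(1) \<open>s \<noteq> []\<close> \<open>t \<noteq> []\<close>] ps by simp
      moreover have "t @ s < p @ s" by (rule less_append_same_length) fact+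
      ultimately show False by simp
    qed
  qed
  then show ?thesis using ne by (auto simp: lyndon_word_def)
qed

text \<open>If \<open>f = g t\<close>, the suffix \<open>t\<close> exceeds \<open>f\<close> and
  hence \<open>g\<close>. This keeps the square of a smaller word below \<open>f\<close> when two
  equal factors meet in the spanning argument.\<close>

lemma square_less_lyndon:
  assumes "lyndon_word f" "g < f" "g \<noteq> []" shows "g @ g < f"
proof (cases "lex_below g f")
  case True then show ?thesis using lex_below_append_less[of g f g "[]"] by simp
next
  case False
  then obtain t where t: "t \<noteq> []" "f = g @ t" using \<open>g < f\<close> by (auto simp: list_less_cases)
  then have "f < t" using assms lyndon_wordD by blast
  then have "g < t" using \<open>g < f\<close> by (rule order.strict_trans[rotated])
  then show ?thesis using t by simp
qed

section \<open>Smallest suffixes and the standard factorization of a word\<close>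

definition min_suffix :: "'i::linorder list \<Rightarrow> 'i list" where
  "min_suffix w = Min {s. suffix s w \<and> s \<noteq> []}"

lemma finite_suffixes: "finite {s. suffix s w \<and> s \<noteq> []}"
  by (rule finite_subset[of _ "set (suffixes w)"]) auto

lemma min_suffix:
  assumes "w \<noteq> []"
  shows "suffix (min_suffix w) w" "min_suffix w \<noteq> []"
    and "\<And>s. suffix s w \<Longrightarrow> s \<noteq> [] \<Longrightarrow> min_suffix w \<le> s"
proof -
  have "{s. suffix s w \<and> s \<noteq> []} \<noteq> {}" using assms by auto
  from Min_in[OF finite_suffixes this]
  show "suffix (min_suffix w) w" "min_suffix w \<noteq> []" by (auto simp: min_suffix_def)
  show "\<And>s. suffix s w \<Longrightarrow> s \<noteq> [] \<Longrightarrow> min_suffix w \<le> s"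
    unfolding min_suffix_def by (rule Min_le[OF finite_suffixes]) auto
qed

lemma lyndon_word_min_suffix:
  assumes "w \<noteq> []" shows "lyndon_word (min_suffix w)"
proof -
  note m = min_suffix[OF assms]
  have "min_suffix w < s" if "min_suffix w = p @ s" "p \<noteq> []" "s \<noteq> []" for p s
  proof -
    have "suffix s w" using that(1) m(1) by (metis suffix_appendD suffix_order.refl)
    then have "min_suffix w \<le> s" using m(3) that by blast
    moreover have "min_suffix w \<noteq> s" using that by auto
    ultimately show ?thesis by simp
  qed
  then show ?thesis using m(2) by (auto simp: lyndon_word_def)
qed

text \<open>The tail is taken to exclude the whole word, which would be the minimum for a Lyndon
  word. The value is meaningful for words of length at least two, Lyndon or not; on squares
  \<open>k @ k\<close> of Lyndon words it is \<open>k\<close>.\<close>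

definition right_factor :: "'i::linorder list \<Rightarrow> 'i list" where
  "right_factor w = min_suffix (tl w)"

definition left_factor :: "'i::linorder list \<Rightarrow> 'i list" where
  "left_factor w = take (length w - length (right_factor w)) w"

context
  fixes w :: "'i::linorder list"
  assumes len: "2 \<le> length w"
begin

lemma tl_nonempty: "tl w \<noteq> []"
  using len by (cases w) auto

lemma factors_append: "left_factor w @ right_factor w = w"
  and left_factor_nonempty: "left_factor w \<noteq> []"
  and right_factor_nonempty: "right_factor w \<noteq> []"
proof -
  note m = min_suffix[OF tl_nonempty]
  obtain p where "tl w = p @ right_factor w" using m(1) by (auto simp: right_factor_def suffix_def)
  then have "w = (hd w # p) @ right_factor w" using len by (cases w) auto
  then have "left_factor w = hd w # p"
    unfolding left_factor_def
    by (metis add_diff_cancel_right' append_eq_conv_conj length_append)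
  then show "left_factor w @ right_factor w = w" "left_factor w \<noteq> []"
    using \<open>w = (hd w # p) @ right_factor w\<close> by auto
  show "right_factor w \<noteq> []" using m(2) by (simp add: right_factor_def)
qed

lemma right_factor_le: "w = p @ s \<Longrightarrow> p \<noteq> [] \<Longrightarrow> s \<noteq> [] \<Longrightarrow> right_factor w \<le> s"
  using min_suffix(3)[OF tl_nonempty, of s] by (cases p) (auto simp: right_factor_def suffix_def)

lemma right_factor_eqI:
  assumes "w = q @ t" "q \<noteq> []" "t \<noteq> []" "\<And>p s. w = p @ s \<Longrightarrow> p \<noteq> [] \<Longrightarrow> s \<noteq> [] \<Longrightarrow> t \<le> s"
  shows "right_factor w = t" "left_factor w = q"
proof -
  show r: "right_factor w = t"
  proof (rule antisym)
    show "right_factor w \<le> t" using right_factor_le assms(1-3) by blast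
    show "t \<le> right_factor w"
      by (rule assms(4)[OF factors_append[symmetric] left_factor_nonempty right_factor_nonempty])
  qed
  show "left_factor w = q" using factors_append r assms(1) by auto
qed

lemma lyndon_word_right_factor: "lyndon_word (right_factor w)"
  using lyndon_word_min_suffix[OF tl_nonempty] by (simp add: right_factor_def)

text \<open>A smaller suffix \<open>s\<close> of the left factor must be a prefix of it, say
  \<open>s @ t\<close>, because \<open>w < s @ ?r\<close>. Cancelling \<open>s\<close> in that
  comparison gives \<open>t @ ?r < ?r\<close>, against the choice of \<open>?r\<close> as the
  smallest proper suffix.\<close>

lemma lyndon_word_left_factor:
  assumes w: "lyndon_word w"
  shows "lyndon_word (left_factor w)"
proof -
  let ?l = "left_factor w" and ?r = "right_factor w"
  have "?l < s" if ps: "?l = p @ s" "p \<noteq> []" "s \<noteq> []" for p s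
  proof (rule ccontr)
    assume "\<not> ?l < s"
    moreover have "s \<noteq> ?l" using ps by auto
    ultimately have "s < ?l" by (simp add: not_less)
    have w_eq: "w = p @ s @ ?r" using ps factors_append by simp
    have sr: "w < s @ ?r" using w w_eq ps lyndon_wordD[of p "s @ ?r"] by simp
    from \<open>s < ?l\<close> consider "lex_below s ?l" | t where "?l = s @ t" "t \<noteq> []"
      by (auto simp: list_less_cases)
    then show False
    proof cases
      case 1
      then have "s @ ?r < ?l @ ?r" by (rule lex_below_append_less)
      then show False using sr factors_append by simp
    next
      case (2 t)
      have "s @ t @ ?r < s @ ?r" using 2 sr factors_append by (metis append.assoc)
      then have "t @ ?r < ?r" by simp
      moreover have "?r \<le> t @ ?r"
        using right_factor_le[of s "t @ ?r"] 2 ps factors_append by (metis append.assoc append_is_Nil_conv)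
      ultimately show False by simp
    qed
  qed
  then show ?thesis using left_factor_nonempty by (auto simp: lyndon_word_def)
qed

end

text \<open>Proper suffixes reaching into \<open>u\<close> have the form \<open>t @ v\<close> with
  \<open>t\<close> at least \<open>right_factor u\<close>, hence at least \<open>v\<close>. The side
  condition decides in the spanning argument whether \<open>[u,v]\<close> is already a Lyndon
  bracket or has to be rearranged.\<close>

lemma factors_lyndon_append:
  assumes u: "lyndon_word u" and v: "lyndon_word v"
    and uv: "length u = 1 \<or> v \<le> right_factor u"
  shows "right_factor (u @ v) = v" "left_factor (u @ v) = u"
proof -
  have ne: "u \<noteq> []" "v \<noteq> []" using u v by (auto simp: lyndon_word_def)
  have len: "2 \<le> length (u @ v)" using ne by (cases u; cases v) auto
  have "v \<le> s" if ps: "u @ v = p @ s" "p \<noteq> []" "s \<noteq> []" for p s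
  proof -
    consider t where "t \<noteq> []" "u = p @ t" "s = t @ v" | t where "p = u @ t" "v = t @ s"
      using ps(1) unfolding append_eq_append_conv2
      by (metis append.right_neutral append_Nil)
    then show ?thesis
    proof cases
      case 1
      then have "length u \<noteq> 1" using ps by (cases p; cases t) auto
      then have lu: "2 \<le> length u" using ne by (cases u) (auto simp: Suc_le_eq)
      have "v \<le> t" using right_factor_le[OF lu 1(2) ps(2) 1(1)] uv \<open>length u \<noteq> 1\<close> by auto
      then show ?thesis using 1 le_append[of t v] by (metis order.trans)
    next
      case 2
      then show ?thesis using lyndon_word_suffix_ge v ps(3) by blast
    qed
  qed
  from right_factor_eqI[OF len refl ne this]
  show "right_factor (u @ v) = v" "left_factor (u @ v) = u" by auto
qed

text \<open>Lets one recursion bracket Lyndon words and squares alike, in agreement with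
  \<open>\<Sigma>(F \<circ> F) = (F, F)\<close>.\<close>

lemma factors_square:
  assumes k: "lyndon_word k"
  shows "right_factor (k @ k) = k" "left_factor (k @ k) = k"
proof -
  have ne: "k \<noteq> []" using k by (auto simp: lyndon_word_def)
  have len: "2 \<le> length (k @ k)" using ne by (cases k) auto
  have "k \<le> s" if ps: "k @ k = p @ s" "p \<noteq> []" "s \<noteq> []" for p s
  proof -
    consider t where "t \<noteq> []" "k = p @ t" "s = t @ k" | t where "p = k @ t" "k = t @ s"
      using ps(1) unfolding append_eq_append_conv2
      by (metis append.right_neutral append_Nil)
    then show ?thesis
    proof cases
      case 1
      then have "k \<le> t" using lyndon_word_suffix_ge k ps by metis
      then show ?thesis using 1 le_append[of t k] by (metis order.trans)
    next
      case 2
      then show ?thesis using lyndon_word_suffix_ge k ps(3) by blast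
    qed
  qed
  from right_factor_eqI[OF len refl ne ne this]
  show "right_factor (k @ k) = k" "left_factor (k @ k) = k" by auto
qed

text \<open>Defined on all words, so that the recursion needs no Lyndon hypothesis; the value on the
  empty word is arbitrary.\<close>

function bracketing :: "'i::linorder list \<Rightarrow> 'i magma" where
  "bracketing w = (if length w < 2 then Gen (hd w)
     else Br (bracketing (left_factor w)) (bracketing (right_factor w)))"
  by auto
termination
proof (relation "measure length", simp_all add: not_less)
  fix w :: "'i::linorder list" assume len: "2 \<le> length w"
  have "length w = length (left_factor w) + length (right_factor w)"
    using factors_append[OF len] by (metis length_append)
  moreover have "length (left_factor w) > 0" "length (right_factor w) > 0"
    using left_factor_nonempty[OF len] right_factor_nonempty[OF len] by simp_all
  ultimately show "length (left_factor w) < length w" "length (right_factor w) < length w" by linarith+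
qed

declare bracketing.simps [simp del]

lemma bracketing_singleton [simp]: "bracketing [a] = Gen a"
  by (simp add: bracketing.simps)

lemma bracketing_long:
  "2 \<le> length w \<Longrightarrow> bracketing w = Br (bracketing (left_factor w)) (bracketing (right_factor w))"
  by (subst bracketing.simps) auto

lemma bracketing_append:
  assumes "lyndon_word u" "lyndon_word v" "length u = 1 \<or> v \<le> right_factor u"
  shows "bracketing (u @ v) = Br (bracketing u) (bracketing v)"
proof -
  have "2 \<le> length (u @ v)" using assms(1,2) by (cases u; cases v) (auto simp: lyndon_word_def)
  then show ?thesis by (simp add: bracketing_long factors_lyndon_append[OF assms])
qed

lemma bracketing_square:
  assumes "lyndon_word k" shows "bracketing (k @ k) = Br (bracketing k) (bracketing k)"
proof -
  have "2 \<le> length (k @ k)" using assms by (cases k) (auto simp: lyndon_word_def)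
  then show ?thesis by (simp add: bracketing_long factors_square[OF assms])
qed

section \<open>Words and heaps\<close>

locale graph_heaps =
  fixes adj :: "'i::linorder \<Rightarrow> 'i \<Rightarrow> bool"
  assumes symp_adj: "symp adj"
begin

definition indep :: "'i \<Rightarrow> 'i \<Rightarrow> bool" where
  "indep a b \<longleftrightarrow> a \<noteq> b \<and> \<not> adj a b"

lemma indep_sym: "indep a b \<Longrightarrow> indep b a"
  using symp_adj by (auto simp: indep_def symp_def)

lemma indep_irrefl [simp]: "\<not> indep a a"
  by (simp add: indep_def)

abbreviation heap_eq :: "'i list \<Rightarrow> 'i list \<Rightarrow> bool" (infix "\<approx>" 50) where
  "u \<approx> v \<equiv> equivclp (swap adj) u v"

lemma swap_iff: "swap adj v w \<longleftrightarrow> (\<exists>x y a b. indep a b \<and> v = x @ [a, b] @ y \<and> w = x @ [b, a] @ y)"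
  by (auto simp: swap_def indep_def)

lemma swap_sym: "swap adj v w \<Longrightarrow> swap adj w v"
  unfolding swap_iff using indep_sym by blast

lemma heap_eq_sym: "u \<approx> v \<Longrightarrow> v \<approx> u"
  by (rule equivclp_sym)

lemma heap_eq_trans [trans]: "u \<approx> v \<Longrightarrow> v \<approx> w \<Longrightarrow> u \<approx> w"
  by (rule equivclp_trans)

text \<open>Since \<open>swap\<close> is symmetric, the forward and backward steps of the
  equivalence closure are of one kind, and a single case remains.\<close>

lemma heap_eq_induct [consumes 1, case_names refl swap]:
  assumes "u \<approx> v" "P u"
    and "\<And>x y a b. u \<approx> x @ a # b # y \<Longrightarrow> indep a b \<Longrightarrow> P (x @ a # b # y) \<Longrightarrow> P (x @ b # a # y)"
  shows "P v"
  using assms(1,2)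
proof (induction rule: equivclp_induct)
  case (step y z)
  then have "swap adj y z" using swap_sym by blast
  then show ?case using step assms(3) by (auto simp: swap_iff)
qed

lemma swap_heap_eq: "indep a b \<Longrightarrow> x @ a # b # y \<approx> x @ b # a # y"
  by (rule r_into_equivclp) (auto simp: swap_iff)

lemma heap_eq_append_left: "u \<approx> v \<Longrightarrow> x @ u \<approx> x @ v"
proof (induction rule: heap_eq_induct)
  case (swap z y a b)
  then show ?case using heap_eq_trans[OF swap(3) swap_heap_eq[OF swap(2), of "x @ z" y, simplified]] by simp
qed simp

lemma heap_eq_append_right: "u \<approx> v \<Longrightarrow> u @ x \<approx> v @ x"
proof (induction rule: heap_eq_induct)
  case (swap z y a b)
  then show ?case using heap_eq_trans[OF _ swap_heap_eq[OF swap(2), of z "y @ x"]] by simp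
qed simp

lemma heap_eq_Cons: "u \<approx> v \<Longrightarrow> a # u \<approx> a # v"
  using heap_eq_append_left[of u v "[a]"] by simp

lemma heap_eq_append: "u \<approx> v \<Longrightarrow> x \<approx> y \<Longrightarrow> u @ x \<approx> v @ y"
  by (rule heap_eq_trans[OF heap_eq_append_left heap_eq_append_right])

lemma heap_eq_rev: "u \<approx> v \<Longrightarrow> rev u \<approx> rev v"
proof (induction rule: heap_eq_induct)
  case (swap z y a b)
  then show ?case
    using heap_eq_trans[OF _ swap_heap_eq[OF indep_sym[OF swap(2)], of "rev y" "rev z"]] by simp
qed simp

lemma heap_eq_mset: "u \<approx> v \<Longrightarrow> mset u = mset v"
  by (induction rule: heap_eq_induct) auto

lemma heap_eq_length: "u \<approx> v \<Longrightarrow> length u = length v"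
  using heap_eq_mset mset_eq_length by blast

lemma heap_eq_set: "u \<approx> v \<Longrightarrow> set u = set v"
  using heap_eq_mset mset_eq_setD by blast

lemma heap_eq_Nil [simp]: "u \<approx> [] \<longleftrightarrow> u = []" "[] \<approx> u \<longleftrightarrow> u = []"
  using heap_eq_length by force+

section \<open>Moving letters, cancellation and Levi's lemma\<close>

lemma move_left: "(\<And>b. b \<in> set x \<Longrightarrow> indep a b) \<Longrightarrow> x @ a # y \<approx> a # x @ y"
proof (induction x)
  case (Cons b x)
  have "b # x @ a # y \<approx> b # a # x @ y" using Cons by (intro heap_eq_Cons) auto
  also have "\<dots> \<approx> a # b # x @ y" using swap_heap_eq[of b a "[]"] Cons.prems indep_sym by auto
  finally show ?case by simp
qed simp

text \<open>The letter \<open>a\<close> is followed through all swaps; the four cases place the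
  swapped pair after it, before it, or with \<open>a\<close> as its left or right member.
  Cancellation and Levi's lemma both rest on this.\<close>

lemma heap_eq_ConsE:
  assumes "a # u \<approx> y"
  obtains y1 y2 where "y = y1 @ a # y2" "\<And>b. b \<in> set y1 \<Longrightarrow> indep a b" "u \<approx> y1 @ y2"
proof -
  have "\<exists>y1 y2. y = y1 @ a # y2 \<and> (\<forall>b\<in>set y1. indep a b) \<and> u \<approx> y1 @ y2"
    using assms
  proof (induction rule: heap_eq_induct)
    case refl
    show ?case by (rule exI[of _ "[]"]) auto
  next
    case (swap x y c d)
    then obtain y1 y2 where y: "x @ c # d # y = y1 @ a # y2" "\<forall>b\<in>set y1. indep a b" "u \<approx> y1 @ y2"
      by blast
    consider "x = y1" "c = a" "d # y = y2"
      | us where "x = y1 @ a # us" "us @ c # d # y = y2"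
      | "y1 = x @ [c]" "d = a" "y = y2"
      | us where "y1 = x @ c # d # us" "y = us @ a # y2"
      using y(1) unfolding append_eq_append_conv2 by (auto simp: Cons_eq_append_conv append_eq_Cons_conv)
    then show ?case
    proof cases
      case 1
      then show ?thesis
        using y swap(2) by (intro exI[of _ "y1 @ [d]"] exI[of _ y]) auto
    next
      case (2 us)
      have "u \<approx> y1 @ us @ d # c # y"
        using y(3) 2 heap_eq_trans[OF _ swap_heap_eq[OF swap(2), of "y1 @ us" y]] by simp
      then show ?thesis
        using y 2 by (intro exI[of _ y1] exI[of _ "us @ d # c # y"]) auto
    next
      case 3
      then show ?thesis
        using y by (intro exI[of _ x] exI[of _ "c # y"]) auto
    next
      case (4 us)
      have "u \<approx> (x @ d # c # us) @ y2"
        using y(3) 4 heap_eq_trans[OF _ swap_heap_eq[OF swap(2), of x "us @ y2"]] by simp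
      then show ?thesis
        using y 4 by (intro exI[of _ "x @ d # c # us"] exI[of _ y2]) auto
    qed
  qed
  then show thesis using that by blast
qed

lemma heap_eq_Cons_cancel: "a # u \<approx> a # v \<longleftrightarrow> u \<approx> v"
proof
  assume "a # u \<approx> a # v"
  then obtain y1 y2 where y: "a # v = y1 @ a # y2" "\<And>b. b \<in> set y1 \<Longrightarrow> indep a b" "u \<approx> y1 @ y2"
    by (rule heap_eq_ConsE) blast
  have "y1 = []" using y(1) y(2)[of a] by (cases y1) auto
  then show "u \<approx> v" using y by simp
qed (rule heap_eq_Cons)

lemma heap_eq_cancel_left [simp]: "x @ u \<approx> x @ v \<longleftrightarrow> u \<approx> v"
  by (induction x) (auto simp: heap_eq_Cons_cancel)

lemma heap_eq_cancel_right [simp]: "u @ x \<approx> v @ x \<longleftrightarrow> u \<approx> v"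
proof
  assume "u @ x \<approx> v @ x"
  then have "rev u \<approx> rev v" using heap_eq_rev by fastforce
  then show "u \<approx> v" using heap_eq_rev by fastforce
qed (rule heap_eq_append_right)

text \<open>Levi's lemma for traces, by induction on \<open>u\<close>. The head of \<open>u\<close>
  is located in \<open>y @ z\<close>: found in \<open>y\<close> it joins \<open>p\<close>; found in
  \<open>z\<close> it has passed all of \<open>y\<close>, so it commutes with \<open>p\<close> and
  \<open>r\<close> and can join \<open>q\<close>.\<close>

lemma levi:
  assumes "u @ v \<approx> y @ z"
  obtains p q r s where "u \<approx> p @ q" "v \<approx> r @ s" "y \<approx> p @ r" "z \<approx> q @ s"
    "\<And>a b. a \<in> set q \<Longrightarrow> b \<in> set r \<Longrightarrow> indep a b"
proof -
  have "\<exists>p q r s. u \<approx> p @ q \<and> v \<approx> r @ s \<and> y \<approx> p @ r \<and> z \<approx> q @ s \<and>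
      (\<forall>a\<in>set q. \<forall>b\<in>set r. indep a b)"
    using assms
  proof (induction u arbitrary: y z)
    case Nil
    then show ?case by (intro exI[of _ "[]"] exI[of _ y] exI[of _ z]) auto
  next
    case (Cons a u)
    from Cons.prems have "a # (u @ v) \<approx> y @ z" by simp
    then obtain y1 y2 where y: "y @ z = y1 @ a # y2" "\<And>b. b \<in> set y1 \<Longrightarrow> indep a b" "u @ v \<approx> y1 @ y2"
      by (rule heap_eq_ConsE) blast
    consider us where "y = y1 @ a # us" "y2 = us @ z" | us where "y1 = y @ us" "z = us @ a # y2"
      using y(1) unfolding append_eq_append_conv2 by (auto simp: Cons_eq_append_conv append_eq_Cons_conv)
    then show ?case
    proof cases
      case (1 us)
      then have "u @ v \<approx> (y1 @ us) @ z" using y(3) by simp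
      then obtain p q r s where pq: "u \<approx> p @ q" "v \<approx> r @ s" "y1 @ us \<approx> p @ r" "z \<approx> q @ s"
        "\<forall>a\<in>set q. \<forall>b\<in>set r. indep a b" using Cons.IH by blast
      have "y \<approx> a # y1 @ us" using 1 move_left y(2) by simp
      also have "\<dots> \<approx> (a # p) @ r" using heap_eq_Cons[OF pq(3)] by simp
      finally show ?thesis
        using pq heap_eq_Cons[OF pq(1)] by (intro exI[of _ "a # p"] exI[of _ q] exI[of _ r] exI[of _ s]) auto
    next
      case (2 us)
      then have "u @ v \<approx> y @ (us @ y2)" using y(3) by simp
      then obtain p q r s where pq: "u \<approx> p @ q" "v \<approx> r @ s" "y \<approx> p @ r" "us @ y2 \<approx> q @ s"
        "\<forall>a\<in>set q. \<forall>b\<in>set r. indep a b" using Cons.IH by blast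
      have ay: "indep a b" if "b \<in> set y" for b using that y(2) 2 by auto
      have set_y: "set y = set p \<union> set r" using heap_eq_set[OF pq(3)] by simp
      have "a # u \<approx> a # p @ q" using heap_eq_Cons[OF pq(1)] .
      also have "\<dots> \<approx> p @ a # q" using ay set_y by (intro heap_eq_sym[OF move_left]) auto
      finally have "a # u \<approx> p @ a # q" .
      moreover have "z \<approx> (a # q) @ s"
      proof -
        have "z \<approx> a # us @ y2" using 2 move_left[of us a y2] y(2) by auto
        also have "\<dots> \<approx> a # q @ s" using heap_eq_Cons[OF pq(4)] .
        finally show ?thesis by simp
      qed
      ultimately show ?thesis
        using pq ay set_y by (intro exI[of _ p] exI[of _ "a # q"] exI[of _ r] exI[of _ s]) auto
    qed
  qed
  then show thesis using that by blast
qed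

section \<open>Heaps as classes of words, and standard words\<close>

lemma heap_of_eq_iff: "heap_of adj u = heap_of adj v \<longleftrightarrow> u \<approx> v"
  unfolding heap_of_def by (auto intro: heap_eq_sym heap_eq_trans)

lemma mem_heap_of: "v \<in> heap_of adj w \<longleftrightarrow> w \<approx> v"
  by (simp add: heap_of_def)

lemma finite_heap_of: "finite (heap_of adj w)"
proof (rule finite_subset)
  show "heap_of adj w \<subseteq> {v. mset v = mset w}" by (auto simp: mem_heap_of heap_eq_mset)
  show "finite {v. mset v = mset w}" by (rule mset_eq_finite)
qed

lemma superpose_heap_of: "superpose adj (heap_of adj u) (heap_of adj v) = heap_of adj (u @ v)"
proof -
  have *: "heap_of adj (x @ y) = heap_of adj (u @ v)" if "u \<approx> x" "v \<approx> y" for x y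
    using heap_eq_append[OF that] by (simp add: heap_of_eq_iff heap_eq_sym)
  have "superpose adj (heap_of adj u) (heap_of adj v) =
      (\<Union>x\<in>heap_of adj u. \<Union>y\<in>heap_of adj v. heap_of adj (u @ v))"
    unfolding superpose_def by (intro SUP_cong refl *) (simp_all only: mem_heap_of)
  moreover have "u \<in> heap_of adj u" "v \<in> heap_of adj v" by (simp_all add: mem_heap_of)
  ultimately show ?thesis by auto
qed

lemma heap_of_eq_empty: "heap_of adj w = empty_heap adj \<longleftrightarrow> w = []"
  by (simp add: empty_heap_def heap_of_eq_iff)

definition standard :: "'i list \<Rightarrow> bool" where
  "standard w \<longleftrightarrow> (\<forall>v. w \<approx> v \<longrightarrow> v \<le> w)"

lemma standard_word_heap_of:
  shows heap_eq_standard_word: "w \<approx> standard_word (heap_of adj w)"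
    and standard_standard_word: "standard (standard_word (heap_of adj w))"
    and standard_word_ge: "w \<approx> v \<Longrightarrow> v \<le> standard_word (heap_of adj w)"
proof -
  have "w \<in> heap_of adj w" by (simp add: mem_heap_of)
  then have "heap_of adj w \<noteq> {}" by blast
  then show 1: "w \<approx> standard_word (heap_of adj w)"
    using Max_in[OF finite_heap_of[of w]] unfolding standard_word_def mem_heap_of[symmetric] by blast
  show 2: "w \<approx> v \<Longrightarrow> v \<le> standard_word (heap_of adj w)" for v
    using Max_ge[OF finite_heap_of] by (simp add: standard_word_def mem_heap_of)
  show "standard (standard_word (heap_of adj w))"
    unfolding standard_def using 2 heap_eq_trans[OF 1] by blast
qed

lemma standard_word_eq: "standard w \<Longrightarrow> standard_word (heap_of adj w) = w"
  using heap_eq_standard_word[of w] standard_word_ge[of w w] by (auto simp: standard_def intro: antisym)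

lemma heap_obtain_standard:
  assumes "E \<in> heaps adj" obtains w where "E = heap_of adj w" "standard w" "standard_word E = w"
proof -
  obtain v where "E = heap_of adj v" using assms by (auto simp: heaps_def)
  then show thesis
    using that[of "standard_word E"] heap_eq_standard_word[of v] standard_standard_word[of v]
    by (simp add: heap_of_eq_iff)
qed

lemma heap_of_in_heaps [simp]: "heap_of adj w \<in> heaps adj"
  by (simp add: heaps_def)

lemma standard_unique: "standard u \<Longrightarrow> standard v \<Longrightarrow> u \<approx> v \<Longrightarrow> u = v"
  unfolding standard_def using heap_eq_sym by (blast intro: antisym)

lemma standard_suffix: "standard (x @ y) \<Longrightarrow> standard y"
  unfolding standard_def using append_le_append heap_eq_append_left by blast

text \<open>Equivalent words have equal length, so a larger representative of the prefix would
  enlarge the whole word whatever follows.\<close>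

lemma standard_prefix: "standard (x @ y) \<Longrightarrow> standard x"
  unfolding standard_def
proof (intro allI impI)
  fix v assume st: "\<forall>v. x @ y \<approx> v \<longrightarrow> v \<le> x @ y" and xv: "x \<approx> v"
  show "v \<le> x"
  proof (rule ccontr)
    assume "\<not> v \<le> x"
    then have "x @ y < v @ y" using heap_eq_length[OF xv] by (simp add: less_append_same_length)
    moreover have "v @ y \<le> x @ y" using st heap_eq_append_right[OF xv, of y] by blast
    ultimately show False by simp
  qed
qed

lemma descending_factor_not_standard:
  assumes "a < b" "\<And>c. c \<in> set (a # u) \<Longrightarrow> indep b c"
  shows "\<not> standard (x @ a # u @ b # y)"
proof
  assume st: "standard (x @ a # u @ b # y)"
  have "x @ (a # u) @ b # y \<approx> x @ b # (a # u) @ y"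
    using assms(2) by (intro heap_eq_append_left move_left) auto
  then have "x @ b # (a # u) @ y \<le> x @ a # u @ b # y" using st by (simp only: standard_def append_Cons)
  then show False using assms(1) by (simp only: append_le_append Cons_le_Cons append_Cons) auto
qed

text \<open>The criterion of Anisimov and Knuth, with the inner word chosen as short as possible.\<close>

lemma not_standardE:
  assumes "\<not> standard w"
  obtains x a u b y where "w = x @ a # u @ b # y" "a < b" "indep b a"
    "\<And>c. c \<in> set u \<Longrightarrow> indep b c \<and> b < c"
proof -
  obtain v where v: "w \<approx> v" "w < v" using assms by (auto simp: standard_def not_le)
  then have "lex_below w v" using heap_eq_length by (intro lex_belowI) auto
  then obtain x a b w' v' where wv: "w = x @ a # w'" "v = x @ b # v'" "a < b"
    unfolding lex_below_def by blast
  \<comment> \<open>Cancelling the common prefix leaves \<open>b\<close> at the head of a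
    representative of \<open>a # w'\<close>; so \<open>b\<close> occurs there with only commuting
    letters before it, among them \<open>a\<close>.\<close>
  then have "b # v' \<approx> a # w'" using v heap_eq_sym by simp
  then obtain y1 y2 where y: "a # w' = y1 @ b # y2" "\<And>c. c \<in> set y1 \<Longrightarrow> indep b c"
    by (rule heap_eq_ConsE) blast
  have "a \<in> set y1" using y(1) wv(3) by (cases y1) auto
  then have "\<exists>c\<in>set y1. c < b" using wv(3) by blast
  then obtain ys a' u where u: "y1 = ys @ a' # u" "a' < b" "\<forall>c\<in>set u. \<not> c < b"
    using split_list_last_prop[of y1 "\<lambda>c. c < b"] by blast
  have "b < c" if "c \<in> set u" for c
  proof -
    have "indep b c" using y(2) u(1) that by auto
    then have "b \<noteq> c" by (auto simp: indep_def)
    then show ?thesis using u(3) that by auto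
  qed
  then show thesis using that[of "x @ ys" a' u b y2] wv(1) y u(1,2) by auto
qed

subsection \<open>Lyndon heaps are the heaps of standard Lyndon words\<close>

text \<open>Read \<open>w\<close> from the left up to the first letter belonging to
  \<open>v\<close>: the letters passed form \<open>p\<close>, and \<open>u'\<close> is the rest of
  \<open>u\<close>, overtaken by \<open>b\<close>. This relates a right factor of the heap to a
  genuine suffix of the word.\<close>

lemma first_letter_of_suffix:
  assumes "w \<approx> u @ v" "v \<noteq> []"
  obtains p b s u' v' where "w = p @ b # s" "u \<approx> p @ u'" "v \<approx> b # v'" "b # s \<approx> u' @ b # v'"
    "\<And>c. c \<in> set u' \<Longrightarrow> indep b c"
proof -
  have "\<exists>p b s u' v'. w = p @ b # s \<and> u \<approx> p @ u' \<and> v \<approx> b # v' \<and> b # s \<approx> u' @ b # v' \<and>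
      (\<forall>c\<in>set u'. indep b c)"
    using assms(1)
  proof (induction w arbitrary: u)
    case Nil
    then show ?case using assms(2) by simp
  next
    case (Cons c w)
    then obtain y1 y2 where y: "u @ v = y1 @ c # y2" "\<And>b. b \<in> set y1 \<Longrightarrow> indep c b" "w \<approx> y1 @ y2"
      using heap_eq_ConsE[OF Cons.prems] by blast
    consider us where "u = y1 @ c # us" "y2 = us @ v" | us where "y1 = u @ us" "v = us @ c # y2"
      using y(1) unfolding append_eq_append_conv2 by (auto simp: Cons_eq_append_conv append_eq_Cons_conv)
    then show ?case
    proof cases
      case (1 us)
      then have "w \<approx> (y1 @ us) @ v" using y(3) by simp
      then obtain p b s u' v' where p: "w = p @ b # s" "y1 @ us \<approx> p @ u'" "v \<approx> b # v'"
        "b # s \<approx> u' @ b # v'" "\<forall>c\<in>set u'. indep b c" using Cons.IH by blast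
      have "u \<approx> c # y1 @ us" using 1 move_left y(2) by simp
      also have "\<dots> \<approx> (c # p) @ u'" using heap_eq_Cons[OF p(2)] by simp
      finally show ?thesis
        using p by (intro exI[of _ "c # p"] exI[of _ b] exI[of _ s] exI[of _ u'] exI[of _ v']) auto
    next
      case (2 us)
      have "v \<approx> c # us @ y2" using 2 move_left y(2) by simp
      moreover from this have "c # w \<approx> u @ c # us @ y2"
        using heap_eq_trans[OF Cons.prems heap_eq_append_left] by blast
      moreover have "indep c b" if "b \<in> set u" for b using that y(2) 2 by simp
      ultimately show ?thesis
        by (intro exI[of _ "[]"] exI[of _ c] exI[of _ w] exI[of _ u] exI[of _ "us @ y2"]) auto
    qed
  qed
  then show thesis using that by blast
qed

text \<open>The overtaken first letter \<open>c\<close> of \<open>u\<close> could also stand in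
  front. As \<open>b # s\<close> is the largest representative, \<open>c\<close> is smaller than
  \<open>b\<close>, and it still occurs in \<open>s\<close>.\<close>

lemma standard_skipped_letter:
  assumes "standard (b # s)" "b # s \<approx> u @ b # v" "u \<noteq> []" "\<And>c. c \<in> set u \<Longrightarrow> indep b c"
  obtains c where "c \<in> set s" "c < b"
proof -
  obtain c u' where u: "u = c # u'" using assms(3) by (cases u) auto
  have "b \<noteq> c" using assms(4)[of c] u by (auto simp: indep_def)
  moreover have "c # u' @ b # v \<le> b # s" using assms(1,2) u unfolding standard_def by (metis append_Cons)
  ultimately have "c < b" by auto
  moreover have "c \<in> set (b # s)" using heap_eq_set[OF assms(2)] u by auto
  ultimately show thesis using that \<open>b \<noteq> c\<close> by auto
qed

text \<open>The heap version of "smaller than every proper suffix". If \<open>v\<close> can start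
  with the least letter \<open>hd w\<close>, nothing was overtaken, since a skipped letter would
  need a still smaller one; then \<open>v\<close> represents a genuine suffix. Otherwise the first
  letters decide.\<close>

lemma lyndon_below_heap_suffix:
  assumes w: "standard w" "lyndon_word w" and uv: "w \<approx> u @ v" and ne: "u \<noteq> []" "v \<noteq> []"
  obtains v0 where "v \<approx> v0" "lex_below w v0"
proof -
  from uv ne(2) obtain p b s u' v' where p: "w = p @ b # s" "u \<approx> p @ u'" "v \<approx> b # v'"
    "b # s \<approx> u' @ b # v'" "\<And>c. c \<in> set u' \<Longrightarrow> indep b c" by (rule first_letter_of_suffix) blast
  have min: "hd w \<le> c" if "c \<in> set w" for c using lyndon_word_hd_le w(2) that .
  then have "hd w \<le> b" using p(1) by auto
  show thesis
  proof (cases "hd w = b")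
    case True
    have "u' = []"
    proof (rule ccontr)
      assume "u' \<noteq> []"
      with standard_suffix[of p "b # s"] w(1) p(1,4,5) obtain c where "c \<in> set s" "c < b"
        by (metis standard_skipped_letter)
      then show False using min[of c] p(1) True by auto
    qed
    then have "b # s \<approx> b # v'" "u \<approx> p" using p(2,4) by simp_all
    then have "v \<approx> b # s" "p \<noteq> []" using heap_eq_trans[OF p(3) heap_eq_sym] ne(1) by auto
    then show thesis using that[of "b # s"] lyndon_word_below[of p "b # s"] w(2) p(1) by simp
  next
    case False
    then have "hd w < b" using \<open>hd w \<le> b\<close> by simp
    moreover have "w = [] @ hd w # tl w" using p(1) by simp
    ultimately have "lex_below w (b # v')" unfolding lex_below_def by (metis append_Nil)
    then show thesis using that p(3) by blast
  qed
qed

text \<open>A chain of transpositions becomes a single equation, because the intertwining words of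
  the steps can be concatenated. In this form Levi's lemma applies.\<close>

lemma conjugate_heap_intertwined:
  assumes "conjugate_heap adj (heap_of adj w) F"
  obtains f x where "F = heap_of adj f" "w @ x \<approx> x @ f"
proof -
  have transposed: "\<exists>u v. E = heap_of adj (u @ v) \<and> F = heap_of adj (v @ u)"
    if tr: "transpose_heap adj E F" for E F
  proof -
    obtain U V where U: "U \<in> heaps adj" "V \<in> heaps adj" "E = superpose adj U V" "F = superpose adj V U"
      using tr unfolding transpose_heap_def by blast
    then obtain u v where "U = heap_of adj u" "V = heap_of adj v" by (auto simp: heaps_def)
    then show ?thesis using U superpose_heap_of by blast
  qed
  have "\<exists>f x. F = heap_of adj f \<and> w @ x \<approx> x @ f"
    using assms unfolding conjugate_heap_def
  proof (induction rule: tranclp_induct)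
    case (base F)
    then obtain u v where "w \<approx> u @ v" "F = heap_of adj (v @ u)" by (auto dest!: transposed simp: heap_of_eq_iff)
    then show ?case
      using heap_eq_append_right[of w "u @ v" u] by (intro exI[of _ "v @ u"] exI[of _ u]) simp
  next
    case (step E F)
    then obtain e x u v where e: "w @ x \<approx> x @ e" "e \<approx> u @ v" "F = heap_of adj (v @ u)"
      using transposed[OF step.hyps(2)] by (auto simp: heap_of_eq_iff)
    have "w @ x @ u \<approx> x @ e @ u" using heap_eq_append_right[OF e(1), of u] by simp
    also have "\<dots> \<approx> x @ u @ v @ u" using heap_eq_append_right[OF e(2), of u] by simp
    finally show ?case using e(3) by (intro exI[of _ "v @ u"] exI[of _ "x @ u"]) simp
  qed
  then show thesis using that by blast
qed

text \<open>Levi's lemma gives \<open>w = p q\<close>, \<open>x = r s = p r\<close>,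
  \<open>f = q s\<close>. If \<open>p\<close> and \<open>q\<close> are both nonempty,
  \<open>q\<close> has a representative above \<open>w\<close> at a differing letter, and so does
  \<open>f\<close>. If \<open>q\<close> is empty, a copy of \<open>w\<close> is cancelled from
  \<open>x\<close>, which is the induction step.\<close>

lemma lyndon_le_conjugate:
  assumes w: "standard w" "lyndon_word w" and "w @ x \<approx> x @ f"
  shows "w \<le> standard_word (heap_of adj f)"
  using assms(3)
proof (induction "length x" arbitrary: x rule: less_induct)
  case less
  obtain p q r s where pq: "w \<approx> p @ q" "x \<approx> r @ s" "x \<approx> p @ r" "f \<approx> q @ s"
    using less.prems by (rule levi) blast
  have w_ne: "w \<noteq> []" using w by (simp add: lyndon_word_def)
  consider "q = []" | "p = []" | "p \<noteq> []" "q \<noteq> []" by blast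
  then show ?case
  proof cases
    case 1
    then have "p \<approx> w" using heap_eq_sym[OF pq(1)] by simp
    then have wr: "x \<approx> w @ r" using heap_eq_trans[OF pq(3) heap_eq_append_right] by blast
    have "w @ w @ r \<approx> w @ x" using heap_eq_append_left[OF heap_eq_sym[OF wr]] .
    also have "\<dots> \<approx> x @ f" by (rule less.prems)
    also have "\<dots> \<approx> w @ r @ f" using heap_eq_append_right[OF wr, of f] by simp
    finally have "w @ r \<approx> r @ f" by simp
    moreover have "length r < length x" using heap_eq_length[OF wr] w_ne by simp
    ultimately show ?thesis using less.hyps by blast
  next
    case 2
    \<comment> \<open>Compare lengths: \<open>x\<close> is equivalent to \<open>r @ s\<close> and,
      as \<open>p\<close> is empty, to \<open>r\<close>.\<close>
    then have "s = []" using heap_eq_length[OF pq(2)] heap_eq_length[OF pq(3)] by simp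
    then have "f \<approx> q" "q \<approx> w" using pq(4) heap_eq_sym[OF pq(1)] 2 by simp_all
    then have "f \<approx> w" by (rule heap_eq_trans)
    then show ?thesis by (rule standard_word_ge)
  next
    case 3
    then obtain q0 where q0: "q \<approx> q0" "lex_below w q0"
      using lyndon_below_heap_suffix[OF w pq(1)] by blast
    have "f \<approx> q0 @ s" using pq(4) heap_eq_append_right[OF q0(1)] heap_eq_trans by blast
    then have "q0 @ s \<le> standard_word (heap_of adj f)" by (rule standard_word_ge)
    moreover have "w < q0 @ s" using lex_below_append_less[OF q0(2), of "[]" s] by simp
    ultimately show ?thesis by simp
  qed
qed

text \<open>Minimality is \<open>lyndon_le_conjugate\<close>. For primitivity, factorizations
  \<open>w = u v = v u\<close> would give a representative starting with a word above
  \<open>w\<close>, although \<open>w\<close> is the largest.\<close>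

lemma lyndon_heap_of:
  assumes w: "standard w" "lyndon_word w"
  shows "lyndon_heap adj (heap_of adj w)"
  unfolding lyndon_heap_def
proof (intro conjI allI impI)
  show "heap_of adj w \<noteq> empty_heap adj" using w by (simp add: heap_of_eq_empty lyndon_word_def)
  show "primitive_heap adj (heap_of adj w)"
    unfolding primitive_heap_def
  proof (intro ballI impI)
    fix U V
    assume "U \<in> heaps adj" "V \<in> heaps adj"
    then obtain u v where UV: "U = heap_of adj u" "V = heap_of adj v" by (auto simp: heaps_def)
    assume "heap_of adj w = superpose adj U V \<and> heap_of adj w = superpose adj V U"
    then have eq: "w \<approx> u @ v" "w \<approx> v @ u" by (auto simp: UV superpose_heap_of heap_of_eq_iff)
    have "u = [] \<or> v = []"
    proof (rule ccontr)
      assume "\<not> (u = [] \<or> v = [])"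
      then obtain v0 where v0: "v \<approx> v0" "lex_below w v0" using lyndon_below_heap_suffix[OF w eq(1)] by blast
      have "w \<approx> v0 @ u" using eq(2) heap_eq_append_right[OF v0(1)] heap_eq_trans by blast
      then have "v0 @ u \<le> w" using w(1) by (simp add: standard_def)
      then show False using lex_below_append_less[OF v0(2), of "[]" u] by simp
    qed
    then show "U = empty_heap adj \<or> V = empty_heap adj" by (simp add: UV heap_of_eq_empty)
  qed
  fix F assume "conjugate_heap adj (heap_of adj w) F"
  then show "heap_le (heap_of adj w) F"
    using lyndon_le_conjugate[OF w] standard_word_eq[OF w(1)]
    by (auto simp: heap_le_def elim!: conjugate_heap_intertwined)
qed simp

lemma conjugate_heap_rotate:
  assumes "conjugate_heap adj E (heap_of adj (u @ v))" shows "conjugate_heap adj E (heap_of adj (v @ u))"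
proof -
  have "transpose_heap adj (heap_of adj (u @ v)) (heap_of adj (v @ u))"
    unfolding transpose_heap_def using superpose_heap_of heap_of_in_heaps by metis
  then show ?thesis using assms unfolding conjugate_heap_def by (rule tranclp.trancl_into_trancl[rotated])
qed

lemma conjugate_heap_refl: "conjugate_heap adj (heap_of adj w) (heap_of adj w)"
proof -
  have "transpose_heap adj (heap_of adj w) (heap_of adj w)"
    unfolding transpose_heap_def using superpose_heap_of[of w "[]"] superpose_heap_of[of "[]" w]
    by (metis append_Nil append_Nil2 heap_of_in_heaps)
  then show ?thesis unfolding conjugate_heap_def by blast
qed

section \<open>From Lyndon heaps to Lyndon words: connectedness and pyramids\<close>

lemma heap_eq_filter:
  assumes "\<And>a b. a \<in> set w \<Longrightarrow> b \<in> set w \<Longrightarrow> P a \<Longrightarrow> \<not> P b \<Longrightarrow> indep a b"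
  shows "w \<approx> filter P w @ filter (\<lambda>a. \<not> P a) w"
  using assms
proof (induction w)
  case (Cons a w)
  have IH: "a # w \<approx> a # filter P w @ filter (\<lambda>a. \<not> P a) w" using Cons by (intro heap_eq_Cons) auto
  have "a # filter P w @ filter (\<lambda>a. \<not> P a) w \<approx> filter P w @ a # filter (\<lambda>a. \<not> P a) w" if "\<not> P a"
    using Cons.prems that indep_sym by (intro heap_eq_sym[OF move_left]) auto
  then show ?case using heap_eq_trans[OF IH] IH by auto
qed simp

text \<open>If the letters inside and outside \<open>P\<close> commuted throughout, the heap would
  be the product of two nonempty factors in either order.\<close>

lemma primitive_heap_connected:
  assumes prim: "primitive_heap adj (heap_of adj w)" and ab: "a \<in> set w" "b \<in> set w" "P a" "\<not> P b"
  obtains c d where "c \<in> set w" "d \<in> set w" "P c" "\<not> P d" "\<not> indep c d"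
proof (rule ccontr)
  assume "\<not> thesis"
  with that have ind: "\<And>c d. c \<in> set w \<Longrightarrow> d \<in> set w \<Longrightarrow> P c \<Longrightarrow> \<not> P d \<Longrightarrow> indep c d" by blast
  let ?u = "filter P w" and ?v = "filter (\<lambda>a. \<not> P a) w"
  have 1: "w \<approx> ?u @ ?v" using ind by (rule heap_eq_filter)
  have "w \<approx> ?v @ filter (\<lambda>a. \<not> \<not> P a) w" using ind indep_sym by (intro heap_eq_filter) auto
  then have 2: "w \<approx> ?v @ ?u" by simp
  have "heap_of adj ?u = empty_heap adj \<or> heap_of adj ?v = empty_heap adj"
    using prim 1 2 unfolding primitive_heap_def
    by (metis heap_of_eq_iff heap_of_in_heaps superpose_heap_of)
  then show False using ab by (auto simp: heap_of_eq_empty filter_empty_conv)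
qed

text \<open>A pyramid in the sense of Viennot: only one piece of the heap can come first, and it is
  labelled \<open>m\<close>.\<close>

definition pyramid :: "'i \<Rightarrow> 'i list \<Rightarrow> bool" where
  "pyramid m v \<longleftrightarrow> v \<noteq> [] \<and> (\<forall>y. v \<approx> y \<longrightarrow> hd y = m)"

text \<open>The new letter is stuck behind \<open>d\<close>, so it cannot become a first
  letter.\<close>

lemma pyramid_snoc:
  assumes v: "pyramid m v" and c: "d \<in> set v" "\<not> indep c d"
  shows "pyramid m (v @ [c])"
  unfolding pyramid_def
proof (intro conjI allI impI)
  fix y assume vy: "v @ [c] \<approx> y"
  then obtain a y' where y: "y = a # y'" by (cases y) auto
  then have "a # y' \<approx> v @ [c]" using heap_eq_sym[OF vy] by simp
  then obtain y1 y2 where y12: "v @ [c] = y1 @ a # y2" "\<And>b. b \<in> set y1 \<Longrightarrow> indep a b"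
    by (rule heap_eq_ConsE) blast
  show "hd y = m"
  proof (cases y2 rule: rev_cases)
    case Nil
    then have "v = y1" "c = a" using y12(1) by auto
    then show ?thesis using y12(2) c by blast
  next
    case (snoc y2' e)
    then have "v = y1 @ a # y2'" using y12(1) by auto
    then have "v \<approx> a # y1 @ y2'" using move_left y12(2) by simp
    then have "hd (a # y1 @ y2') = m" using v unfolding pyramid_def by blast
    then show ?thesis using y by simp
  qed
qed simp

text \<open>Grow the pyramid from the single piece \<open>m\<close>: letters of the remainder that
  commute with all of \<open>v\<close> are rotated to the end, and the first one that does not is
  absorbed. Connectedness provides such a letter as long as the remainder is nonempty.\<close>

lemma primitive_heap_conjugate_pyramid:
  assumes prim: "primitive_heap adj (heap_of adj w)" and "m \<in> set w"
  obtains v where "pyramid m v" "conjugate_heap adj (heap_of adj w) (heap_of adj v)"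
proof -
  have grow: "\<exists>v. pyramid m v \<and> conjugate_heap adj (heap_of adj w) (heap_of adj v)"
    if "pyramid m v" "conjugate_heap adj (heap_of adj w) (heap_of adj (v @ u))" for v u
    using that
  proof (induction "length u" arbitrary: u v rule: less_induct)
    case less
    show ?case
    proof (cases "u = []")
      case True
      then show ?thesis using less.prems by auto
    next
      case False
      have set_w: "set w = set v \<union> set u"
      proof -
        obtain f x where "heap_of adj (v @ u) = heap_of adj f" "w @ x \<approx> x @ f"
          using conjugate_heap_intertwined[OF less.prems(2)] by blast
        then have "mset (v @ u) = mset f" "mset (w @ x) = mset (x @ f)"
          by (auto simp only: heap_of_eq_iff intro: heap_eq_mset)
        then have "mset w = mset (v @ u)" by simp
        then have "set w = set (v @ u)" by (rule mset_eq_setD)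
        then show ?thesis by simp
      qed
      have "\<exists>c\<in>set u. \<exists>d\<in>set v. \<not> indep c d"
      proof (cases "\<exists>c\<in>set u. c \<in> set v")
        case True then show ?thesis by (meson indep_irrefl)
      next
        case disj: False
        have "v \<noteq> []" using less.prems(1) by (simp add: pyramid_def)
        then have "hd v \<in> set w" "hd u \<in> set w" "hd v \<in> set v" "hd u \<notin> set v"
          using set_w False disj by auto
        then obtain c d where "c \<in> set w" "d \<in> set w" "c \<in> set v" "d \<notin> set v" "\<not> indep c d"
          by (rule primitive_heap_connected[OF prim, where P = "\<lambda>c. c \<in> set v"])
        then show ?thesis using set_w indep_sym by blast
      qed
      then obtain u1 c u2 where u: "u = u1 @ c # u2" "\<exists>d\<in>set v. \<not> indep c d"
        "\<forall>c\<in>set u1. \<not> (\<exists>d\<in>set v. \<not> indep c d)"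
        by (rule split_list_first_propE) blast
      have "v @ u1 \<approx> u1 @ v"
        using u(3)
      proof (induction u1)
        case (Cons e u1)
        have "v @ e # u1 \<approx> e # v @ u1" by (rule move_left) (use Cons.prems in simp)
        also have "\<dots> \<approx> e # u1 @ v" by (rule heap_eq_Cons, rule Cons.IH) (use Cons.prems in simp)
        finally show ?case by simp
      qed simp
      then have "v @ u \<approx> u1 @ (v @ c # u2)" using heap_eq_append_right[of "v @ u1" "u1 @ v" "c # u2"] u by simp
      then have "conjugate_heap adj (heap_of adj w) (heap_of adj ((v @ c # u2) @ u1))"
        using less.prems(2) heap_of_eq_iff conjugate_heap_rotate by metis
      then show ?thesis
        using less.hyps[of "u2 @ u1" "v @ [c]"] u pyramid_snoc[OF less.prems(1)] by auto
    qed
  qed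
  obtain p s where w: "w = p @ m # s" using \<open>m \<in> set w\<close> by (meson split_list)
  have "conjugate_heap adj (heap_of adj w) (heap_of adj ((m # s) @ p))"
    using conjugate_heap_rotate conjugate_heap_refl w by metis
  moreover have "pyramid m [m]"
    unfolding pyramid_def using heap_eq_mset by (metis list.sel(1) list.simps(3) mset_single_iff_right mset.simps(1) mset.simps(2))
  ultimately show thesis using grow[of "[m]" "s @ p"] that by auto
qed

text \<open>A forbidden factor \<open>a u b\<close> would have to straddle the border with
  \<open>hd p\<close> equal to \<open>b\<close> or inside \<open>u\<close>. The first contradicts
  \<open>a < b\<close>, the second \<open>b < c\<close> for the letters \<open>c\<close> of
  \<open>u\<close>, because \<open>hd p\<close> is least.\<close>

lemma standard_append:
  assumes s: "standard s" and p: "standard p" and least: "\<And>c. c \<in> set s \<union> set p \<Longrightarrow> hd p \<le> c"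
  shows "standard (s @ p)"
proof (rule ccontr)
  assume "\<not> standard (s @ p)"
  then obtain x a u b y where f: "s @ p = x @ a # u @ b # y" "a < b" "indep b a"
    "\<And>c. c \<in> set u \<Longrightarrow> indep b c \<and> b < c" by (rule not_standardE) blast
  note not_std = descending_factor_not_standard[OF f(2), of u]
  have "set (s @ p) = set (x @ a # u @ b # y)" using f(1) by simp
  then have ge: "hd p \<le> a" "hd p \<le> b" using least by auto
  from f(1) have "s @ p = (x @ a # u) @ (b # y)" by simp
  then consider "p = b # y" | t where "s = x @ a # u @ b # t"
    | us where "us \<noteq> []" "s @ us = x @ a # u" "p = us @ b # y"
    unfolding append_eq_append_conv2[of s p] by (auto simp: append_eq_Cons_conv)
  then show False
  proof cases
    case 1
    then show False using ge f(2) by simp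
  next
    case (2 t)
    then show False using not_std[of x t] f(3,4) s by auto
  next
    case (3 us)
    from 3(2) consider vs where "us = vs @ a # u" | vs where "u = vs @ us"
      unfolding append_eq_append_conv2[of s us] by (auto simp: append_eq_Cons_conv)
    then show False
    proof cases
      case (1 vs)
      then show False using not_std[of vs y] f(3,4) p 3(3) by auto
    next
      case (2 vs)
      then have "hd p \<in> set u" using 3 by (cases us) auto
      then have "b < hd p" using f(4) by blast
      then show False using ge by simp
    qed
  qed
qed

text \<open>Rotations of a standard word need not be standard, so minimality among conjugates does
  not at once compare \<open>w\<close> with its rotations. A conjugate pyramid over the least letter
  \<open>m\<close> forces \<open>w\<close> to start with \<open>m\<close>. Rotations starting with
  \<open>m\<close> are then standard by \<open>standard_append\<close>, the others are larger by
  their first letter, and equality is excluded by primitivity.\<close>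

lemma lyndon_heap_lyndon_word:
  assumes lyn: "lyndon_heap adj (heap_of adj w)" and st: "standard w"
  shows "lyndon_word w"
proof -
  have w_ne: "w \<noteq> []" and prim: "primitive_heap adj (heap_of adj w)"
    and minimal: "\<And>f. conjugate_heap adj (heap_of adj w) (heap_of adj f) \<Longrightarrow> w \<le> standard_word (heap_of adj f)"
    using lyn st standard_word_eq by (auto simp: lyndon_heap_def heap_of_eq_empty heap_le_def)
  define m where "m = Min (set w)"
  have m: "m \<in> set w" "\<And>c. c \<in> set w \<Longrightarrow> m \<le> c" using w_ne by (auto simp: m_def)
  obtain v where v: "pyramid m v" "conjugate_heap adj (heap_of adj w) (heap_of adj v)"
    using primitive_heap_conjugate_pyramid[OF prim m(1)] by blast
  have "hd (standard_word (heap_of adj v)) = m" "standard_word (heap_of adj v) \<noteq> []"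
    using v(1) heap_eq_standard_word[of v] by (auto simp: pyramid_def)
  moreover have "w \<le> standard_word (heap_of adj v)" using minimal v(2) by blast
  ultimately have hd_w: "hd w = m"
    using m(2)[of "hd w"] w_ne by (cases w; cases "standard_word (heap_of adj v)") auto
  show ?thesis
  proof (rule lyndon_word_if_rotations[OF w_ne])
    fix p s assume ps: "w = p @ s" "p \<noteq> []" "s \<noteq> []"
    show "w < s @ p"
    proof (cases "hd s = m")
      case False
      then have "m < hd s" using m(2)[of "hd s"] ps by simp
      then show ?thesis using hd_w w_ne ps(3) by (cases w; cases s) auto
    next
      case True
      have "standard (s @ p)"
      proof (rule standard_append)
        have "standard (p @ s)" using st ps(1) by simp
        then show "standard s" "standard p" by (rule standard_suffix, rule standard_prefix)
        have "hd p = m" using hd_w ps(1,2) by simp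
        then show "hd p \<le> c" if "c \<in> set s \<union> set p" for c using that m(2)[of c] ps(1) by auto
      qed
      moreover have "conjugate_heap adj (heap_of adj w) (heap_of adj (s @ p))"
        unfolding ps(1) by (rule conjugate_heap_rotate[OF conjugate_heap_refl])
      ultimately have "w \<le> s @ p" using minimal[of "s @ p"] standard_word_eq[of "s @ p"] by simp
      moreover have "w \<noteq> s @ p"
      proof
        assume "w = s @ p"
        then have "heap_of adj w = superpose adj (heap_of adj p) (heap_of adj s)"
          "heap_of adj w = superpose adj (heap_of adj s) (heap_of adj p)"
          using ps(1) by (simp_all add: superpose_heap_of)
        then have "heap_of adj p = empty_heap adj \<or> heap_of adj s = empty_heap adj"
          by (intro prim[unfolded primitive_heap_def, rule_format] conjI heap_of_in_heaps)
        then show False using ps by (simp add: heap_of_eq_empty)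
      qed
      ultimately show ?thesis by simp
    qed
  qed
qed

lemma lyndon_heapE:
  assumes "lyndon_heap adj E" obtains w where "E = heap_of adj w" "standard w" "lyndon_word w"
  using assms heap_obtain_standard lyndon_heap_lyndon_word by (metis lyndon_heap_def)

lemma standard_square:
  assumes "standard k" "lyndon_word k" shows "standard (k @ k)"
  using standard_append[OF assms(1,1)] lyndon_word_hd_le[OF assms(2)] by blast

subsection \<open>Standard factorization of heaps\<close>

lemma lyndon_split_heap_of:
  assumes w: "standard w" "lyndon_word w" "2 \<le> length w"
  shows "lyndon_split adj (heap_of adj w) (heap_of adj (left_factor w)) (heap_of adj (right_factor w))"
proof -
  have "standard (right_factor w)" using factors_append[OF w(3)] w(1) standard_suffix by metis
  then have "lyndon_heap adj (heap_of adj (right_factor w))"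
    using lyndon_heap_of lyndon_word_right_factor[OF w(3)] by blast
  then show ?thesis
    using left_factor_nonempty[OF w(3)] factors_append[OF w(3)]
    by (simp add: lyndon_split_def heap_of_eq_empty superpose_heap_of)
qed

text \<open>Either nothing is overtaken and \<open>n\<close> represents a genuine suffix of
  \<open>w\<close>, or a letter smaller than \<open>b\<close> occurs later in \<open>w\<close> and
  starts a suffix below \<open>n\<close>. So the minimal right factor of the heap is found among the
  suffixes of one word.\<close>

lemma right_factor_le_split:
  assumes w: "standard w" and un: "w \<approx> u @ n" "u \<noteq> []" "n \<noteq> []" "standard n"
  shows "2 \<le> length w" "right_factor w \<le> n"
proof -
  show len: "2 \<le> length w" using heap_eq_length[OF un(1)] un(2,3) by (cases u; cases n) auto
  from un(1,3) obtain p b s u' v' where p: "w = p @ b # s" "u \<approx> p @ u'" "n \<approx> b # v'"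
    "b # s \<approx> u' @ b # v'" "\<And>c. c \<in> set u' \<Longrightarrow> indep b c" by (rule first_letter_of_suffix) blast
  have n_ge: "b # v' \<le> n" using un(4) p(3) by (simp add: standard_def)
  show "right_factor w \<le> n"
  proof (cases "u' = []")
    case True
    then have "b # s \<approx> b # v'" using p(4) by simp
    then have "n \<approx> b # s" using heap_eq_trans[OF p(3) heap_eq_sym] by blast
    then have "b # s \<le> n" using un(4) by (simp add: standard_def)
    moreover have "p \<noteq> []" using True p(2) un(2) by auto
    ultimately show ?thesis using right_factor_le[OF len p(1)] by auto
  next
    case False
    with standard_suffix[of p "b # s"] w(1) p(1,4,5) obtain c where "c \<in> set s" "c < b"
      by (metis standard_skipped_letter)
    then obtain s1 s2 where "s = s1 @ c # s2" by (meson split_list)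
    then have "right_factor w \<le> c # s2" using right_factor_le[OF len, of "p @ b # s1" "c # s2"] p(1) by auto
    moreover have "c # s2 < b # v'" using \<open>c < b\<close> by simp
    ultimately show ?thesis using n_ge by (meson le_less_trans less_le_trans order.strict_implies_order)
  qed
qed

lemma standard_factorization_lyndon:
  assumes w: "standard w" "lyndon_word w" "2 \<le> length w"
  shows "standard_factorization adj \<Psi> (heap_of adj w) (heap_of adj (left_factor w)) (heap_of adj (right_factor w))"
proof (rule standard_factorization.lyndon)
  show "lyndon_heap adj (heap_of adj w)" using w lyndon_heap_of by blast
  show "lyndon_split adj (heap_of adj w) (heap_of adj (left_factor w)) (heap_of adj (right_factor w))"
    by (rule lyndon_split_heap_of[OF w])
  fix F' N' assume "lyndon_split adj (heap_of adj w) F' N'"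
  then have F': "F' \<in> heaps adj" "F' \<noteq> empty_heap adj" and N': "lyndon_heap adj N'"
    and eq: "heap_of adj w = superpose adj F' N'" by (auto simp: lyndon_split_def)
  obtain u where u: "F' = heap_of adj u" using F' by (auto simp: heaps_def)
  obtain n where n: "N' = heap_of adj n" "standard n" "lyndon_word n" using N' by (rule lyndon_heapE)
  have "standard (right_factor w)" using factors_append[OF w(3)] w(1) standard_suffix by metis
  moreover have "right_factor w \<le> n"
    using right_factor_le_split(2)[OF w(1), of u n] F' eq n u
    by (auto simp: superpose_heap_of heap_of_eq_iff heap_of_eq_empty lyndon_word_def)
  ultimately show "heap_le (heap_of adj (right_factor w)) N'"
    using n by (simp add: heap_le_def standard_word_eq)
qed

text \<open>The square rule cannot apply, since a Lyndon heap is primitive. Minimality then fixes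
  the right factor, and cancellation the left one.\<close>

lemma standard_factorization_lyndonD:
  assumes w: "standard w" "lyndon_word w" and f: "standard_factorization adj \<Psi> (heap_of adj w) F N"
  shows "2 \<le> length w" "F = heap_of adj (left_factor w)" "N = heap_of adj (right_factor w)"
proof -
  have lyn: "lyndon_heap adj (heap_of adj w)" using w lyndon_heap_of by blast
  have "lyndon_split adj (heap_of adj w) F N \<and> (\<forall>F' N'. lyndon_split adj (heap_of adj w) F' N' \<longrightarrow> heap_le N N')"
    using f
  proof cases
    case square
    then have "F \<noteq> empty_heap adj" "F \<in> heaps adj" by (auto simp: lyndon_heap_def)
    then show ?thesis using lyn square unfolding lyndon_heap_def primitive_heap_def by metis
  qed blast
  then have split: "lyndon_split adj (heap_of adj w) F N"
    and least: "\<And>F' N'. lyndon_split adj (heap_of adj w) F' N' \<Longrightarrow> heap_le N N'" by blast+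
  then have F: "F \<in> heaps adj" "F \<noteq> empty_heap adj" and N: "lyndon_heap adj N"
    and eq: "heap_of adj w = superpose adj F N" by (auto simp: lyndon_split_def)
  obtain u where u: "F = heap_of adj u" using F by (auto simp: heaps_def)
  obtain n where n: "N = heap_of adj n" "standard n" "lyndon_word n" using N by (rule lyndon_heapE)
  have un: "w \<approx> u @ n" "u \<noteq> []" "n \<noteq> []"
    using F eq n u by (auto simp: superpose_heap_of heap_of_eq_iff heap_of_eq_empty lyndon_word_def)
  show len: "2 \<le> length w" using right_factor_le_split(1)[OF w(1) un n(2)] .
  have r: "standard (right_factor w)" using factors_append[OF len] w(1) standard_suffix by metis
  have "n \<le> right_factor w"
    using least[OF lyndon_split_heap_of[OF w len]] n r by (simp add: heap_le_def standard_word_eq)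
  then have nr: "n = right_factor w" using right_factor_le_split(2)[OF w(1) un n(2)] by simp
  then show "N = heap_of adj (right_factor w)" using n by simp
  have "left_factor w @ right_factor w \<approx> u @ right_factor w" using un nr factors_append[OF len] by simp
  then show "F = heap_of adj (left_factor w)" using u by (simp add: heap_of_eq_iff heap_eq_sym)
qed

text \<open>Here the Lyndon rule is excluded, as a square is not primitive; the root is unique
  because both squares are standard words of the same heap, and equal words can be halved.\<close>

lemma standard_factorization_squareD:
  assumes k: "standard k" "lyndon_word k" and f: "standard_factorization adj \<Psi> (heap_of adj (k @ k)) F N"
  shows "F = heap_of adj k" "N = heap_of adj k"
proof -
  have "F = N \<and> lyndon_heap adj F \<and> heap_of adj (k @ k) = superpose adj F F"
    using f
  proof cases
    case lyndon
    have "heap_of adj (k @ k) = superpose adj (heap_of adj k) (heap_of adj k)" by (simp add: superpose_heap_of)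
    then have "heap_of adj k = empty_heap adj"
      using lyndon(1) unfolding lyndon_heap_def primitive_heap_def by (metis heap_of_in_heaps)
    then show ?thesis using k by (simp add: heap_of_eq_empty lyndon_word_def)
  qed auto
  moreover from this obtain g where g: "F = heap_of adj g" "standard g" "lyndon_word g" by (metis lyndon_heapE)
  ultimately have "k @ k \<approx> g @ g" by (simp add: superpose_heap_of heap_of_eq_iff)
  then have "k @ k = g @ g" using standard_unique standard_square k g by blast
  then have "length (k @ k) = length (g @ g)" by simp
  then have "length k = length g" by simp
  then have "k = g" using \<open>k @ k = g @ g\<close> by simp
  then show "F = heap_of adj k" "N = heap_of adj k" using g \<open>F = N \<and> _\<close> by auto
qed

end

section \<open>Noncommutative power series with the super bracket\<close>

definition odd_word :: "'i set \<Rightarrow> 'i list \<Rightarrow> bool" where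
  "odd_word \<Psi> w \<longleftrightarrow> odd (length (filter (\<lambda>i. i \<in> \<Psi>) w))"

definition parity_sign :: "bool \<Rightarrow> bool \<Rightarrow> complex" where
  "parity_sign p q = (if p \<and> q then - 1 else 1)"

lemma odd_word_append [simp]: "odd_word \<Psi> (u @ v) \<longleftrightarrow> odd_word \<Psi> u \<noteq> odd_word \<Psi> v"
  by (auto simp: odd_word_def)

lemma odd_word_mset: "odd_word \<Psi> w \<longleftrightarrow> odd (size (filter_mset (\<lambda>i. i \<in> \<Psi>) (mset w)))"
  by (simp add: odd_word_def flip: mset_filter)

lemma odd_word_mset_cong: "mset v = mset w \<Longrightarrow> odd_word \<Psi> v \<longleftrightarrow> odd_word \<Psi> w"
  by (simp add: odd_word_mset)

definition conv :: "('i list \<Rightarrow> complex) \<Rightarrow> ('i list \<Rightarrow> complex) \<Rightarrow> 'i list \<Rightarrow> complex" where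
  "conv f g w = (\<Sum>i\<le>length w. f (take i w) * g (drop i w))"

text \<open>The sign is read off from the two pieces of the word and not from parities of
  \<open>f\<close> and \<open>g\<close>, which makes the operation bilinear on all series. On
  homogeneous series it is the usual supercommutator.\<close>

definition super_bracket ::
    "'i set \<Rightarrow> ('i list \<Rightarrow> complex) \<Rightarrow> ('i list \<Rightarrow> complex) \<Rightarrow> 'i list \<Rightarrow> complex" where
  "super_bracket \<Psi> f g w = (\<Sum>i\<le>length w. f (take i w) * g (drop i w) -
     parity_sign (odd_word \<Psi> (take i w)) (odd_word \<Psi> (drop i w)) * (g (take i w) * f (drop i w)))"

lemma conv_linear_left: "conv (\<lambda>w. a w - c * b w) g w = conv a g w - c * conv b g w"
  by (simp add: conv_def left_diff_distrib sum_subtractf sum_distrib_left mult.assoc)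

lemma conv_linear_right: "conv f (\<lambda>w. a w - c * b w) w = conv f a w - c * conv f b w"
  by (simp add: conv_def right_diff_distrib sum_subtractf sum_distrib_left mult.left_commute)

lemma sum_triangle_shift:
  "(\<Sum>j\<le>n. \<Sum>i\<le>j. F i j) = (\<Sum>i\<le>n. \<Sum>k\<le>n - i. F i (i + k))" for F :: "nat \<Rightarrow> nat \<Rightarrow> complex" and n :: nat
proof -
  have "(\<Sum>j\<le>n. \<Sum>i\<le>j. F i j) = (\<Sum>(j, i)\<in>Sigma {..n} (\<lambda>j. {..j}). F i j)"
    by (simp add: sum.Sigma)
  also have "\<dots> = (\<Sum>(i, k)\<in>Sigma {..n} (\<lambda>i. {..n - i}). F i (i + k))"
    by (rule sum.reindex_bij_witness[where i = "\<lambda>(i, k). (i + k, i)" and j = "\<lambda>(j, i). (i, j - i)"]) auto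
  finally show ?thesis by (simp add: sum.Sigma)
qed

lemma conv_assoc: "conv (conv f g) h w = conv f (conv g h) w"
proof -
  have "conv (conv f g) h w =
      (\<Sum>j\<le>length w. \<Sum>i\<le>j. f (take i w) * g (drop i (take j w)) * h (drop j w))"
    unfolding conv_def by (intro sum.cong refl) (simp add: sum_distrib_right min_def)
  also have "\<dots> = (\<Sum>i\<le>length w. \<Sum>k\<le>length w - i. f (take i w) * g (drop i (take (i + k) w)) * h (drop (i + k) w))"
    by (rule sum_triangle_shift)
  also have "\<dots> = conv f (conv g h) w"
    unfolding conv_def
    by (intro sum.cong refl) (simp add: sum_distrib_left mult.assoc drop_take add.commute)
  finally show ?thesis .
qed

text \<open>A relation rather than a function, because the zero series has both parities.\<close>

definition series_parity :: "'i set \<Rightarrow> bool \<Rightarrow> ('i list \<Rightarrow> complex) \<Rightarrow> bool" where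
  "series_parity \<Psi> p f \<longleftrightarrow> (\<forall>w. f w \<noteq> 0 \<longrightarrow> odd_word \<Psi> w = p)"

lemma super_bracket_homogeneous:
  assumes "series_parity \<Psi> p f" "series_parity \<Psi> q g"
  shows "super_bracket \<Psi> f g = (\<lambda>w. conv f g w - parity_sign p q * conv g f w)"
proof
  fix w
  have *: "parity_sign (odd_word \<Psi> (take i w)) (odd_word \<Psi> (drop i w)) * (g (take i w) * f (drop i w)) =
      parity_sign p q * (g (take i w) * f (drop i w))" for i
  proof (cases "g (take i w) * f (drop i w) = 0")
    case False
    then have "odd_word \<Psi> (take i w) = q" "odd_word \<Psi> (drop i w) = p"
      using assms by (auto simp: series_parity_def)
    then show ?thesis by (simp add: parity_sign_def)
  qed simp
  show "super_bracket \<Psi> f g w = conv f g w - parity_sign p q * conv g f w"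
    by (simp only: super_bracket_def conv_def sum_subtractf sum_distrib_left *)
qed

lemma series_parity_bracket:
  assumes "series_parity \<Psi> p f" "series_parity \<Psi> q g"
  shows "series_parity \<Psi> (p \<noteq> q) (super_bracket \<Psi> f g)"
  unfolding series_parity_def
proof (intro allI impI)
  fix w assume "super_bracket \<Psi> f g w \<noteq> 0"
  then obtain i where "f (take i w) * g (drop i w) -
     parity_sign (odd_word \<Psi> (take i w)) (odd_word \<Psi> (drop i w)) * (g (take i w) * f (drop i w)) \<noteq> 0"
    unfolding super_bracket_def by (rule sum.not_neutral_contains_not_neutral)
  then have "f (take i w) \<noteq> 0 \<and> g (drop i w) \<noteq> 0 \<or> g (take i w) \<noteq> 0 \<and> f (drop i w) \<noteq> 0" by auto
  then have "odd_word \<Psi> (take i w @ drop i w) = (p \<noteq> q)"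
    using assms unfolding series_parity_def odd_word_append by metis
  then show "odd_word \<Psi> w = (p \<noteq> q)" by simp
qed

lemma super_bracket_skew:
  assumes "series_parity \<Psi> p f" "series_parity \<Psi> q g"
  shows "super_bracket \<Psi> f g w + parity_sign p q * super_bracket \<Psi> g f w = 0"
  using assms by (simp add: super_bracket_homogeneous) (simp add: parity_sign_def algebra_simps)

text \<open>All terms become triple products under \<open>conv\<close>, which associativity brings
  to a common form; they cancel in each of the eight parity cases.\<close>

lemma super_bracket_jacobi:
  assumes "series_parity \<Psi> p f" "series_parity \<Psi> q g" "series_parity \<Psi> r h"
  shows "super_bracket \<Psi> f (super_bracket \<Psi> g h) w - super_bracket \<Psi> (super_bracket \<Psi> f g) h w
     - parity_sign p q * super_bracket \<Psi> g (super_bracket \<Psi> f h) w = 0"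
  unfolding super_bracket_homogeneous[OF assms(1) series_parity_bracket[OF assms(2,3)]]
    super_bracket_homogeneous[OF series_parity_bracket[OF assms(1,2)] assms(3)]
    super_bracket_homogeneous[OF assms(2) series_parity_bracket[OF assms(1,3)]]
  unfolding
    super_bracket_homogeneous[OF assms(1,2)] super_bracket_homogeneous[OF assms(2,3)]
    super_bracket_homogeneous[OF assms(1,3)] conv_linear_left conv_linear_right conv_assoc
  by (cases p; cases q; cases r) (simp_all add: parity_sign_def)

lemma super_bracket_sum_left:
  "super_bracket \<Psi> (\<lambda>w. \<Sum>s\<in>A. a s * F s w) g w = (\<Sum>s\<in>A. a s * super_bracket \<Psi> (F s) g w)"
  unfolding super_bracket_def sum_distrib_left
  by (subst sum.swap, intro sum.cong refl)
     (simp add: sum_distrib_left sum_distrib_right sum_subtractf right_diff_distrib mult_ac)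

lemma super_bracket_sum_right:
  "super_bracket \<Psi> f (\<lambda>w. \<Sum>s\<in>A. a s * G s w) w = (\<Sum>s\<in>A. a s * super_bracket \<Psi> f (G s) w)"
  unfolding super_bracket_def sum_distrib_left
  by (subst sum.swap, intro sum.cong refl)
     (simp add: sum_distrib_left sum_distrib_right sum_subtractf right_diff_distrib mult_ac)

section \<open>Trees as noncommutative series\<close>

primrec leaves :: "'i magma \<Rightarrow> 'i multiset" where
  "leaves (Gen i) = {#i#}"
| "leaves (Br s t) = leaves s + leaves t"

lemma magma_parity_leaves: "magma_parity \<Psi> t \<longleftrightarrow> odd (size (filter_mset (\<lambda>i. i \<in> \<Psi>) (leaves t)))"
  by (induction t) auto

lemma magma_parity_odd_word: "mset w = leaves t \<Longrightarrow> magma_parity \<Psi> t = odd_word \<Psi> w"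
  by (simp add: magma_parity_leaves odd_word_mset)

primrec tree_series :: "'i set \<Rightarrow> 'i magma \<Rightarrow> 'i list \<Rightarrow> complex" where
  "tree_series \<Psi> (Gen i) = (\<lambda>w. if w = [i] then 1 else 0)"
| "tree_series \<Psi> (Br s t) = super_bracket \<Psi> (tree_series \<Psi> s) (tree_series \<Psi> t)"

lemma super_bracket_nonzeroE:
  assumes "super_bracket \<Psi> f g w \<noteq> 0"
  obtains u v where "w = u @ v" "f u \<noteq> 0" "g v \<noteq> 0" | u v where "w = u @ v" "g u \<noteq> 0" "f v \<noteq> 0"
proof -
  from assms obtain i where "f (take i w) * g (drop i w) -
     parity_sign (odd_word \<Psi> (take i w)) (odd_word \<Psi> (drop i w)) * (g (take i w) * f (drop i w)) \<noteq> 0"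
    unfolding super_bracket_def by (rule sum.not_neutral_contains_not_neutral)
  then have "f (take i w) \<noteq> 0 \<and> g (drop i w) \<noteq> 0 \<or> g (take i w) \<noteq> 0 \<and> f (drop i w) \<noteq> 0" by auto
  then show thesis using that by (metis append_take_drop_id)
qed

lemma tree_series_mset: "tree_series \<Psi> t w \<noteq> 0 \<Longrightarrow> mset w = leaves t"
proof (induction t arbitrary: w)
  case (Gen i)
  then show ?case by (auto split: if_splits)
next
  case (Br s t)
  from Br.prems have "super_bracket \<Psi> (tree_series \<Psi> s) (tree_series \<Psi> t) w \<noteq> 0" by simp
  then show ?case by (rule super_bracket_nonzeroE) (use Br.IH in auto)
qed

lemma series_parity_tree: "series_parity \<Psi> (magma_parity \<Psi> t) (tree_series \<Psi> t)"
  unfolding series_parity_def using tree_series_mset magma_parity_odd_word by metis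

abbreviation tree :: "'i magma \<Rightarrow> ('i magma \<Rightarrow>\<^sub>0 complex)" where
  "tree t \<equiv> Poly_Mapping.single t 1"

abbreviation scale :: "complex \<Rightarrow> ('a \<Rightarrow>\<^sub>0 complex) \<Rightarrow> ('a \<Rightarrow>\<^sub>0 complex)" where
  "scale c \<equiv> Poly_Mapping.map ((*) c)"

text \<open>The homomorphism from the free magma algebra to the free associative superalgebra with
  its supercommutator, determined by sending generators to letters.\<close>

definition series :: "'i set \<Rightarrow> ('i magma \<Rightarrow>\<^sub>0 complex) \<Rightarrow> 'i list \<Rightarrow> complex" where
  "series \<Psi> x w = (\<Sum>t\<in>Poly_Mapping.keys x. Poly_Mapping.lookup x t * tree_series \<Psi> t w)"

lemma series_superset:
  assumes "finite A" "Poly_Mapping.keys x \<subseteq> A"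
  shows "series \<Psi> x w = (\<Sum>t\<in>A. Poly_Mapping.lookup x t * tree_series \<Psi> t w)"
  unfolding series_def using assms by (intro sum.mono_neutral_left) (auto simp: in_keys_iff)

lemma series_add: "series \<Psi> (x + y) w = series \<Psi> x w + series \<Psi> y w"
proof -
  let ?A = "Poly_Mapping.keys x \<union> Poly_Mapping.keys y"
  have "Poly_Mapping.keys (x + y) \<subseteq> ?A" by (rule keys_add)
  then show ?thesis
    by (simp add: series_superset[of ?A] lookup_add distrib_right sum.distrib)
qed

lemma series_zero [simp]: "series \<Psi> 0 w = 0"
  by (simp add: series_def)

lemma series_single [simp]: "series \<Psi> (Poly_Mapping.single t c) w = c * tree_series \<Psi> t w"
  by (simp add: series_superset[of "{t}"])

lemma series_smult [simp]: "series \<Psi> (scale c x) w = c * series \<Psi> x w"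
proof -
  have "series \<Psi> (scale c x) w =
      (\<Sum>t\<in>Poly_Mapping.keys x. c * Poly_Mapping.lookup x t * tree_series \<Psi> t w)"
    using keys_smult[of c x] by (simp add: series_superset[of "Poly_Mapping.keys x"] lookup_smult)
  then show ?thesis by (simp add: series_def sum_distrib_left mult.assoc)
qed

lemma series_uminus: "series \<Psi> (- x) w = - series \<Psi> x w"
  using series_add[of \<Psi> x "- x" w] by (simp add: add_eq_0_iff)

lemma series_diff: "series \<Psi> (x - y) w = series \<Psi> x w - series \<Psi> y w"
  using series_add[of \<Psi> "x - y" y w] by simp

lemma series_sum: "series \<Psi> (sum f A) w = (\<Sum>a\<in>A. series \<Psi> (f a) w)"
  by (induction A rule: infinite_finite_induct) (auto simp: series_add)

lemma series_super_sign: "series \<Psi> (super_sign p q x) w = parity_sign p q * series \<Psi> x w"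
  by (simp add: super_sign_def parity_sign_def series_uminus)

lemma series_mult: "series \<Psi> (magma_mult x y) = super_bracket \<Psi> (series \<Psi> x) (series \<Psi> y)"
proof
  fix w
  have x: "series \<Psi> x = (\<lambda>w. \<Sum>t\<in>Poly_Mapping.keys x. Poly_Mapping.lookup x t * tree_series \<Psi> t w)"
    and y: "series \<Psi> y = (\<lambda>w. \<Sum>t\<in>Poly_Mapping.keys y. Poly_Mapping.lookup y t * tree_series \<Psi> t w)"
    by (auto simp: series_def)
  show "series \<Psi> (magma_mult x y) w = super_bracket \<Psi> (series \<Psi> x) (series \<Psi> y) w"
    unfolding x y super_bracket_sum_left super_bracket_sum_right
    by (simp add: magma_mult_def series_sum sum_distrib_left mult.assoc)
qed

lemma series_parity_series: "homogeneous \<Psi> p x \<Longrightarrow> series_parity \<Psi> p (series \<Psi> x)"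
  unfolding series_parity_def
proof (intro allI impI)
  fix w assume x: "homogeneous \<Psi> p x" and "series \<Psi> x w \<noteq> 0"
  then obtain t where "t \<in> Poly_Mapping.keys x" "Poly_Mapping.lookup x t * tree_series \<Psi> t w \<noteq> 0"
    unfolding series_def by (meson sum.not_neutral_contains_not_neutral)
  then show "odd_word \<Psi> w = p"
    using x series_parity_tree[of \<Psi> t] by (auto simp: homogeneous_def series_parity_def)
qed

lemma series_lie_superalgebra_relation:
  assumes "x \<in> lie_superalgebra_relations \<Psi>" shows "series \<Psi> x w = 0"
  using assms unfolding lie_superalgebra_relations_def
proof (elim UnE CollectE exE conjE)
  fix a b p q assume "x = magma_mult a b + super_sign p q (magma_mult b a)"
    "homogeneous \<Psi> p a" "homogeneous \<Psi> q b"
  then show ?thesis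
    using super_bracket_skew[OF series_parity_series series_parity_series]
    by (simp add: series_add series_mult series_super_sign)
next
  fix a b c p q r
  assume "x = magma_mult a (magma_mult b c) - magma_mult (magma_mult a b) c
        - super_sign p q (magma_mult b (magma_mult a c))"
    "homogeneous \<Psi> p a" "homogeneous \<Psi> q b" "homogeneous \<Psi> r c"
  then show ?thesis
    using super_bracket_jacobi[OF series_parity_series series_parity_series series_parity_series]
    by (simp add: series_diff series_mult series_super_sign)
qed

subsection \<open>Leading words\<close>

text \<open>Homogeneity in the letters is built in, because comparing concatenations factor by
  factor requires equal lengths.\<close>

definition leading_word :: "('i::linorder list \<Rightarrow> complex) \<Rightarrow> 'i list \<Rightarrow> bool" where
  "leading_word f w \<longleftrightarrow> f w \<noteq> 0 \<and> (\<forall>v. f v \<noteq> 0 \<longrightarrow> mset v = mset w \<and> w \<le> v)"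

lemma leading_wordD:
  assumes "leading_word f w"
  shows "f w \<noteq> 0" "f v \<noteq> 0 \<Longrightarrow> mset v = mset w" "f v \<noteq> 0 \<Longrightarrow> length v = length w" "f v \<noteq> 0 \<Longrightarrow> w \<le> v"
  using assms unfolding leading_word_def by (blast intro: mset_eq_length)+

lemma append_mono_same_length:
  "u \<le> u' \<Longrightarrow> v \<le> v' \<Longrightarrow> length u = length u' \<Longrightarrow> u @ v \<le> u' @ v'" for u v :: "'i::linorder list"
  using less_append_same_length[of u u' v v'] by (cases "u = u'") (simp_all add: order.order_iff_strict)

text \<open>All words of \<open>f\<close> have the length of \<open>u\<close>, so in the coefficient
  of \<open>u @ v\<close> the first product contributes only at the cut after \<open>u\<close>; the
  reversed product contributes only to words that are at least \<open>v @ u\<close>.\<close>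

lemma leading_word_bracket:
  assumes f: "leading_word f u" and g: "leading_word g v" and uv: "u @ v < v @ u"
  shows "leading_word (super_bracket \<Psi> f g) (u @ v)"
proof -
  have fg: "mset (a @ b) = mset (u @ v)" "u @ v \<le> a @ b" if "f a \<noteq> 0" "g b \<noteq> 0" for a b
    using leading_wordD(2-4)[OF f that(1)] leading_wordD(2,4)[OF g that(2)]
      append_mono_same_length[of u a v b] by simp_all
  have gf: "mset (b @ a) = mset (u @ v)" "u @ v < b @ a" if "f a \<noteq> 0" "g b \<noteq> 0" for a b
    using leading_wordD(2,4)[OF f that(1)] leading_wordD(2-4)[OF g that(2)]
      less_le_trans[OF uv append_mono_same_length[of v b u a]] by simp_all
  have "super_bracket \<Psi> f g (u @ v) =
      (\<Sum>i\<le>length (u @ v). f (take i (u @ v)) * g (drop i (u @ v)))"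
    unfolding super_bracket_def
  proof (intro sum.cong refl)
    fix i
    have "g (take i (u @ v)) * f (drop i (u @ v)) = 0"
      using gf(2)[of "drop i (u @ v)" "take i (u @ v)"] by (simp only: append_take_drop_id) auto
    then show "f (take i (u @ v)) * g (drop i (u @ v)) - parity_sign (odd_word \<Psi> (take i (u @ v)))
        (odd_word \<Psi> (drop i (u @ v))) * (g (take i (u @ v)) * f (drop i (u @ v))) =
        f (take i (u @ v)) * g (drop i (u @ v))" by (simp only: mult_zero_right diff_zero)
  qed
  also have "\<dots> = (\<Sum>i\<in>{length u}. f (take i (u @ v)) * g (drop i (u @ v)))"
  proof (rule sum.mono_neutral_right)
    show "\<forall>i\<in>{..length (u @ v)} - {length u}. f (take i (u @ v)) * g (drop i (u @ v)) = 0"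
    proof
      fix i assume "i \<in> {..length (u @ v)} - {length u}"
      then have "length (take i (u @ v)) \<noteq> length u" by (simp only: length_take) auto
      then show "f (take i (u @ v)) * g (drop i (u @ v)) = 0" using leading_wordD(3)[OF f] by force
    qed
  qed auto
  finally have "super_bracket \<Psi> f g (u @ v) \<noteq> 0" using leading_wordD(1)[OF f] leading_wordD(1)[OF g] by simp
  moreover have "mset w = mset (u @ v) \<and> u @ v \<le> w" if "super_bracket \<Psi> f g w \<noteq> 0" for w
    using that by (rule super_bracket_nonzeroE) (use fg gf less_imp_le in blast)+
  ultimately show ?thesis by (simp add: leading_word_def)
qed

text \<open>For odd \<open>u\<close> the sign turns the difference of the two products into a sum,
  whence the coefficient \<open>2 * (f u * g u)\<close>. The series \<open>f\<close> and
  \<open>g\<close> may differ, which allows one of them to come from a kernel element later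
  on.\<close>

lemma leading_word_square:
  assumes f: "leading_word f u" and g: "leading_word g u" and "odd_word \<Psi> u"
  shows "leading_word (super_bracket \<Psi> f g) (u @ u)"
proof -
  have fg: "mset (a @ b) = mset (u @ u)" "u @ u \<le> a @ b" "mset (b @ a) = mset (u @ u)" "u @ u \<le> b @ a"
    if "f a \<noteq> 0" "g b \<noteq> 0" for a b
    using leading_wordD(2-4)[OF f that(1)] leading_wordD(2-4)[OF g that(2)]
      append_mono_same_length[of u a u b] append_mono_same_length[of u b u a] by simp_all
  have "super_bracket \<Psi> f g (u @ u) = (\<Sum>i\<in>{length u}. f (take i (u @ u)) * g (drop i (u @ u)) -
     parity_sign (odd_word \<Psi> (take i (u @ u))) (odd_word \<Psi> (drop i (u @ u))) *
     (g (take i (u @ u)) * f (drop i (u @ u))))"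
    unfolding super_bracket_def
  proof (rule sum.mono_neutral_right)
    show "\<forall>i\<in>{..length (u @ u)} - {length u}. f (take i (u @ u)) * g (drop i (u @ u)) -
      parity_sign (odd_word \<Psi> (take i (u @ u))) (odd_word \<Psi> (drop i (u @ u))) *
      (g (take i (u @ u)) * f (drop i (u @ u))) = 0"
    proof
      fix i assume "i \<in> {..length (u @ u)} - {length u}"
      then have "length (take i (u @ u)) \<noteq> length u" by (simp only: length_take) auto
      then have "f (take i (u @ u)) = 0" "g (take i (u @ u)) = 0"
        using leading_wordD(3)[OF f] leading_wordD(3)[OF g] by blast+
      then show "f (take i (u @ u)) * g (drop i (u @ u)) -
        parity_sign (odd_word \<Psi> (take i (u @ u))) (odd_word \<Psi> (drop i (u @ u))) *
        (g (take i (u @ u)) * f (drop i (u @ u))) = 0" by (simp only: mult_zero_left mult_zero_right diff_zero)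
    qed
  qed auto
  then have "super_bracket \<Psi> f g (u @ u) = 2 * (f u * g u)"
    using \<open>odd_word \<Psi> u\<close> by (simp add: parity_sign_def)
  then have "super_bracket \<Psi> f g (u @ u) \<noteq> 0" using leading_wordD(1)[OF f] leading_wordD(1)[OF g] by simp
  moreover have "mset w = mset (u @ u) \<and> u @ u \<le> w" if "super_bracket \<Psi> f g w \<noteq> 0" for w
    using that by (rule super_bracket_nonzeroE) (use fg in blast)+
  ultimately show ?thesis by (simp add: leading_word_def)
qed

definition super_lyndon_word :: "'i::linorder set \<Rightarrow> 'i list \<Rightarrow> bool" where
  "super_lyndon_word \<Psi> w \<longleftrightarrow> lyndon_word w \<or> (\<exists>k. lyndon_word k \<and> odd_word \<Psi> k \<and> w = k @ k)"

lemma leading_word_lyndon: "lyndon_word w \<Longrightarrow> leading_word (tree_series \<Psi> (bracketing w)) w"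
proof (induction w rule: length_induct)
  case (1 w)
  show ?case
  proof (cases "2 \<le> length w")
    case True
    let ?l = "left_factor w" and ?r = "right_factor w"
    have w: "?l @ ?r = w" "?l \<noteq> []" "?r \<noteq> []"
      using factors_append[OF True] left_factor_nonempty[OF True] right_factor_nonempty[OF True] by auto
    then have "length ?l + length ?r = length w" by (metis length_append)
    then have "length ?l < length w" "length ?r < length w" using w by (auto simp flip: length_greater_0_conv)
    then have "leading_word (tree_series \<Psi> (bracketing ?l)) ?l" "leading_word (tree_series \<Psi> (bracketing ?r)) ?r"
      using 1 lyndon_word_left_factor[OF True] lyndon_word_right_factor[OF True] by auto
    moreover have "?l @ ?r < ?r @ ?l" using lyndon_word_swap 1 w by metis
    ultimately show ?thesis
      using leading_word_bracket[of _ ?l _ ?r \<Psi>] w by (simp add: bracketing_long[OF True])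
  next
    case False
    then obtain a where "w = [a]" using 1 by (cases w; cases "tl w") (auto simp: lyndon_word_def)
    then show ?thesis by (auto simp: leading_word_def)
  qed
qed

lemma leading_word_super_lyndon:
  "super_lyndon_word \<Psi> w \<Longrightarrow> leading_word (tree_series \<Psi> (bracketing w)) w"
  by (auto simp: super_lyndon_word_def bracketing_square leading_word_lyndon leading_word_square)

section \<open>The presentation of \<open>LS\<close> by the free magma algebra\<close>

context
  fixes L :: "(complex, 'a) module" and J :: "'a set"
  assumes L: "bilinear_algebra L" and J: "algebra_ideal L J"
begin

interpretation Module.module class_ring L
  using L by (simp add: bilinear_algebra_def)

interpretation J: LinearCombinations.submodule class_ring J L
  using J by (simp add: algebra_ideal_def)

lemma algebra_ideal_subgroup: "subgroup J (add_monoid L)"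
proof (rule group.subgroupI[OF a_group])
  fix a assume a: "a \<in> J"
  then have "a \<in> carrier L" using J.subset by blast
  then have "\<ominus>\<^bsub>L\<^esub> a = (- 1) \<odot>\<^bsub>L\<^esub> a"
    using smult_l_minus[of 1 a] smult_one[of a] class_ring_simps by (metis UNIV_I a_inv_def)
  then show "inv\<^bsub>add_monoid L\<^esub> a \<in> J" using J.smult_closed[of "- 1" a] a by (simp add: a_inv_def)
qed (use J.subset J.zero_closed in \<open>auto simp del: J.zero_closed\<close>)

interpretation A: abelian_subgroup J L
  by (intro abelian_subgroupI3 additive_subgroup.intro abelian_group_axioms algebra_ideal_subgroup)

lemma coset_eqI: "a \<in> J +>\<^bsub>L\<^esub> x \<Longrightarrow> x \<in> carrier L \<Longrightarrow> J +>\<^bsub>L\<^esub> a = J +>\<^bsub>L\<^esub> x"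
  using a_repr_independence[of a J x] A.a_subgroup by auto

lemma quotient_algebra_carrier: "carrier (quotient_algebra L J) = (\<lambda>x. J +>\<^bsub>L\<^esub> x) ` carrier L"
  by (auto simp: quotient_algebra_def A_RCOSETS_def')

lemma quotient_algebra_zero: "\<zero>\<^bsub>quotient_algebra L J\<^esub> = J"
  by (simp add: quotient_algebra_def)

lemma coset_eq_zero_iff: "x \<in> carrier L \<Longrightarrow> J +>\<^bsub>L\<^esub> x = \<zero>\<^bsub>quotient_algebra L J\<^esub> \<longleftrightarrow> x \<in> J"
  using A.a_rcos_self[of x] a_coset_join2[of x J] A.a_subgroup by (auto simp: quotient_algebra_zero)

lemma quotient_algebra_add:
  "x \<in> carrier L \<Longrightarrow> y \<in> carrier L \<Longrightarrow>
     J +>\<^bsub>L\<^esub> (x \<oplus>\<^bsub>L\<^esub> y) = (J +>\<^bsub>L\<^esub> x) \<oplus>\<^bsub>quotient_algebra L J\<^esub> (J +>\<^bsub>L\<^esub> y)"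
  by (simp add: quotient_algebra_def A.a_rcos_sum)

lemma quotient_algebra_smult:
  assumes x: "x \<in> carrier L"
  shows "J +>\<^bsub>L\<^esub> (c \<odot>\<^bsub>L\<^esub> x) = c \<odot>\<^bsub>quotient_algebra L J\<^esub> (J +>\<^bsub>L\<^esub> x)"
proof -
  have "J +>\<^bsub>L\<^esub> (c \<odot>\<^bsub>L\<^esub> a) = J +>\<^bsub>L\<^esub> (c \<odot>\<^bsub>L\<^esub> x)" if a: "a \<in> J +>\<^bsub>L\<^esub> x" for a
  proof (rule coset_eqI)
    obtain j where j: "j \<in> J" "a = j \<oplus>\<^bsub>L\<^esub> x" using a by (auto simp: a_r_coset_def')
    then have "c \<odot>\<^bsub>L\<^esub> a = c \<odot>\<^bsub>L\<^esub> j \<oplus>\<^bsub>L\<^esub> c \<odot>\<^bsub>L\<^esub> x" using x J.subset by (auto intro: smult_r_distr)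
    moreover have "c \<odot>\<^bsub>L\<^esub> j \<in> J" using j by (intro J.smult_closed) auto
    ultimately show "c \<odot>\<^bsub>L\<^esub> a \<in> J +>\<^bsub>L\<^esub> (c \<odot>\<^bsub>L\<^esub> x)" by (auto simp: a_r_coset_def')
  qed (use x in auto)
  then have "c \<odot>\<^bsub>quotient_algebra L J\<^esub> (J +>\<^bsub>L\<^esub> x) = (\<Union>a\<in>J +>\<^bsub>L\<^esub> x. J +>\<^bsub>L\<^esub> (c \<odot>\<^bsub>L\<^esub> x))"
    unfolding quotient_algebra_def module.simps by (intro SUP_cong refl)
  then show ?thesis using A.a_rcos_self[OF x] by (metis SUP_const empty_iff)
qed

lemma quotient_algebra_mult:
  assumes x: "x \<in> carrier L" and y: "y \<in> carrier L"
  shows "J +>\<^bsub>L\<^esub> (x \<otimes>\<^bsub>L\<^esub> y) = (J +>\<^bsub>L\<^esub> x) \<otimes>\<^bsub>quotient_algebra L J\<^esub> (J +>\<^bsub>L\<^esub> y)"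
proof -
  have cl: "u \<otimes>\<^bsub>L\<^esub> v \<in> carrier L" if "u \<in> carrier L" "v \<in> carrier L" for u v
    using L that by (auto simp: bilinear_algebra_def)
  have "J +>\<^bsub>L\<^esub> (a \<otimes>\<^bsub>L\<^esub> b) = J +>\<^bsub>L\<^esub> (x \<otimes>\<^bsub>L\<^esub> y)"
    if ab: "a \<in> J +>\<^bsub>L\<^esub> x" "b \<in> J +>\<^bsub>L\<^esub> y" for a b
  proof (rule coset_eqI)
    obtain j where j: "j \<in> J" "a = j \<oplus>\<^bsub>L\<^esub> x" using ab by (auto simp: a_r_coset_def')
    obtain k where k: "k \<in> J" "b = k \<oplus>\<^bsub>L\<^esub> y" using ab by (auto simp: a_r_coset_def')
    have jk: "j \<in> carrier L" "k \<in> carrier L" "b \<in> carrier L" using j k J.subset y by auto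
    have "x \<otimes>\<^bsub>L\<^esub> b = x \<otimes>\<^bsub>L\<^esub> k \<oplus>\<^bsub>L\<^esub> x \<otimes>\<^bsub>L\<^esub> y"
      unfolding k(2) using L jk x y by (auto simp: bilinear_algebra_def)
    moreover have "a \<otimes>\<^bsub>L\<^esub> b = j \<otimes>\<^bsub>L\<^esub> b \<oplus>\<^bsub>L\<^esub> x \<otimes>\<^bsub>L\<^esub> b"
      unfolding j(2) using L jk x by (auto simp: bilinear_algebra_def)
    ultimately have "a \<otimes>\<^bsub>L\<^esub> b = j \<otimes>\<^bsub>L\<^esub> b \<oplus>\<^bsub>L\<^esub> (x \<otimes>\<^bsub>L\<^esub> k \<oplus>\<^bsub>L\<^esub> x \<otimes>\<^bsub>L\<^esub> y)" by simp
    also have "\<dots> = (j \<otimes>\<^bsub>L\<^esub> b \<oplus>\<^bsub>L\<^esub> x \<otimes>\<^bsub>L\<^esub> k) \<oplus>\<^bsub>L\<^esub> x \<otimes>\<^bsub>L\<^esub> y"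
      by (rule a_assoc[symmetric]) (intro cl jk x y)+
    finally have "a \<otimes>\<^bsub>L\<^esub> b = (j \<otimes>\<^bsub>L\<^esub> b \<oplus>\<^bsub>L\<^esub> x \<otimes>\<^bsub>L\<^esub> k) \<oplus>\<^bsub>L\<^esub> x \<otimes>\<^bsub>L\<^esub> y" .
    moreover have "j \<otimes>\<^bsub>L\<^esub> b \<oplus>\<^bsub>L\<^esub> x \<otimes>\<^bsub>L\<^esub> k \<in> J"
      using J j(1) k(1) jk x by (intro J.m_closed) (auto simp: algebra_ideal_def)
    ultimately show "a \<otimes>\<^bsub>L\<^esub> b \<in> J +>\<^bsub>L\<^esub> (x \<otimes>\<^bsub>L\<^esub> y)" by (auto simp: a_r_coset_def')
  qed (rule cl[OF x y])
  then have "(J +>\<^bsub>L\<^esub> x) \<otimes>\<^bsub>quotient_algebra L J\<^esub> (J +>\<^bsub>L\<^esub> y) =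
      (\<Union>a\<in>J +>\<^bsub>L\<^esub> x. \<Union>b\<in>J +>\<^bsub>L\<^esub> y. J +>\<^bsub>L\<^esub> (x \<otimes>\<^bsub>L\<^esub> y))"
    unfolding quotient_algebra_def monoid.simps rcoset_mult_def by (intro SUP_cong refl)
  then show ?thesis using A.a_rcos_self[OF x] A.a_rcos_self[OF y] by (metis SUP_const empty_iff)
qed

text \<open>Needed to bound \<open>commutation_ideal\<close>, an ideal of the quotient
  \<open>FLS\<close>, by ideals of the free algebra.\<close>

lemma algebra_ideal_image:
  assumes I: "algebra_ideal L I"
  shows "algebra_ideal (quotient_algebra L J) ((\<lambda>x. J +>\<^bsub>L\<^esub> x) ` I)"
proof -
  interpret I: LinearCombinations.submodule class_ring I L using I by (simp add: algebra_ideal_def)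
  have sub: "I \<subseteq> carrier L" by (rule I.subset)
  have "Module.module class_ring (quotient_algebra L J)"
    using bilinear_algebra_quotient[OF L J] by (simp add: bilinear_algebra_def)
  moreover have "\<zero>\<^bsub>quotient_algebra L J\<^esub> \<in> (\<lambda>x. J +>\<^bsub>L\<^esub> x) ` I"
    using coset_eq_zero_iff[of "\<zero>\<^bsub>L\<^esub>"] J.zero_closed I.zero_closed by force
  ultimately have "submodule class_ring ((\<lambda>x. J +>\<^bsub>L\<^esub> x) ` I) (quotient_algebra L J)"
    unfolding LinearCombinations.submodule_def using sub I.m_closed I.smult_closed
    by (auto simp: quotient_algebra_carrier subset_iff
        simp flip: quotient_algebra_add quotient_algebra_smult)
  then show ?thesis
    using I sub unfolding algebra_ideal_def quotient_algebra_carrier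
    by (auto simp: subset_iff simp flip: quotient_algebra_mult)
qed

end

lemma algebra_idealD:
  assumes "algebra_ideal L I"
  shows "\<zero>\<^bsub>L\<^esub> \<in> I" "x \<in> I \<Longrightarrow> y \<in> I \<Longrightarrow> x \<oplus>\<^bsub>L\<^esub> y \<in> I"
    "x \<in> carrier L \<Longrightarrow> y \<in> I \<Longrightarrow> x \<otimes>\<^bsub>L\<^esub> y \<in> I" "x \<in> carrier L \<Longrightarrow> y \<in> I \<Longrightarrow> y \<otimes>\<^bsub>L\<^esub> x \<in> I"
  using assms unfolding algebra_ideal_def LinearCombinations.submodule_def by blast+

lemma generated_ideal_least: "algebra_ideal L I \<Longrightarrow> S \<subseteq> I \<Longrightarrow> generated_ideal L S \<subseteq> I"
  by (auto simp: generated_ideal_def)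

lemma generated_ideal_superset: "S \<subseteq> generated_ideal L S"
  by (auto simp: generated_ideal_def)

lemma algebra_ideal_lie: "algebra_ideal free_algebra (lie_superalgebra_ideal \<Psi>)"
  unfolding lie_superalgebra_ideal_def
  by (intro generated_ideal_is_ideal bilinear_algebra_free_algebra) (simp add: free_algebra_def)

lemma algebra_ideal_commutation: "algebra_ideal (FLS \<Psi>) (commutation_ideal adj \<Psi>)"
  unfolding commutation_ideal_def
  using bilinear_algebra_FLS[of \<Psi>] FLS_gen_closed[of \<Psi>]
  by (intro generated_ideal_is_ideal) (auto simp: bilinear_algebra_def)

global_interpretation vec: vector_space "\<lambda>c. scale c :: ('i magma \<Rightarrow>\<^sub>0 complex) \<Rightarrow> _"
  by unfold_locales (auto intro!: poly_mapping_eqI simp: lookup_smult lookup_add algebra_simps)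

lemma algebra_ideal_free_algebraI:
  fixes I :: "('i magma \<Rightarrow>\<^sub>0 complex) set"
  assumes "vec.subspace I" "\<And>x y. y \<in> I \<Longrightarrow> magma_mult x y \<in> I \<and> magma_mult y x \<in> I"
  shows "algebra_ideal free_algebra I"
proof -
  have "Module.module class_ring (free_algebra :: (complex, 'i magma \<Rightarrow>\<^sub>0 complex) module)"
    using bilinear_algebra_free_algebra unfolding bilinear_algebra_def by (rule conjunct1)
  then show ?thesis
    using assms unfolding algebra_ideal_def LinearCombinations.submodule_def vec.subspace_def
    by (simp add: free_algebra_def)
qed

lemma magma_mult_tree: "magma_mult (tree s) (tree t) = tree (Br s t)"
  by (simp add: magma_mult_superset[of "{s}" "{t}"])

section \<open>The kernel of the projection from the free magma algebra to \<open>LS\<close>\<close>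

locale supergraph = graph_heaps adj for adj :: "'i::linorder \<Rightarrow> 'i \<Rightarrow> bool" +
  fixes \<Psi> :: "'i set"
begin

definition LS_class :: "('i magma \<Rightarrow>\<^sub>0 complex) \<Rightarrow> ('i magma \<Rightarrow>\<^sub>0 complex) set set" where
  "LS_class x = commutation_ideal adj \<Psi> +>\<^bsub>FLS \<Psi>\<^esub> (lie_superalgebra_ideal \<Psi> +>\<^bsub>free_algebra\<^esub> x)"

abbreviation FLS_class :: "('i magma \<Rightarrow>\<^sub>0 complex) \<Rightarrow> ('i magma \<Rightarrow>\<^sub>0 complex) set" where
  "FLS_class x \<equiv> lie_superalgebra_ideal \<Psi> +>\<^bsub>free_algebra\<^esub> x"

lemma carrier_free_algebra [simp]: "x \<in> carrier free_algebra"
  by (simp add: free_algebra_def)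

lemmas FLS_lemmas = bilinear_algebra_free_algebra algebra_ideal_lie[of \<Psi>]
lemmas LS_lemmas = bilinear_algebra_FLS[of \<Psi>] algebra_ideal_commutation[of \<Psi> adj]

lemma carrier_FLS: "carrier (FLS \<Psi>) = range FLS_class"
  using quotient_algebra_carrier[OF FLS_lemmas] by (simp add: FLS_def free_algebra_def)

lemma FLS_class_closed [simp]: "FLS_class x \<in> carrier (FLS \<Psi>)"
  by (auto simp: carrier_FLS)

lemma carrier_LS: "carrier (LS adj \<Psi>) = range LS_class"
  using quotient_algebra_carrier[OF LS_lemmas] by (auto simp: LS_def carrier_FLS LS_class_def)

lemma FLS_class_add: "FLS_class (x + y) = FLS_class x \<oplus>\<^bsub>FLS \<Psi>\<^esub> FLS_class y"
  using quotient_algebra_add[OF FLS_lemmas, of x y] by (simp add: FLS_def) (simp add: free_algebra_def)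

lemma FLS_class_smult: "FLS_class (scale c x) = c \<odot>\<^bsub>FLS \<Psi>\<^esub> FLS_class x"
  using quotient_algebra_smult[OF FLS_lemmas, of x c] by (simp add: FLS_def) (simp add: free_algebra_def)

lemma FLS_class_mult: "FLS_class (magma_mult x y) = FLS_class x \<otimes>\<^bsub>FLS \<Psi>\<^esub> FLS_class y"
  using quotient_algebra_mult[OF FLS_lemmas, of x y] by (simp add: FLS_def) (simp add: free_algebra_def)

lemma LS_class_add: "LS_class (x + y) = LS_class x \<oplus>\<^bsub>LS adj \<Psi>\<^esub> LS_class y"
  using quotient_algebra_add[OF LS_lemmas, of "FLS_class x" "FLS_class y"]
  by (simp add: LS_class_def FLS_class_add LS_def)

lemma LS_class_smult: "LS_class (scale c x) = c \<odot>\<^bsub>LS adj \<Psi>\<^esub> LS_class x"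
  using quotient_algebra_smult[OF LS_lemmas, of "FLS_class x"]
  by (simp add: LS_class_def FLS_class_smult LS_def)

lemma LS_class_mult: "LS_class (magma_mult x y) = LS_class x \<otimes>\<^bsub>LS adj \<Psi>\<^esub> LS_class y"
  using quotient_algebra_mult[OF LS_lemmas, of "FLS_class x" "FLS_class y"]
  by (simp add: LS_class_def FLS_class_mult LS_def)

lemma LS_class_gen: "LS_class (tree (Gen i)) = LS_gen adj \<Psi> i"
  by (simp add: LS_class_def LS_gen_def FLS_gen_def)

definition null_ideal :: "('i magma \<Rightarrow>\<^sub>0 complex) set" where
  "null_ideal = {x. LS_class x = \<zero>\<^bsub>LS adj \<Psi>\<^esub>}"

lemma null_ideal_iff: "x \<in> null_ideal \<longleftrightarrow> FLS_class x \<in> commutation_ideal adj \<Psi>"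
  using coset_eq_zero_iff[OF LS_lemmas, of "FLS_class x"] by (simp add: null_ideal_def LS_class_def LS_def)

interpretation LS: Module.module class_ring "LS adj \<Psi>"
  using vectorspace_LS[of adj \<Psi>] by (simp add: vectorspace_def)

lemma LS_class_closed [simp]: "LS_class x \<in> carrier (LS adj \<Psi>)"
  by (auto simp: carrier_LS)

lemma LS_class_zero: "LS_class 0 = \<zero>\<^bsub>LS adj \<Psi>\<^esub>"
proof -
  have "LS_class 0 \<oplus>\<^bsub>LS adj \<Psi>\<^esub> LS_class 0 = LS_class 0" by (simp flip: LS_class_add)
  then show ?thesis using LS.add.l_cancel_one by simp
qed

lemma LS_class_sum: "LS_class (\<Sum>a\<in>A. f a) = (\<Oplus>\<^bsub>LS adj \<Psi>\<^esub>a\<in>A. LS_class (f a))" if "finite A"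
  using that by (induction A) (auto simp: LS_class_zero LS_class_add)

lemma null_ideal_subspace: "vec.subspace null_ideal"
  unfolding vec.subspace_def null_ideal_def
  using LS.smult_r_null by (auto simp: LS_class_add LS_class_smult LS_class_zero)

lemma null_ideal_mult:
  assumes "x \<in> null_ideal" shows "magma_mult x y \<in> null_ideal" "magma_mult y x \<in> null_ideal"
proof -
  have 1: "FLS_class x \<in> commutation_ideal adj \<Psi>" using assms by (simp add: null_ideal_iff)
  show "magma_mult x y \<in> null_ideal" "magma_mult y x \<in> null_ideal"
    using LS_lemmas(2) 1 unfolding algebra_ideal_def null_ideal_iff FLS_class_mult by auto
qed

lemma lie_superalgebra_relations_null: "x \<in> lie_superalgebra_relations \<Psi> \<Longrightarrow> x \<in> null_ideal"
proof -
  assume "x \<in> lie_superalgebra_relations \<Psi>"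
  then have "x \<in> lie_superalgebra_ideal \<Psi>"
    unfolding lie_superalgebra_ideal_def by (rule subsetD[OF generated_ideal_superset])
  then have "FLS_class x = \<zero>\<^bsub>FLS \<Psi>\<^esub>" using coset_eq_zero_iff[OF FLS_lemmas, of x] by (simp add: FLS_def)
  moreover have "\<zero>\<^bsub>FLS \<Psi>\<^esub> \<in> commutation_ideal adj \<Psi>"
    by (rule algebra_idealD(1)[OF LS_lemmas(2)])
  ultimately show ?thesis by (simp add: null_ideal_iff)
qed

lemma commuting_generators_null:
  assumes "indep i j" shows "tree (Br (Gen i) (Gen j)) \<in> null_ideal"
proof -
  have "FLS_class (tree (Br (Gen i) (Gen j))) = FLS_gen \<Psi> i \<otimes>\<^bsub>FLS \<Psi>\<^esub> FLS_gen \<Psi> j"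
    using FLS_class_mult[of "tree (Gen i)" "tree (Gen j)"]
    by (simp add: magma_mult_tree FLS_gen_def)
  then show ?thesis
    using assms unfolding null_ideal_iff commutation_ideal_def indep_def
    by (intro subsetD[OF generated_ideal_superset]) blast
qed

text \<open>The two successive quotients amount to one: the image of \<open>I\<close> in
  \<open>FLS\<close> is an ideal containing the generators of the commutation ideal, and a change of
  representative costs an element of the Lie ideal, which lies in \<open>I\<close>. Functionals are
  shown to vanish on the kernel in this way.\<close>

lemma null_ideal_least:
  assumes I: "algebra_ideal free_algebra I" and rel: "lie_superalgebra_relations \<Psi> \<subseteq> I"
    and comm: "\<And>i j. indep i j \<Longrightarrow> tree (Br (Gen i) (Gen j)) \<in> I"
  shows "null_ideal \<subseteq> I"
proof
  fix x assume "x \<in> null_ideal"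
  have lie: "lie_superalgebra_ideal \<Psi> \<subseteq> I"
    unfolding lie_superalgebra_ideal_def using I rel by (rule generated_ideal_least)
  have "commutation_ideal adj \<Psi> \<subseteq> FLS_class ` I"
    unfolding commutation_ideal_def
  proof (rule generated_ideal_least)
    show "algebra_ideal (FLS \<Psi>) (FLS_class ` I)"
      unfolding FLS_def by (rule algebra_ideal_image[OF FLS_lemmas I])
    have "FLS_gen \<Psi> i \<otimes>\<^bsub>FLS \<Psi>\<^esub> FLS_gen \<Psi> j \<in> FLS_class ` I" if "i \<noteq> j \<and> \<not> adj i j" for i j
    proof -
      have "FLS_gen \<Psi> i \<otimes>\<^bsub>FLS \<Psi>\<^esub> FLS_gen \<Psi> j = FLS_class (tree (Br (Gen i) (Gen j)))"
        using FLS_class_mult[of "tree (Gen i)" "tree (Gen j)"]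
        by (simp add: magma_mult_tree FLS_gen_def)
      then show ?thesis using comm[of i j] that by (simp add: indep_def)
    qed
    then show "{FLS_gen \<Psi> i \<otimes>\<^bsub>FLS \<Psi>\<^esub> FLS_gen \<Psi> j |i j. i \<noteq> j \<and> \<not> adj i j} \<subseteq> FLS_class ` I"
      by blast
  qed
  moreover have "FLS_class x \<in> commutation_ideal adj \<Psi>" using \<open>x \<in> null_ideal\<close> null_ideal_iff by simp
  ultimately have "FLS_class x \<in> FLS_class ` I" by (rule subsetD)
  then obtain y where y: "FLS_class x = FLS_class y" "y \<in> I" by (rule imageE)
  have mem: "x \<in> FLS_class y \<longleftrightarrow> (\<exists>j\<in>lie_superalgebra_ideal \<Psi>. x = j + y)" for x y
    by (simp add: a_r_coset_def' free_algebra_def)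
  have "0 \<in> lie_superalgebra_ideal \<Psi>"
    using algebra_idealD(1)[OF algebra_ideal_lie[of \<Psi>]] by (simp add: free_algebra_def)
  then have "x \<in> FLS_class x" unfolding mem by force
  then obtain j where j: "j \<in> lie_superalgebra_ideal \<Psi>" "x = j + y" unfolding y(1) mem by blast
  then have "j \<in> I" using lie by blast
  then show "x \<in> I"
    using algebra_idealD(2)[OF I _ y(2), of j] j(2)  by (simp add: free_algebra_def)
qed

end

lemma leaves_bracketing: "w \<noteq> [] \<Longrightarrow> leaves (bracketing w) = mset w"
proof (induction w rule: bracketing.induct)
  case (1 w)
  show ?case
  proof (cases "2 \<le> length w")
    case True
    then have "leaves (bracketing w) = mset (left_factor w) + mset (right_factor w)"
      using 1 left_factor_nonempty[OF True] right_factor_nonempty[OF True] by (simp add: bracketing_long)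
    then show ?thesis using factors_append[OF True] by (metis mset_append)
  next
    case False
    then obtain a where "w = [a]" using 1(3) by (cases w; cases "tl w") auto
    then show ?thesis by simp
  qed
qed

lemma lyndon_word_nonempty: "lyndon_word w \<Longrightarrow> w \<noteq> []"
  by (simp add: lyndon_word_def)

lemma super_lyndon_word_nonempty: "super_lyndon_word \<Psi> w \<Longrightarrow> w \<noteq> []"
  using lyndon_word_nonempty unfolding super_lyndon_word_def by blast

lemma magma_parity_bracketing: "w \<noteq> [] \<Longrightarrow> magma_parity \<Psi> (bracketing w) = odd_word \<Psi> w"
  by (rule magma_parity_odd_word) (simp add: leaves_bracketing)

text \<open>A super Lyndon word above \<open>k\<close> is at least \<open>k @ k\<close>: for Lyndon
  words by \<open>square_less_lyndon\<close>, for a square \<open>j @ j\<close> by comparing the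
  root \<open>j\<close> with \<open>k\<close>.\<close>

lemma less_square_lyndon:
  assumes e: "super_lyndon_word \<Psi> e" and k: "lyndon_word k" and "e < k @ k" "e \<noteq> k"
  shows "e < k"
proof (rule ccontr)
  assume "\<not> e < k"
  then have "k < e" using \<open>e \<noteq> k\<close> by simp
  show False
  proof (cases "lyndon_word e")
    case True
    then show False using square_less_lyndon[OF True \<open>k < e\<close>] lyndon_word_nonempty[OF k] \<open>e < k @ k\<close> by simp
  next
    case False
    then obtain j where j: "lyndon_word j" "e = j @ j" using e by (auto simp: super_lyndon_word_def)
    consider "j < k" | "j = k" | "k < j" by fastforce
    then show False
    proof cases
      case 1
      then show False using square_less_lyndon[OF k, of j] lyndon_word_nonempty[OF j(1)] j \<open>k < e\<close> by simp
    next
      case 2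
      then show False using j \<open>e < k @ k\<close> by simp
    next
      case 3
      then have "k @ k < j" using square_less_lyndon[OF j(1)] lyndon_word_nonempty[OF k] by simp
      also have "j \<le> e" using j by simp
      finally show False using \<open>e < k @ k\<close> by simp
    qed
  qed
qed

lemma algebra_ideal_free_algebraD:
  fixes I :: "('i magma \<Rightarrow>\<^sub>0 complex) set"
  assumes I: "algebra_ideal free_algebra I"
  shows "vec.subspace I" "y \<in> I \<Longrightarrow> magma_mult x y \<in> I" "y \<in> I \<Longrightarrow> magma_mult y x \<in> I"
proof -
  show "vec.subspace I"
    using I unfolding algebra_ideal_def LinearCombinations.submodule_def vec.subspace_def
    by (simp add: free_algebra_def)
  show "y \<in> I \<Longrightarrow> magma_mult x y \<in> I" "y \<in> I \<Longrightarrow> magma_mult y x \<in> I"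
    using algebra_idealD(3,4)[OF I, of x y] by (simp_all add: free_algebra_def)
qed

lemma super_bracket_zero: "super_bracket \<Psi> f (\<lambda>_. 0) = (\<lambda>_. 0)" "super_bracket \<Psi> (\<lambda>_. 0) f = (\<lambda>_. 0)"
  by (auto simp: super_bracket_def)

lemma series_lie_superalgebra_ideal:
  assumes "x \<in> lie_superalgebra_ideal \<Psi>" shows "series \<Psi> x = (\<lambda>_. 0)"
proof -
  have "lie_superalgebra_ideal \<Psi> \<subseteq> {x. series \<Psi> x = (\<lambda>_. 0)}"
    unfolding lie_superalgebra_ideal_def
  proof (rule generated_ideal_least)
    show "algebra_ideal free_algebra {x. series \<Psi> x = (\<lambda>_. 0)}"
    proof (rule algebra_ideal_free_algebraI)
      show "vec.subspace {x. series \<Psi> x = (\<lambda>_. 0)}"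
        by (simp add: vec.subspace_def fun_eq_iff series_add)
      show "magma_mult x y \<in> {x. series \<Psi> x = (\<lambda>_. 0)} \<and> magma_mult y x \<in> {x. series \<Psi> x = (\<lambda>_. 0)}"
        if "y \<in> {x. series \<Psi> x = (\<lambda>_. 0)}" for x y
        using that by (simp add: series_mult super_bracket_zero)
    qed
    show "lie_superalgebra_relations \<Psi> \<subseteq> {x. series \<Psi> x = (\<lambda>_. 0)}"
      by (auto simp: series_lie_superalgebra_relation)
  qed
  then show ?thesis using assms by blast
qed

section \<open>Lyndon brackets span the free Lie superalgebra\<close>

definition lyndon_element :: "'i::linorder list \<Rightarrow> ('i magma \<Rightarrow>\<^sub>0 complex)" where
  "lyndon_element w = tree (bracketing w)"

text \<open>The ideal is put into the spanning set, so that membership is a statement modulo the Lie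
  relations and no coset is formed.\<close>

definition lie_span :: "'i::linorder set \<Rightarrow> 'i list set \<Rightarrow> ('i magma \<Rightarrow>\<^sub>0 complex) set" where
  "lie_span \<Psi> A = vec.span (lie_superalgebra_ideal \<Psi> \<union> lyndon_element ` A)"

section \<open>Consequences of skew symmetry and the Jacobi identity for trees\<close>

lemma homogeneous_tree: "homogeneous \<Psi> (magma_parity \<Psi> t) (tree t)"
  by (simp add: homogeneous_def)

lemma lie_relation_in_ideal: "x \<in> lie_superalgebra_relations \<Psi> \<Longrightarrow> x \<in> lie_superalgebra_ideal \<Psi>"
  unfolding lie_superalgebra_ideal_def by (rule subsetD[OF generated_ideal_superset])

lemma tree_skew:
  "tree (Br s t) + super_sign (magma_parity \<Psi> s) (magma_parity \<Psi> t) (tree (Br t s)) \<in> lie_superalgebra_ideal \<Psi>"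
proof (rule lie_relation_in_ideal)
  show "tree (Br s t) + super_sign (magma_parity \<Psi> s) (magma_parity \<Psi> t) (tree (Br t s))
      \<in> lie_superalgebra_relations \<Psi>"
    unfolding lie_superalgebra_relations_def magma_mult_tree[symmetric]
    using homogeneous_tree by blast
qed

lemma tree_jacobi:
  "tree (Br s (Br t r)) - tree (Br (Br s t) r)
     - super_sign (magma_parity \<Psi> s) (magma_parity \<Psi> t) (tree (Br t (Br s r))) \<in> lie_superalgebra_ideal \<Psi>"
proof (rule lie_relation_in_ideal)
  show "tree (Br s (Br t r)) - tree (Br (Br s t) r)
     - super_sign (magma_parity \<Psi> s) (magma_parity \<Psi> t) (tree (Br t (Br s r))) \<in> lie_superalgebra_relations \<Psi>"
    unfolding lie_superalgebra_relations_def magma_mult_tree[symmetric]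
    using homogeneous_tree by blast
qed

lemma subspace_super_sign_iff:
  "vec.subspace V \<Longrightarrow> super_sign p q x \<in> V \<longleftrightarrow> x \<in> V"
  using vec.subspace_neg[of V x] vec.subspace_neg[of V "- x"]
  by (auto simp: super_sign_def)

context
  fixes \<Psi> :: "'i set" and V :: "('i magma \<Rightarrow>\<^sub>0 complex) set"
  assumes V: "vec.subspace V" and lie: "lie_superalgebra_ideal \<Psi> \<subseteq> V"
begin

text \<open>Signs drop out, because only membership in a subspace containing the Lie relations is at
  stake; the same holds for the Jacobi rule below.\<close>

lemma subspace_tree_commute:
  assumes "tree (Br s t) \<in> V" shows "tree (Br t s) \<in> V"
proof -
  have "tree (Br s t) + super_sign (magma_parity \<Psi> s) (magma_parity \<Psi> t) (tree (Br t s)) \<in> V"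
    using tree_skew lie by blast
  from vec.subspace_diff[OF V this assms]
  show ?thesis using subspace_super_sign_iff[OF V] by simp
qed

lemma subspace_tree_jacobi:
  assumes "tree (Br s (Br t r)) \<in> V" "tree (Br t (Br s r)) \<in> V"
  shows "tree (Br (Br s t) r) \<in> V"
proof -
  let ?c = "super_sign (magma_parity \<Psi> s) (magma_parity \<Psi> t) (tree (Br t (Br s r)))"
  have "tree (Br s (Br t r)) - tree (Br (Br s t) r) - ?c \<in> V"
    using tree_jacobi lie by blast
  moreover have "?c \<in> V" using assms(2) subspace_super_sign_iff[OF V] by simp
  ultimately have "tree (Br s (Br t r)) - (tree (Br s (Br t r)) - tree (Br (Br s t) r) - ?c) - ?c \<in> V"
    using assms(1) vec.subspace_diff[OF V] by blast
  then show ?thesis by simp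
qed

end

lemma subspace_lie_ideal: "vec.subspace (lie_superalgebra_ideal \<Psi>)"
  by (rule algebra_ideal_free_algebraD(1)[OF algebra_ideal_lie])

lemma lie_multiple_cancel:
  assumes "scale c x \<in> lie_superalgebra_ideal \<Psi>" "c \<noteq> 0"
  shows "x \<in> lie_superalgebra_ideal \<Psi>"
  using vec.subspace_scale[OF subspace_lie_ideal assms(1), of "inverse c"] assms(2)
  by (simp add: vec.scale_scale)

text \<open>Skew symmetry gives \<open>2 [t,t] = 0\<close>.\<close>

lemma tree_square_even:
  assumes "\<not> magma_parity \<Psi> t" shows "tree (Br t t) \<in> lie_superalgebra_ideal \<Psi>"
proof (rule lie_multiple_cancel[where c = 2])
  have "tree (Br t t) + tree (Br t t) \<in> lie_superalgebra_ideal \<Psi>"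
    using tree_skew[of t t \<Psi>] assms by (simp add: super_sign_def)
  then show "scale 2 (tree (Br t t)) \<in> lie_superalgebra_ideal \<Psi>"
    using vec.scale_left_distrib[of 1 1 "tree (Br t t)"] by simp
qed simp

text \<open>With \<open>?x = [t,[t,t]]\<close> and \<open>?y = [[t,t],t]\<close>, the Jacobi
  identity gives \<open>2 ?x - ?y = 0\<close> and skew symmetry \<open>?y + ?x = 0\<close>; the sum
  is \<open>3 ?x = 0\<close>.\<close>

lemma tree_cube_odd:
  assumes "magma_parity \<Psi> t" shows "tree (Br t (Br t t)) \<in> lie_superalgebra_ideal \<Psi>"
proof (rule lie_multiple_cancel[where c = 3])
  let ?x = "tree (Br t (Br t t))" and ?y = "tree (Br (Br t t) t)"
  have "?x - ?y + ?x \<in> lie_superalgebra_ideal \<Psi>"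
    using tree_jacobi[of t t t \<Psi>] assms by (simp add: super_sign_def)
  moreover have "?y + ?x \<in> lie_superalgebra_ideal \<Psi>"
    using tree_skew[of "Br t t" t \<Psi>] by (simp add: super_sign_def)
  ultimately have "(?x - ?y + ?x) + (?y + ?x) \<in> lie_superalgebra_ideal \<Psi>"
    by (rule vec.subspace_add[OF subspace_lie_ideal])
  moreover have "scale 3 ?x = (?x - ?y + ?x) + (?y + ?x)"
    by (intro poly_mapping_eqI) (simp add: lookup_smult lookup_add lookup_minus lookup_single when_def)
  ultimately show "scale 3 ?x \<in> lie_superalgebra_ideal \<Psi>" by simp
qed simp

lemma subspace_lie_span: "vec.subspace (lie_span \<Psi> A)"
  by (simp add: lie_span_def)

lemma lie_ideal_subset_lie_span: "lie_superalgebra_ideal \<Psi> \<subseteq> lie_span \<Psi> A"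
  unfolding lie_span_def using vec.span_superset by blast

lemma lyndon_element_in_lie_span: "w \<in> A \<Longrightarrow> lyndon_element w \<in> lie_span \<Psi> A"
  unfolding lie_span_def by (rule vec.span_base) simp

lemma lie_span_mono: "A \<subseteq> B \<Longrightarrow> lie_span \<Psi> A \<subseteq> lie_span \<Psi> B"
  unfolding lie_span_def by (rule vec.span_mono) blast

lemma magma_mult_zero [simp]: "magma_mult 0 x = 0" "magma_mult x 0 = 0"
  by (simp_all add: magma_mult_def)

lemma lie_span_mult_right:
  assumes x: "x \<in> lie_span \<Psi> A"
    and V: "vec.subspace V" "lie_superalgebra_ideal \<Psi> \<subseteq> V"
    and mult: "\<And>h. h \<in> A \<Longrightarrow> magma_mult y (lyndon_element h) \<in> V"
  shows "magma_mult y x \<in> V"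
  using x unfolding lie_span_def
proof (rule vec.span_induct)
  show "vec.subspace {z. magma_mult y z \<in> V}"
    using V(1) by (simp add: vec.subspace_def magma_mult_add_right magma_mult_smult_right)
  show "magma_mult y z \<in> V" if "z \<in> lie_superalgebra_ideal \<Psi> \<union> lyndon_element ` A" for z
    using that
  proof
    assume "z \<in> lie_superalgebra_ideal \<Psi>"
    then show ?thesis using algebra_ideal_free_algebraD(2)[OF algebra_ideal_lie] V(2) by blast
  qed (use mult in blast)
qed

lemma lie_span_mult_left:
  assumes x: "x \<in> lie_span \<Psi> A"
    and V: "vec.subspace V" "lie_superalgebra_ideal \<Psi> \<subseteq> V"
    and mult: "\<And>h. h \<in> A \<Longrightarrow> magma_mult (lyndon_element h) y \<in> V"
  shows "magma_mult x y \<in> V"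
  using x unfolding lie_span_def
proof (rule vec.span_induct)
  show "vec.subspace {z. magma_mult z y \<in> V}"
    using V(1) by (simp add: vec.subspace_def magma_mult_add_left magma_mult_smult_left)
  show "magma_mult z y \<in> V" if "z \<in> lie_superalgebra_ideal \<Psi> \<union> lyndon_element ` A" for z
    using that
  proof
    assume "z \<in> lie_superalgebra_ideal \<Psi>"
    then show ?thesis using algebra_ideal_free_algebraD(3)[OF algebra_ideal_lie] V(2) by blast
  qed (use mult in blast)
qed

section \<open>Brackets of two Lyndon elements\<close>

lemma lyndon_element_mult:
  "magma_mult (lyndon_element u) (lyndon_element v) = tree (Br (bracketing u) (bracketing v))"
  by (simp add: lyndon_element_def magma_mult_tree)

text \<open>A super Lyndon word that is a square is even, so an odd \<open>g\<close> is Lyndon and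
  \<open>[g,g]\<close> is the bracketing of \<open>g @ g\<close>. For even \<open>g\<close> the
  bracket vanishes.\<close>

lemma lyndon_element_square:
  assumes g: "super_lyndon_word \<Psi> g"
  shows "magma_mult (lyndon_element g) (lyndon_element g) \<in>
     lie_span \<Psi> {h. super_lyndon_word \<Psi> h \<and> h = g @ g \<and> lyndon_word g}"
proof (cases "odd_word \<Psi> g")
  case True
  then have "lyndon_word g" using g by (auto simp: super_lyndon_word_def)
  then have "magma_mult (lyndon_element g) (lyndon_element g) = lyndon_element (g @ g)"
    by (simp add: lyndon_element_mult lyndon_element_def bracketing_square magma_mult_tree)
  moreover have "super_lyndon_word \<Psi> (g @ g)" using True \<open>lyndon_word g\<close> by (auto simp: super_lyndon_word_def)
  ultimately show ?thesis using \<open>lyndon_word g\<close> by (auto intro: lyndon_element_in_lie_span)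
next
  case False
  then have "\<not> magma_parity \<Psi> (bracketing g)"
    using magma_parity_bracketing super_lyndon_word_nonempty[OF g] by blast
  then show ?thesis
    unfolding lyndon_element_mult by (intro subsetD[OF lie_ideal_subset_lie_span] tree_square_even)
qed

text \<open>The strict bound by \<open>f\<close> is what lets the induction close: an inner bracket
  involving \<open>f\<close> expands into words below \<open>f\<close>, and brackets of two words
  below \<open>f\<close> are covered by the hypothesis for a smaller maximum.\<close>

definition bracket_span :: "'i::linorder set \<Rightarrow> 'i multiset \<Rightarrow> 'i list \<Rightarrow> ('i magma \<Rightarrow>\<^sub>0 complex) set" where
  "bracket_span \<Psi> d f = lie_span \<Psi> {h. super_lyndon_word \<Psi> h \<and> mset h = d \<and> h < f}"

lemma bracket_span_subspace [simp]:
  "vec.subspace (bracket_span \<Psi> d f)"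
  "lie_superalgebra_ideal \<Psi> \<subseteq> bracket_span \<Psi> d f"
  unfolding bracket_span_def using subspace_lie_span lie_ideal_subset_lie_span by blast+

lemma bracket_span_mono: "f \<le> f' \<Longrightarrow> bracket_span \<Psi> d f \<subseteq> bracket_span \<Psi> d f'"
  unfolding bracket_span_def by (rule lie_span_mono) auto

lemma finite_submset_words: "finite {g. mset g \<subseteq># d}"
proof (rule finite_subset)
  show "{g. mset g \<subseteq># d} \<subseteq> {g. set g \<subseteq> set_mset d \<and> length g \<le> size d}"
    by (auto dest: mset_subset_eqD size_mset_mono)
qed (simp add: finite_lists_length_le)

lemma lyndon_bracket_commute:
  "magma_mult (lyndon_element u) (lyndon_element v) \<in> bracket_span \<Psi> d f \<Longrightarrow>
     magma_mult (lyndon_element v) (lyndon_element u) \<in> bracket_span \<Psi> d f"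
  unfolding lyndon_element_mult by (rule subspace_tree_commute[of _ \<Psi>]) simp_all

lemma lyndon_bracket_jacobi:
  assumes "magma_mult (tree s) (tree (Br t r)) \<in> bracket_span \<Psi> d f"
    "magma_mult (tree t) (tree (Br s r)) \<in> bracket_span \<Psi> d f"
  shows "tree (Br (Br s t) r) \<in> bracket_span \<Psi> d f"
  using assms unfolding magma_mult_tree by (intro subspace_tree_jacobi[of _ \<Psi>]) simp_all

text \<open>
  By the Jacobi identity one descends either in the total degree or in the larger one of the two words.
\<close>

lemma lyndon_bracket_in_span:
  assumes "super_lyndon_word \<Psi> e" "super_lyndon_word \<Psi> f" "e < f" "mset e + mset f = d"
  shows "magma_mult (lyndon_element e) (lyndon_element f) \<in> bracket_span \<Psi> d f"
  using assms
proof (induction "size d" arbitrary: d e f rule: less_induct)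
  case outer: less
  have smaller: "magma_mult (lyndon_element g) (lyndon_element h) \<in> bracket_span \<Psi> (mset g + mset h) (max g h)"
    if "super_lyndon_word \<Psi> g" "super_lyndon_word \<Psi> h" "g \<noteq> h" "length g + length h < size d" for g h
  proof (cases "g < h")
    case True
    then have "max g h = h" by simp
    then show ?thesis using outer.hyps[OF _ that(1,2) True refl] that by simp
  next
    case False
    then have "h < g" "max g h = g" using that(3) by auto
    moreover have "magma_mult (lyndon_element h) (lyndon_element g) \<in> bracket_span \<Psi> (mset h + mset g) g"
      using outer.hyps[OF _ that(2,1) \<open>h < g\<close> refl] that(4) by simp
    ultimately show ?thesis
      unfolding add.commute[of "mset g"] by (simp only:) (rule lyndon_bracket_commute)
  qed
  show ?case
    using outer.prems
  \<comment> \<open>Descent along \<open><\<close> needs a finite measure: the words below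
    \<open>f\<close> whose letters form a submultiset of \<open>d\<close> are counted. Submultisets,
    because the larger factor carries only part of the degree \<open>d\<close>.\<close>
  proof (induction "card {g. mset g \<subseteq># d \<and> g < f}" arbitrary: e f rule: less_induct)
    case inner: less
    note e = inner.prems(1) and f = inner.prems(2) and ef = inner.prems(3) and d = inner.prems(4)
    have ne: "e \<noteq> []" "f \<noteq> []" using super_lyndon_word_nonempty[OF e] super_lyndon_word_nonempty[OF f] by simp_all
    have size_d: "size d = length e + length f" using arg_cong[OF d, of size] by simp
    have below: "magma_mult (lyndon_element g) (lyndon_element h) \<in> bracket_span \<Psi> d f"
      if gh: "super_lyndon_word \<Psi> g" "super_lyndon_word \<Psi> h" "g < f" "h < f" "g \<noteq> h" "mset g + mset h = d" for g h
    proof -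
      have step: "magma_mult (lyndon_element g) (lyndon_element h) \<in> bracket_span \<Psi> d f"
        if "super_lyndon_word \<Psi> g" "super_lyndon_word \<Psi> h" "h < f" "g < h" "mset g + mset h = d" for g h
      proof -
        have "h \<in> {g. mset g \<subseteq># d \<and> g < f}" "h \<notin> {g. mset g \<subseteq># d \<and> g < h}"
          using \<open>h < f\<close> that(5)[symmetric] by simp_all
        moreover have "{g. mset g \<subseteq># d \<and> g < h} \<subseteq> {g. mset g \<subseteq># d \<and> g < f}"
          using \<open>h < f\<close> by (auto intro: order.strict_trans)
        ultimately have "{g. mset g \<subseteq># d \<and> g < h} \<subset> {g. mset g \<subseteq># d \<and> g < f}" by blast
        then have "card {g. mset g \<subseteq># d \<and> g < h} < card {g. mset g \<subseteq># d \<and> g < f}"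
          by (rule psubset_card_mono[rotated]) (rule finite_subset[OF _ finite_submset_words[of d]], blast)
        then have "magma_mult (lyndon_element g) (lyndon_element h) \<in> bracket_span \<Psi> d h"
          by (rule inner.hyps) (rule that)+
        then show ?thesis using bracket_span_mono[OF less_imp_le[OF \<open>h < f\<close>]] by blast
      qed
      show ?thesis
      proof (cases "g < h")
        case True
        then show ?thesis by (intro step gh)
      next
        case False
        then have "h < g" using gh(5) by simp
        moreover have "mset h + mset g = d" using gh(6) by (simp only: add.commute)
        ultimately show ?thesis using lyndon_bracket_commute[OF step[OF gh(2,1,3)]] by blast
      qed
    qed
    \<comment> \<open>With \<open>k\<close> in both places the two terms of the Jacobi identity
      coincide, so bounding \<open>[k,[k,g]]\<close> suffices. The assumption \<open>equal\<close>
      excludes the one pair, \<open>k\<close> with itself, to which \<open>below\<close> does not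
      apply.\<close>
    have square: "tree (Br (Br (bracketing k) (bracketing k)) (bracketing g)) \<in> bracket_span \<Psi> d f"
      if k: "lyndon_word k" and g: "super_lyndon_word \<Psi> g" "k \<noteq> g" and kg: "mset (k @ k) + mset g = d"
        and max: "max k g \<le> f" "k < f"
        and equal: "\<And>h. h = k \<Longrightarrow> mset k + mset h = d \<Longrightarrow> False" for k g
    proof -
      have k': "super_lyndon_word \<Psi> k" "k \<noteq> []"
        using k lyndon_word_nonempty[OF k] by (simp_all add: super_lyndon_word_def)
      have "magma_mult (lyndon_element k) (lyndon_element g) \<in> bracket_span \<Psi> (mset k + mset g) (max k g)"
        using arg_cong[OF kg, of size] k'(2) by (intro smaller k' g) (cases k; simp)
      then have "magma_mult (lyndon_element k) (magma_mult (lyndon_element k) (lyndon_element g)) \<in> bracket_span \<Psi> d f"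
        unfolding bracket_span_def[of _ "mset k + mset g"]
      proof (rule lie_span_mult_right)
        fix h assume "h \<in> {h. super_lyndon_word \<Psi> h \<and> mset h = mset k + mset g \<and> h < max k g}"
        then have h: "super_lyndon_word \<Psi> h" "h < f" "mset k + mset h = d"
          using kg less_le_trans[OF _ max(1), of h] by (simp_all add: add.assoc)
        then have "k \<noteq> h" using equal by blast
        then show "magma_mult (lyndon_element k) (lyndon_element h) \<in> bracket_span \<Psi> d f"
          by (intro below h k' max)
      qed simp_all
      then show ?thesis
        unfolding lyndon_element_mult unfolding lyndon_element_def by (intro lyndon_bracket_jacobi)
    qed
    show ?case
    proof (cases "lyndon_word f")
      case False
      then obtain k where k: "lyndon_word k" "odd_word \<Psi> k" "f = k @ k"
        using f unfolding super_lyndon_word_def by blast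
      have "tree (Br (Br (bracketing k) (bracketing k)) (bracketing e)) \<in> bracket_span \<Psi> d f"
      proof (cases "e = k")
        case True
        have "tree (Br (bracketing k) (Br (bracketing k) (bracketing k))) \<in> lie_superalgebra_ideal \<Psi>"
          using k(2) magma_parity_bracketing[OF lyndon_word_nonempty[OF k(1)]] by (intro tree_cube_odd) blast
        then have "tree (Br (Br (bracketing k) (bracketing k)) (bracketing k)) \<in> lie_superalgebra_ideal \<Psi>"
          by (rule subspace_tree_commute[OF subspace_lie_ideal order.refl])
        then show ?thesis using True bracket_span_subspace(2) by blast
      next
        case False
        \<comment> \<open>\<open>e\<close> is below \<open>f = k @ k\<close> and different from
          \<open>k\<close>, and no super Lyndon word lies strictly between \<open>k\<close> and
          \<open>k @ k\<close>.\<close>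
        then have "e < k" using less_square_lyndon[OF e k(1) ef[unfolded k(3)]] by blast
        have kf: "k < f" using k lyndon_word_nonempty by simp
        have "mset k + mset k \<noteq> d" using d k(3) ne(1) by (auto simp: add.commute)
        then show ?thesis
          using k(1,3) e False d kf \<open>e < k\<close> by (intro square) (auto simp: add.commute)
      qed
      then have "tree (Br (bracketing f) (bracketing e)) \<in> bracket_span \<Psi> d f"
        using k by (simp add: bracketing_square)
      then show ?thesis
        unfolding lyndon_element_mult by (rule subspace_tree_commute[of _ \<Psi>, rotated 2]) simp_all
    next
      case lf: True
      \<comment> \<open>When \<open>f\<close> is Lyndon, equal factors are harmless as well: the
        square of a word below \<open>f\<close> is still below \<open>f\<close>.\<close>
      have below': "magma_mult (lyndon_element g) (lyndon_element h) \<in> bracket_span \<Psi> d f"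
        if gh: "super_lyndon_word \<Psi> g" "super_lyndon_word \<Psi> h" "g < f" "h < f" "mset g + mset h = d" for g h
      proof (cases "g = h")
        case True
        have "g @ g < f" using square_less_lyndon[OF lf gh(3)] super_lyndon_word_nonempty gh by blast
        then have "{h. super_lyndon_word \<Psi> h \<and> h = g @ g \<and> lyndon_word g} \<subseteq> {h. super_lyndon_word \<Psi> h \<and> mset h = d \<and> h < f}"
          using gh(5) True by auto
        then show ?thesis
          using lyndon_element_square[OF gh(1)] lie_span_mono True unfolding bracket_span_def by blast
      qed (use below gh in blast)
      show ?thesis
      proof (cases "lyndon_word e")
        case False
        then obtain j where j: "lyndon_word j" "e = j @ j" using e by (auto simp: super_lyndon_word_def)
        have "j < f"
        proof (rule le_less_trans)
          show "j \<le> e" using j by simp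
        qed (rule ef)
        have "mset j + mset j \<noteq> d" using d j ne by auto
        then have "tree (Br (Br (bracketing j) (bracketing j)) (bracketing f)) \<in> bracket_span \<Psi> d f"
          using j f d \<open>j < f\<close> by (intro square) auto
        then show ?thesis using j by (simp add: lyndon_element_mult bracketing_square)
      next
        case le: True
        show ?thesis
        \<comment> \<open>In this case \<open>[e,f]\<close> is the bracketing of the Lyndon word
          \<open>e @ f\<close>, which is below \<open>f\<close>. Otherwise both factors of
          \<open>e\<close> are below \<open>f\<close>, and the Jacobi identity distributes
          \<open>f\<close> over them.\<close>
        proof (cases "length e = 1 \<or> f \<le> right_factor e")
          case True
          have "lyndon_word (e @ f)" using lyndon_word_append le lf ef by blast
          moreover have "e @ f < f" using lyndon_wordD[OF \<open>lyndon_word (e @ f)\<close> ne] .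
          ultimately have "lyndon_element (e @ f) \<in> bracket_span \<Psi> d f"
            unfolding bracket_span_def using d
            by (intro lyndon_element_in_lie_span) (auto simp: super_lyndon_word_def)
          then show ?thesis
            using bracketing_append[OF le lf True] by (simp add: lyndon_element_def magma_mult_tree)
        next
          case False
          then have len: "2 \<le> length e" using ne by (cases e; cases "tl e") auto
          let ?l = "left_factor e" and ?r = "right_factor e"
          have lr: "super_lyndon_word \<Psi> ?l" "super_lyndon_word \<Psi> ?r"
            using lyndon_word_left_factor[OF len le] lyndon_word_right_factor[OF len]
            by (auto simp: super_lyndon_word_def)
          have app: "?l @ ?r = e" using factors_append[OF len] .
          have me: "mset e = mset ?l + mset ?r" using app by (metis mset_append)
          have lf': "?l < f"
          proof (rule le_less_trans)
            show "?l \<le> e" using app le_append[of ?l ?r] by simp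
          qed (rule ef)
          have rf: "?r < f" using False by (simp add: not_le)
          have pos: "0 < length ?l" "0 < length ?r"
            using left_factor_nonempty[OF len] right_factor_nonempty[OF len] by simp_all
          \<comment> \<open>The bracket \<open>[h,f]\<close> has smaller degree and expands into
            words below \<open>f\<close>, so the bracket with \<open>g\<close> involves only words
            below \<open>f\<close>.\<close>
          have nested: "magma_mult (lyndon_element g) (magma_mult (lyndon_element h) (lyndon_element f)) \<in> bracket_span \<Psi> d f"
            if gh: "super_lyndon_word \<Psi> g" "super_lyndon_word \<Psi> h" "g < f" "h < f" "mset g + mset h = mset e"
              "0 < length g" for g h
          proof (rule lie_span_mult_right)
            have "length h + length f < size d" using size_d arg_cong[OF gh(5), of size] gh(6) by (simp del: length_greater_0_conv)
            from smaller[OF gh(2) f _ this]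
            show "magma_mult (lyndon_element h) (lyndon_element f) \<in>
                lie_span \<Psi> {k. super_lyndon_word \<Psi> k \<and> mset k = mset h + mset f \<and> k < f}"
              using gh(4) unfolding bracket_span_def max_absorb2[OF less_imp_le[OF gh(4)]] by blast
            fix k assume "k \<in> {k. super_lyndon_word \<Psi> k \<and> mset k = mset h + mset f \<and> k < f}"
            then show "magma_mult (lyndon_element g) (lyndon_element k) \<in> bracket_span \<Psi> d f"
              using gh d by (intro below') (simp_all flip: add.assoc)
          qed simp_all
          have "magma_mult (lyndon_element ?l) (magma_mult (lyndon_element ?r) (lyndon_element f)) \<in> bracket_span \<Psi> d f"
            using me by (intro nested lr lf' rf pos) simp
          moreover have "magma_mult (lyndon_element ?r) (magma_mult (lyndon_element ?l) (lyndon_element f)) \<in> bracket_span \<Psi> d f"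
            using me by (intro nested lr lf' rf pos) (simp add: add.commute)
          ultimately have "tree (Br (Br (bracketing ?l) (bracketing ?r)) (bracketing f)) \<in> bracket_span \<Psi> d f"
            unfolding lyndon_element_mult unfolding lyndon_element_def by (intro lyndon_bracket_jacobi)
          then show ?thesis by (simp add: lyndon_element_mult bracketing_long[OF len])
        qed
      qed
    qed
  qed
qed

definition super_lyndon_words :: "'i::linorder set \<Rightarrow> 'i multiset \<Rightarrow> 'i list set" where
  "super_lyndon_words \<Psi> d = {w. super_lyndon_word \<Psi> w \<and> mset w = d}"

lemma finite_super_lyndon_words: "finite (super_lyndon_words \<Psi> d)"
proof (rule finite_subset)
  show "super_lyndon_words \<Psi> d \<subseteq> {w. mset w = d}" by (auto simp: super_lyndon_words_def)
  show "finite {w. mset w = d}"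
    using mset_eq_finite by (metis (mono_tags, lifting) Collect_cong ex_mset)
qed

lemma lie_span_mult:
  assumes x: "x \<in> lie_span \<Psi> (super_lyndon_words \<Psi> c)" and y: "y \<in> lie_span \<Psi> (super_lyndon_words \<Psi> d)"
  shows "magma_mult x y \<in> lie_span \<Psi> (super_lyndon_words \<Psi> (c + d))"
proof -
  have "magma_mult (lyndon_element g) (lyndon_element h) \<in> lie_span \<Psi> (super_lyndon_words \<Psi> (c + d))"
    if g: "g \<in> super_lyndon_words \<Psi> c" and h: "h \<in> super_lyndon_words \<Psi> d" for g h
  proof -
    have s: "super_lyndon_word \<Psi> g" "super_lyndon_word \<Psi> h" "mset g + mset h = c + d"
      using g h by (auto simp: super_lyndon_words_def)
    have sub: "bracket_span \<Psi> (c + d) f \<subseteq> lie_span \<Psi> (super_lyndon_words \<Psi> (c + d))" for f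
      unfolding bracket_span_def by (rule lie_span_mono) (auto simp: super_lyndon_words_def)
    consider "g < h" | "h < g" | "g = h" by fastforce
    then show ?thesis
    proof cases
      case 1
      then show ?thesis using lyndon_bracket_in_span[OF s(1,2) 1 s(3)] sub by blast
    next
      case 2
      have "mset h + mset g = c + d" using s(3) by (simp add: add.commute)
      then have "magma_mult (lyndon_element h) (lyndon_element g) \<in> bracket_span \<Psi> (c + d) g"
        using lyndon_bracket_in_span[OF s(2,1) 2] by blast
      then show ?thesis using lyndon_bracket_commute sub by blast
    next
      case 3
      have "{f. super_lyndon_word \<Psi> f \<and> f = g @ g \<and> lyndon_word g} \<subseteq> super_lyndon_words \<Psi> (c + d)"
        using s(3) 3 by (auto simp: super_lyndon_words_def)
      then show ?thesis using lyndon_element_square[OF s(1)] lie_span_mono 3 by blast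
    qed
  qed
  then have "magma_mult (lyndon_element g) y \<in> lie_span \<Psi> (super_lyndon_words \<Psi> (c + d))"
    if "g \<in> super_lyndon_words \<Psi> c" for g
    using lie_span_mult_right[OF y subspace_lie_span lie_ideal_subset_lie_span] that by blast
  then show ?thesis
    using lie_span_mult_left[OF x subspace_lie_span lie_ideal_subset_lie_span] by blast
qed

lemma tree_in_lie_span: "tree t \<in> lie_span \<Psi> (super_lyndon_words \<Psi> (leaves t))"
proof (induction t)
  case (Gen i)
  have "tree (Gen i) = lyndon_element [i]" by (simp add: lyndon_element_def)
  then show ?case
    using lyndon_element_in_lie_span[of "[i]"] by (simp add: super_lyndon_words_def super_lyndon_word_def)
next
  case (Br s t)
  then show ?case using lie_span_mult[OF Br] by (simp add: magma_mult_tree)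
qed

lemma lyndon_element_in_degree:
  "super_lyndon_word \<Psi> w \<Longrightarrow> lyndon_element w \<in> lie_span \<Psi> (super_lyndon_words \<Psi> (mset w))"
  by (rule lyndon_element_in_lie_span) (simp add: super_lyndon_words_def)

section \<open>Signed sums over heaps\<close>

text \<open>
  Modulo \<open>ab = \<plusminus>ba\<close> every word is, up to sign, determined by its heap; the sign is the parity of the
  number of inversions among the odd letters.  Summing coefficients over a heap with these signs
  is a linear functional that vanishes on the relations.
\<close>

definition letter_sign :: "'i::linorder set \<Rightarrow> 'i \<Rightarrow> 'i list \<Rightarrow> complex" where
  "letter_sign \<Psi> a w = (if a \<in> \<Psi> then (- 1) ^ length (filter (\<lambda>b. b \<in> \<Psi> \<and> b < a) w) else 1)"

primrec inversion_sign :: "'i::linorder set \<Rightarrow> 'i list \<Rightarrow> complex" where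
  "inversion_sign \<Psi> [] = 1"
| "inversion_sign \<Psi> (a # w) = letter_sign \<Psi> a w * inversion_sign \<Psi> w"

text \<open>The inversions between two blocks. They depend only on the multisets of letters, so the
  sign of a word splits at any cut into the signs of its parts and a factor constant on their
  heaps.\<close>

definition block_sign :: "'i::linorder set \<Rightarrow> 'i list \<Rightarrow> 'i list \<Rightarrow> complex" where
  "block_sign \<Psi> u v = prod_list (map (\<lambda>a. letter_sign \<Psi> a v) u)"

lemma letter_sign_append: "letter_sign \<Psi> a (u @ v) = letter_sign \<Psi> a u * letter_sign \<Psi> a v"
  by (simp add: letter_sign_def power_add)

lemma inversion_sign_append:
  "inversion_sign \<Psi> (u @ v) = inversion_sign \<Psi> u * inversion_sign \<Psi> v * block_sign \<Psi> u v"
  by (induction u) (auto simp: block_sign_def letter_sign_append)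

lemma inversion_sign_nonzero: "inversion_sign \<Psi> w \<noteq> 0"
  by (induction w) (auto simp: letter_sign_def)

lemma letter_sign_mset_cong: "mset v = mset v' \<Longrightarrow> letter_sign \<Psi> a v = letter_sign \<Psi> a v'"
  unfolding letter_sign_def by (metis mset_filter size_mset)

lemma block_sign_mset_cong: "mset u = mset u' \<Longrightarrow> mset v = mset v' \<Longrightarrow> block_sign \<Psi> u v = block_sign \<Psi> u' v'"
proof -
  assume u: "mset u = mset u'" and v: "mset v = mset v'"
  have "block_sign \<Psi> u v = prod_mset (image_mset (\<lambda>a. letter_sign \<Psi> a v) (mset u))"
    unfolding block_sign_def by (metis mset_map prod_mset_prod_list)
  also have "\<dots> = prod_mset (image_mset (\<lambda>a. letter_sign \<Psi> a v') (mset u'))"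
    using u letter_sign_mset_cong[OF v] by simp
  also have "\<dots> = block_sign \<Psi> u' v'"
    unfolding block_sign_def by (metis mset_map prod_mset_prod_list)
  finally show ?thesis .
qed

context supergraph
begin

section \<open>The signed sum functionals and the kernel\<close>

definition heap_sum :: "('i list \<Rightarrow> complex) \<Rightarrow> 'i list \<Rightarrow> complex" where
  "heap_sum f w = (\<Sum>v\<in>heap_of adj w. inversion_sign \<Psi> v * f v)"

text \<open>By right cancellation, the words of a heap with a prescribed ending vary only through a
  beginning taken from one heap. Sums over a heap can thus be evaluated fibre by fibre.\<close>

lemma heap_of_fiber_right:
  assumes "x0 \<in> heap_of adj w"
  shows "{x \<in> heap_of adj w. drop i x = drop i x0} = (\<lambda>u. u @ drop i x0) ` heap_of adj (take i x0)"
proof (intro equalityI subsetI)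
  fix x assume "x \<in> {x \<in> heap_of adj w. drop i x = drop i x0}"
  then have x: "w \<approx> x" "drop i x = drop i x0" by (auto simp: mem_heap_of)
  have "w \<approx> take i x0 @ drop i x0" using assms by (simp add: mem_heap_of)
  moreover have "w \<approx> take i x @ drop i x0" using x by (metis append_take_drop_id)
  ultimately have "take i x0 @ drop i x0 \<approx> take i x @ drop i x0" using heap_eq_trans heap_eq_sym by blast
  then have "take i x0 \<approx> take i x" by (simp only: heap_eq_cancel_right)
  then show "x \<in> (\<lambda>u. u @ drop i x0) ` heap_of adj (take i x0)"
    using x(2) by (intro image_eqI[of _ _ "take i x"]) (simp_all add: mem_heap_of flip: x(2))
next
  fix x assume "x \<in> (\<lambda>u. u @ drop i x0) ` heap_of adj (take i x0)"
  then obtain u where u: "x = u @ drop i x0" "take i x0 \<approx> u" by (auto simp: mem_heap_of)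
  have w: "w \<approx> take i x0 @ drop i x0" using assms by (simp add: mem_heap_of)
  have "w \<approx> x" using heap_eq_trans[OF w heap_eq_append_right[OF u(2)]] u(1) by simp
  moreover have "drop i x = drop i x0"
  proof (cases "i \<le> length x0")
    case True
    then have "length u = i" using heap_eq_length[OF u(2)] by simp
    then show ?thesis using u(1) by simp
  next
    case False
    then show ?thesis using u heap_eq_length[OF u(2)] by simp
  qed
  ultimately show "x \<in> {x \<in> heap_of adj w. drop i x = drop i x0}" by (simp add: mem_heap_of)
qed

lemma heap_of_fiber_left:
  assumes "x0 \<in> heap_of adj w"
  shows "{x \<in> heap_of adj w. take i x = take i x0} = (\<lambda>v. take i x0 @ v) ` heap_of adj (drop i x0)"
proof (intro equalityI subsetI)
  fix x assume "x \<in> {x \<in> heap_of adj w. take i x = take i x0}"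
  then have x: "w \<approx> x" "take i x = take i x0" by (auto simp: mem_heap_of)
  have "w \<approx> take i x0 @ drop i x0" using assms by (simp add: mem_heap_of)
  moreover have "w \<approx> take i x0 @ drop i x" using x by (metis append_take_drop_id)
  ultimately have "take i x0 @ drop i x0 \<approx> take i x0 @ drop i x" using heap_eq_trans heap_eq_sym by blast
  then have "drop i x0 \<approx> drop i x" by (simp only: heap_eq_cancel_left)
  then show "x \<in> (\<lambda>v. take i x0 @ v) ` heap_of adj (drop i x0)"
    using x(2) by (intro image_eqI[of _ _ "drop i x"]) (simp_all add: mem_heap_of flip: x(2))
next
  fix x assume "x \<in> (\<lambda>v. take i x0 @ v) ` heap_of adj (drop i x0)"
  then obtain v where v: "x = take i x0 @ v" "drop i x0 \<approx> v" by (auto simp: mem_heap_of)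
  have w: "w \<approx> take i x0 @ drop i x0" using assms by (simp add: mem_heap_of)
  have "w \<approx> x" using heap_eq_trans[OF w heap_eq_append_left[OF v(2)]] v(1) by simp
  moreover have "take i x = take i x0"
  proof (cases "i \<le> length x0")
    case True
    then show ?thesis using v(1) by simp
  next
    case False
    then show ?thesis using v heap_eq_length[OF v(2)] by simp
  qed
  ultimately show "x \<in> {x \<in> heap_of adj w. take i x = take i x0}" by (simp add: mem_heap_of)
qed

text \<open>Group the words by their ending \<open>v\<close>. On each fibre the weight and the block
  sign are constant, and what remains is a multiple of \<open>heap_sum f u0\<close>. The weight
  \<open>c\<close> stands for the constant 1 or the parity sign, the two coefficients in
  \<open>super_bracket\<close>.\<close>

lemma weighted_heap_sum_left:
  assumes f: "\<And>u. heap_sum f u = 0"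
    and c: "\<And>u u' v. mset u = mset u' \<Longrightarrow> c u v = c u' v"
  shows "(\<Sum>x\<in>heap_of adj w. inversion_sign \<Psi> x * (c (take i x) (drop i x) * (f (take i x) * g (drop i x)))) = 0"
    (is "sum ?h _ = 0")
proof -
  let ?H = "heap_of adj w"
  have "sum ?h ?H = (\<Sum>v\<in>drop i ` ?H. sum ?h {x \<in> ?H. drop i x = v})"
    by (rule sum.image_gen) (rule finite_heap_of)
  also have "\<dots> = 0"
  proof (rule sum.neutral, rule ballI)
    fix v assume "v \<in> drop i ` ?H"
    then obtain x0 where x0: "x0 \<in> ?H" "v = drop i x0" by blast
    define u0 where "u0 = take i x0"
    have len: "take i (u @ v) = u" "drop i (u @ v) = v" if "u \<in> heap_of adj u0" for u
    proof -
      have "length u = length u0" using that heap_eq_length by (metis mem_heap_of)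
      then show "take i (u @ v) = u" "drop i (u @ v) = v"
        unfolding u0_def x0(2) by (auto simp: min_def split: if_splits)
    qed
    have "sum ?h {x \<in> ?H. drop i x = v} = (\<Sum>u\<in>heap_of adj u0. ?h (u @ v))"
      unfolding x0(2) heap_of_fiber_right[OF x0(1)] u0_def
      by (subst sum.reindex) (auto simp: inj_on_def)
    also have "\<dots> = (\<Sum>u\<in>heap_of adj u0. inversion_sign \<Psi> v * block_sign \<Psi> u0 v * c u0 v * g v * (inversion_sign \<Psi> u * f u))"
    proof (intro sum.cong refl)
      fix u assume u: "u \<in> heap_of adj u0"
      then have m: "mset u = mset u0" using heap_eq_mset[of u0 u] by (simp add: mem_heap_of)
      show "?h (u @ v) = inversion_sign \<Psi> v * block_sign \<Psi> u0 v * c u0 v * g v * (inversion_sign \<Psi> u * f u)"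
        unfolding len[OF u] inversion_sign_append c[OF m] block_sign_mset_cong[OF m refl] by (simp add: mult_ac)
    qed
    also have "\<dots> = inversion_sign \<Psi> v * block_sign \<Psi> u0 v * c u0 v * g v * heap_sum f u0"
      by (simp add: heap_sum_def sum_distrib_left)
    finally show "sum ?h {x \<in> ?H. drop i x = v} = 0" by (simp add: f)
  qed
  finally show ?thesis .
qed

lemma weighted_heap_sum_right:
  assumes f: "\<And>u. heap_sum f u = 0"
    and c: "\<And>u v v'. mset v = mset v' \<Longrightarrow> c u v = c u v'"
  shows "(\<Sum>x\<in>heap_of adj w. inversion_sign \<Psi> x * (c (take i x) (drop i x) * (g (take i x) * f (drop i x)))) = 0"
    (is "sum ?h _ = 0")
proof -
  let ?H = "heap_of adj w"
  have "sum ?h ?H = (\<Sum>u\<in>take i ` ?H. sum ?h {x \<in> ?H. take i x = u})"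
    by (rule sum.image_gen) (rule finite_heap_of)
  also have "\<dots> = 0"
  proof (rule sum.neutral, rule ballI)
    fix u assume "u \<in> take i ` ?H"
    then obtain x0 where x0: "x0 \<in> ?H" "u = take i x0" by blast
    define v0 where "v0 = drop i x0"
    have len: "take i (u @ v) = u" "drop i (u @ v) = v" if "v \<in> heap_of adj v0" for v
    proof -
      have "length v = length v0" using that heap_eq_length by (metis mem_heap_of)
      then show "take i (u @ v) = u" "drop i (u @ v) = v"
        unfolding v0_def x0(2) by (auto simp: min_def)
    qed
    have "sum ?h {x \<in> ?H. take i x = u} = (\<Sum>v\<in>heap_of adj v0. ?h (u @ v))"
      unfolding x0(2) heap_of_fiber_left[OF x0(1)] v0_def
      by (subst sum.reindex) (auto simp: inj_on_def)
    also have "\<dots> = (\<Sum>v\<in>heap_of adj v0. inversion_sign \<Psi> u * block_sign \<Psi> u v0 * c u v0 * g u * (inversion_sign \<Psi> v * f v))"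
    proof (intro sum.cong refl)
      fix v assume v: "v \<in> heap_of adj v0"
      then have m: "mset v = mset v0" using heap_eq_mset[of v0 v] by (simp add: mem_heap_of)
      show "?h (u @ v) = inversion_sign \<Psi> u * block_sign \<Psi> u v0 * c u v0 * g u * (inversion_sign \<Psi> v * f v)"
        unfolding len[OF v] inversion_sign_append c[OF m] block_sign_mset_cong[OF refl m] by (simp add: mult_ac)
    qed
    also have "\<dots> = inversion_sign \<Psi> u * block_sign \<Psi> u v0 * c u v0 * g u * heap_sum f v0"
      by (simp add: heap_sum_def sum_distrib_left)
    finally show "sum ?h {x \<in> ?H. take i x = u} = 0" by (simp add: f)
  qed
  finally show ?thesis .
qed

lemma heap_sum_super_bracket:
  "heap_sum (super_bracket \<Psi> f g) w = (\<Sum>i\<le>length w.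
     (\<Sum>x\<in>heap_of adj w. inversion_sign \<Psi> x * (1 * (f (take i x) * g (drop i x)))) -
     (\<Sum>x\<in>heap_of adj w. inversion_sign \<Psi> x * (parity_sign (odd_word \<Psi> (take i x)) (odd_word \<Psi> (drop i x)) *
        (g (take i x) * f (drop i x)))))"
proof -
  have "heap_sum (super_bracket \<Psi> f g) w = (\<Sum>x\<in>heap_of adj w. \<Sum>i\<le>length w.
     inversion_sign \<Psi> x * (1 * (f (take i x) * g (drop i x))) -
     inversion_sign \<Psi> x * (parity_sign (odd_word \<Psi> (take i x)) (odd_word \<Psi> (drop i x)) *
        (g (take i x) * f (drop i x))))"
    unfolding heap_sum_def
  proof (intro sum.cong refl)
    fix x assume "x \<in> heap_of adj w"
    then have "length x = length w" using heap_eq_length[of w x] by (simp add: mem_heap_of)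
    then show "inversion_sign \<Psi> x * super_bracket \<Psi> f g x = (\<Sum>i\<le>length w.
       inversion_sign \<Psi> x * (1 * (f (take i x) * g (drop i x))) -
       inversion_sign \<Psi> x * (parity_sign (odd_word \<Psi> (take i x)) (odd_word \<Psi> (drop i x)) *
        (g (take i x) * f (drop i x))))"
      by (simp add: super_bracket_def sum_distrib_left right_diff_distrib)
  qed
  then show ?thesis by (subst (asm) sum.swap) (simp add: sum_subtractf)
qed

lemma heap_sum_super_bracket_zero:
  assumes f: "\<And>u. heap_sum f u = 0"
  shows "heap_sum (super_bracket \<Psi> f g) w = 0" "heap_sum (super_bracket \<Psi> g f) w = 0"
  unfolding heap_sum_super_bracket
  using weighted_heap_sum_left[OF f, where c = "\<lambda>_ _. 1"]
    weighted_heap_sum_right[OF f, where c = "\<lambda>_ _. 1"]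
    weighted_heap_sum_left[OF f, where c = "\<lambda>u v. parity_sign (odd_word \<Psi> u) (odd_word \<Psi> v)"]
    weighted_heap_sum_right[OF f, where c = "\<lambda>u v. parity_sign (odd_word \<Psi> u) (odd_word \<Psi> v)"]
    odd_word_mset_cong
  by (simp_all cong: odd_word_mset_cong)

text \<open>By \<open>null_ideal_least\<close> it is enough to check an ideal containing the
  relations. The signs are made for the commuting generators: the words \<open>ij\<close> and
  \<open>ji\<close> lie in the same heaps, and their signed coefficients in \<open>[i,j]\<close>
  cancel.\<close>

lemma heap_sum_null:
  assumes "x \<in> null_ideal" shows "heap_sum (series \<Psi> x) w = 0"
proof -
  let ?I = "{x. \<forall>w. heap_sum (series \<Psi> x) w = 0}"
  have "null_ideal \<subseteq> ?I"
  proof (rule null_ideal_least)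
    show "algebra_ideal free_algebra ?I"
    proof (rule algebra_ideal_free_algebraI)
      show "vec.subspace ?I"
        unfolding vec.subspace_def
        by (simp add: heap_sum_def series_add distrib_left sum.distrib mult.left_commute flip: sum_distrib_left)
      show "magma_mult x y \<in> ?I \<and> magma_mult y x \<in> ?I" if "y \<in> ?I" for x y
        using heap_sum_super_bracket_zero that by (simp add: series_mult)
    qed
    show "lie_superalgebra_relations \<Psi> \<subseteq> ?I"
      by (auto simp: heap_sum_def series_lie_superalgebra_relation)
    show "tree (Br (Gen i) (Gen j)) \<in> ?I" if ij: "indep i j" for i j
    proof -
      have ne: "i \<noteq> j" using ij by (auto simp: indep_def)
      have swap: "[i, j] \<approx> [j, i]" using swap_heap_eq[OF ij, of "[]" "[]"] by simp
      have s: "series_parity \<Psi> (i \<in> \<Psi>) (tree_series \<Psi> (Gen i))" for i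
        using series_parity_tree[of \<Psi> "Gen i"] by simp
      have conv_gen: "conv (tree_series \<Psi> (Gen i)) (tree_series \<Psi> (Gen j)) v = (if v = [i, j] then 1 else 0)" for i j v
      proof -
        have "conv (tree_series \<Psi> (Gen i)) (tree_series \<Psi> (Gen j)) v =
            (\<Sum>k\<le>length v. if k = 1 \<and> v = [i, j] then 1 else 0)"
          unfolding conv_def
        proof (intro sum.cong refl)
          fix k
          have "take k v = [i] \<and> drop k v = [j] \<longleftrightarrow> k = 1 \<and> v = [i, j]"
          proof
            assume a: "take k v = [i] \<and> drop k v = [j]"
            then have "v = [i, j]" using append_take_drop_id[of k v] by simp
            moreover from this have "k = 1" using arg_cong[OF conjunct1[OF a], of length] by simp
            ultimately show "k = 1 \<and> v = [i, j]" by simp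
          qed auto
          then show "tree_series \<Psi> (Gen i) (take k v) * tree_series \<Psi> (Gen j) (drop k v) =
            (if k = 1 \<and> v = [i, j] then 1 else 0)" by auto
        qed
        then show ?thesis by (cases "v = [i, j]") simp_all
      qed
      have "heap_sum (series \<Psi> (tree (Br (Gen i) (Gen j)))) w = 0" for w
      proof -
        have mem: "[i, j] \<in> heap_of adj w \<longleftrightarrow> [j, i] \<in> heap_of adj w"
          using swap heap_eq_trans heap_eq_sym unfolding mem_heap_of by blast
        \<comment> \<open>Exchanging two distinct odd letters creates or removes exactly one
          inversion; with any other parities no inversion is counted.\<close>
        have sign: "parity_sign (i \<in> \<Psi>) (j \<in> \<Psi>) * inversion_sign \<Psi> [j, i] = inversion_sign \<Psi> [i, j]"
          using ne by (cases "i < j") (auto simp: letter_sign_def parity_sign_def)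
        have val: "inversion_sign \<Psi> v * series \<Psi> (tree (Br (Gen i) (Gen j))) v =
            (if v = [i, j] then inversion_sign \<Psi> [i, j] else 0) -
            (if v = [j, i] then inversion_sign \<Psi> [i, j] else 0)" for v
          unfolding series_single tree_series.simps(2) super_bracket_homogeneous[OF s s] conv_gen sign[symmetric]
          using ne sign by (simp add: mult.commute del: inversion_sign.simps)
        have "heap_sum (series \<Psi> (tree (Br (Gen i) (Gen j)))) w =
          (\<Sum>v\<in>heap_of adj w. (if v = [i, j] then inversion_sign \<Psi> [i, j] else 0) -
            (if v = [j, i] then inversion_sign \<Psi> [i, j] else 0))"
          unfolding heap_sum_def val ..
        also have "\<dots> = 0"
          by (simp only: sum_subtractf sum.delta[OF finite_heap_of] mem diff_self)
        finally show ?thesis .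
      qed
      then show ?thesis by blast
    qed
  qed
  then show ?thesis using assms by blast
qed

lemma heap_sum_leading:
  assumes f: "leading_word f w" and w: "standard w"
  shows "heap_sum f w \<noteq> 0"
proof -
  have "heap_sum f w = (\<Sum>v\<in>{w}. inversion_sign \<Psi> v * f v)"
    unfolding heap_sum_def
  proof (rule sum.mono_neutral_right)
    show "\<forall>v\<in>heap_of adj w - {w}. inversion_sign \<Psi> v * f v = 0"
    proof
      fix v assume v: "v \<in> heap_of adj w - {w}"
      then have "v < w" using w by (auto simp: standard_def mem_heap_of)
      then show "inversion_sign \<Psi> v * f v = 0" using leading_wordD(4)[OF f, of v] by auto
    qed
  qed (auto simp: finite_heap_of mem_heap_of)
  then show ?thesis using inversion_sign_nonzero leading_wordD(1)[OF f] by simp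
qed

lemma heap_sum_above:
  assumes "standard w" "\<And>v. f v \<noteq> 0 \<Longrightarrow> w < v"
  shows "heap_sum f w = 0"
  unfolding heap_sum_def
proof (rule sum.neutral, rule ballI)
  fix v assume "v \<in> heap_of adj w"
  then have "\<not> w < v" using assms(1) by (auto simp: standard_def mem_heap_of not_less)
  then show "inversion_sign \<Psi> v * f v = 0" using assms(2)[of v] by auto
qed

end

section \<open>Tools for the elimination: Lyndon decomposition and triangular exchange\<close>

lemma lyndon_word_Cons_least:
  assumes "\<And>c. c \<in> set u \<Longrightarrow> a < c" shows "lyndon_word (a # u)"
proof -
  have "a # u < s" if ps: "a # u = p @ s" "p \<noteq> []" "s \<noteq> []" for p s
  proof -
    have "hd s \<in> set u" using ps by (cases p; cases s) auto
    then have "a < hd s" by (rule assms)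
    then show ?thesis using ps(3) by (cases s) auto
  qed
  then show ?thesis by (auto simp: lyndon_word_def)
qed

text \<open>Smallest suffixes are peeled off as in the Chen-Fox-Lyndon factorization. They do not
  decrease towards the left: if \<open>?r' < ?r\<close>, then either the suffix
  \<open>?r' @ ?r\<close> of \<open>q\<close> would be below \<open>?r\<close>, or
  \<open>?r = ?r' @ t\<close> and minimality would give \<open>t \<le> ?r\<close>, although
  \<open>?r\<close> is Lyndon.\<close>

lemma lyndon_decomposition:
  assumes "q \<noteq> []" "w < min_suffix q"
  obtains qs where "concat qs = q" "\<And>x. x \<in> set qs \<Longrightarrow> lyndon_word x \<and> w < x"
proof -
  have "\<exists>qs. concat qs = q \<and> (\<forall>x\<in>set qs. lyndon_word x \<and> w < x)"
    using assms
  proof (induction q rule: length_induct)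
    case (1 q)
    let ?r = "min_suffix q"
    note r = min_suffix[OF 1(2)] and lr = lyndon_word_min_suffix[OF 1(2)]
    obtain q' where q: "q = q' @ ?r" using r(1) by (auto simp: suffix_def)
    show ?case
    proof (cases "q' = []")
      case True
      then show ?thesis using q lr 1(3) by (intro exI[of _ "[?r]"]) auto
    next
      case False
      let ?r' = "min_suffix q'"
      note r' = min_suffix[OF False]
      have "?r \<le> ?r'"
      proof (rule ccontr)
        assume "\<not> ?r \<le> ?r'"
        then have "?r' < ?r" by simp
        have "suffix (?r' @ ?r) q"
          using r'(1) unfolding suffix_def by (metis append.assoc q)
        then have le: "?r \<le> ?r' @ ?r" using r(3) r'(2) by simp
        from \<open>?r' < ?r\<close> consider "lex_below ?r' ?r" | t where "t \<noteq> []" "?r = ?r' @ t"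
          by (auto simp: list_less_cases)
        then show False
        proof cases
          case 1
          then have "?r' @ ?r < ?r" using lex_below_append_less[of ?r' ?r ?r "[]"] by simp
          then show False using le by simp
        next
          case (2 t)
          then have "?r < t" using lr lyndon_wordD r'(2) by metis
          moreover have "t \<le> ?r" using le 2(2) by (metis append_le_append)
          ultimately show False by simp
        qed
      qed
      then have "w < ?r'" using 1(3) by simp
      moreover have "length q' < length q" using arg_cong[OF q, of length] r(2) by simp
      ultimately obtain qs where "concat qs = q'" "\<forall>x\<in>set qs. lyndon_word x \<and> w < x"
        using 1(1) False by blast
      then show ?thesis using q lr 1(3) by (intro exI[of _ "qs @ [?r]"]) auto
    qed
  qed
  then show thesis using that by blast
qed

lemma lie_span_coefficients:
  assumes "x \<in> lie_span \<Psi> A" "finite A"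
  obtains k c where "k \<in> lie_superalgebra_ideal \<Psi>"
    "x = k + (\<Sum>h\<in>A. scale (c h) (lyndon_element h))"
proof -
  let ?P = "{x. \<exists>k c. k \<in> lie_superalgebra_ideal \<Psi> \<and> x = k + (\<Sum>h\<in>A. scale (c h) (lyndon_element h))}"
  have "x \<in> ?P"
    using assms(1) unfolding lie_span_def
  proof (rule vec.span_induct[where P = "\<lambda>x. x \<in> ?P"])
    show "vec.subspace {x. x \<in> ?P}"
      unfolding vec.subspace_def
    proof (intro conjI ballI allI)
      show "0 \<in> {x. x \<in> ?P}"
        using vec.subspace_0[OF subspace_lie_ideal[of \<Psi>]]
        by (intro CollectI exI[of _ 0] exI[of _ "\<lambda>_. 0"]) simp
    next
      fix x y assume "x \<in> {x. x \<in> ?P}" "y \<in> {x. x \<in> ?P}"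
      then obtain k c l d where "k \<in> lie_superalgebra_ideal \<Psi>" "l \<in> lie_superalgebra_ideal \<Psi>"
        "x = k + (\<Sum>h\<in>A. scale (c h) (lyndon_element h))"
        "y = l + (\<Sum>h\<in>A. scale (d h) (lyndon_element h))" by blast
      then show "x + y \<in> {x. x \<in> ?P}"
        using vec.subspace_add[OF subspace_lie_ideal[of \<Psi>], of k l]
        by (intro CollectI exI[of _ "k + l"] exI[of _ "\<lambda>h. c h + d h"])
           (simp add: vec.scale_left_distrib sum.distrib)
    next
      fix x b assume "x \<in> {x. x \<in> ?P}"
      then obtain k c where "k \<in> lie_superalgebra_ideal \<Psi>"
        "x = k + (\<Sum>h\<in>A. scale (c h) (lyndon_element h))" by blast
      then show "scale b x \<in> {x. x \<in> ?P}"
        using vec.subspace_scale[OF subspace_lie_ideal[of \<Psi>], of k b]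
        by (intro CollectI exI[of _ "scale b k"] exI[of _ "\<lambda>h. b * c h"])
           (simp add: vec.scale_right_distrib vec.scale_sum_right)
    qed
  next
    fix x assume "x \<in> lie_superalgebra_ideal \<Psi> \<union> lyndon_element ` A"
    then show "x \<in> ?P"
    proof
      assume "x \<in> lie_superalgebra_ideal \<Psi>"
      then show ?thesis by (intro CollectI exI[of _ x] exI[of _ "\<lambda>_. 0"]) simp
    next
      assume "x \<in> lyndon_element ` A"
      then obtain w where w: "w \<in> A" "x = lyndon_element w" by blast
      have "(\<Sum>h\<in>A. scale (if h = w then 1 else 0) (lyndon_element h)) =
          (\<Sum>h\<in>{w}. scale (if h = w then 1 else 0) (lyndon_element h))"
        using w assms(2) by (intro sum.mono_neutral_right) auto
      then show ?thesis
        using w vec.subspace_0[OF subspace_lie_ideal[of \<Psi>]]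
        by (intro CollectI exI[of _ 0] exI[of _ "\<lambda>h. if h = w then 1 else 0"]) simp
    qed
  qed
  then show thesis using that by blast
qed

lemma series_lyndon_element: "series \<Psi> (lyndon_element w) = tree_series \<Psi> (bracketing w)"
  by (rule ext) (simp add: lyndon_element_def)

lemma leading_word_lyndon_element:
  "super_lyndon_word \<Psi> w \<Longrightarrow> leading_word (series \<Psi> (lyndon_element w)) w"
  by (simp add: series_lyndon_element leading_word_super_lyndon)

text \<open>Modulo the Lie ideal, \<open>x\<close> is a combination of Lyndon elements of its
  degree. Triangularity of the leading words rules out those below \<open>w\<close> and makes the
  coefficient at \<open>w\<close> nonzero, so the combination can be solved for
  \<open>[w]\<close>.\<close>

lemma lyndon_element_exchange:
  assumes w: "super_lyndon_word \<Psi> w" and x: "x \<in> lie_span \<Psi> (super_lyndon_words \<Psi> (mset w))"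
    and lead: "leading_word (series \<Psi> x) w"
  shows "lyndon_element w \<in> vec.span
     (insert x (lie_superalgebra_ideal \<Psi> \<union> lyndon_element ` {h \<in> super_lyndon_words \<Psi> (mset w). w < h}))"
    (is "_ \<in> vec.span ?S")
proof -
  let ?D = "super_lyndon_words \<Psi> (mset w)"
  obtain k c where k: "k \<in> lie_superalgebra_ideal \<Psi>"
    "x = k + (\<Sum>h\<in>?D. scale (c h) (lyndon_element h))"
    using lie_span_coefficients[OF x finite_super_lyndon_words] by blast
  have series_x: "series \<Psi> x v = (\<Sum>h\<in>?D. c h * series \<Psi> (lyndon_element h) v)" for v
    using series_lie_superalgebra_ideal[OF k(1)] by (simp add: k(2) series_add series_sum)
  have leadD: "leading_word (series \<Psi> (lyndon_element h)) h" if "h \<in> ?D" for h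
    using that leading_word_lyndon_element by (auto simp: super_lyndon_words_def)
  have diag: "series \<Psi> x v = c v * series \<Psi> (lyndon_element v) v"
    if v: "v \<in> ?D" and small: "\<And>h. h \<in> ?D \<Longrightarrow> h < v \<Longrightarrow> c h = 0" for v
  proof -
    have "series \<Psi> x v = (\<Sum>h\<in>{v}. c h * series \<Psi> (lyndon_element h) v)"
      unfolding series_x
    proof (rule sum.mono_neutral_right[OF finite_super_lyndon_words])
      show "\<forall>h\<in>?D - {v}. c h * series \<Psi> (lyndon_element h) v = 0"
      proof
        fix h assume h: "h \<in> ?D - {v}"
        show "c h * series \<Psi> (lyndon_element h) v = 0"
        proof (cases "h < v")
          case True
          then show ?thesis using small h by simp
        next
          case False
          then have "\<not> h \<le> v" using h by auto
          then have "series \<Psi> (lyndon_element h) v = 0" using leading_wordD(4)[OF leadD] h by blast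
          then show ?thesis by simp
        qed
      qed
    qed (use v in simp)
    then show ?thesis by simp
  qed
  have small: "c h = 0" if "h \<in> ?D" "h < w" for h
  proof (rule ccontr)
    assume "c h \<noteq> 0"
    \<comment> \<open>At the smallest such word only its own Lyndon element contributes, so
      \<open>series \<Psi> x\<close> would be nonzero at a word below its leading word
      \<open>w\<close>.\<close>
    define h0 where "h0 = Min {h \<in> ?D. h < w \<and> c h \<noteq> 0}"
    have fin: "finite {h \<in> ?D. h < w \<and> c h \<noteq> 0}" using finite_super_lyndon_words[of \<Psi>] by simp
    have "h0 \<in> {h \<in> ?D. h < w \<and> c h \<noteq> 0}"
      unfolding h0_def using that \<open>c h \<noteq> 0\<close> by (intro Min_in fin) blast
    then have h0: "h0 \<in> ?D" "h0 < w" "c h0 \<noteq> 0" by auto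
    have "c g = 0" if "g \<in> ?D" "g < h0" for g
    proof (rule ccontr)
      assume "c g \<noteq> 0"
      then have "h0 \<le> g" unfolding h0_def using that h0(2) by (intro Min_le fin) auto
      then show False using that by simp
    qed
    then have "series \<Psi> x h0 = c h0 * series \<Psi> (lyndon_element h0) h0" by (rule diag[OF h0(1)])
    then have "series \<Psi> x h0 \<noteq> 0" using h0(3) leading_wordD(1)[OF leadD[OF h0(1)]] by simp
    then show False using leading_wordD(4)[OF lead] h0(2) by fastforce
  qed
  have wD: "w \<in> ?D" using w by (simp add: super_lyndon_words_def)
  have "series \<Psi> x w = c w * series \<Psi> (lyndon_element w) w" using diag[OF wD] small by blast
  then have cw: "c w \<noteq> 0" using leading_wordD(1)[OF lead] by auto
  let ?G = "{h \<in> ?D. w < h}"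
  have "(\<Sum>h\<in>?D. scale (c h) (lyndon_element h)) =
      (\<Sum>h\<in>insert w ?G. scale (c h) (lyndon_element h))"
  proof (rule sum.mono_neutral_right[OF finite_super_lyndon_words])
    show "\<forall>h\<in>?D - insert w ?G. scale (c h) (lyndon_element h) = 0"
    proof
      fix h assume h: "h \<in> ?D - insert w ?G"
      then have "h < w" by (auto simp: not_less)
      then have "c h = 0" using small h by blast
      then show "scale (c h) (lyndon_element h) = 0" by simp
    qed
  qed (use wD in auto)
  also have "\<dots> = scale (c w) (lyndon_element w) +
      (\<Sum>h\<in>?G. scale (c h) (lyndon_element h))"
    using finite_super_lyndon_words[of \<Psi> "mset w"] by (subst sum.insert) auto
  finally have "scale (c w) (lyndon_element w) =
      x - k - (\<Sum>h\<in>?G. scale (c h) (lyndon_element h))"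
    using k(2) by simp
  moreover have "x - k - (\<Sum>h\<in>?G. scale (c h) (lyndon_element h)) \<in> vec.span ?S"
    using k(1)
    by (intro vec.span_diff vec.span_sum vec.span_scale vec.span_base) auto
  ultimately have "scale (c w) (lyndon_element w) \<in> vec.span ?S" by (simp only:)
  from vec.span_scale[OF this, of "inverse (c w)"]
  show ?thesis using cw by (simp add: vec.scale_scale)
qed

context supergraph
begin

section \<open>Eliminating non-standard Lyndon words\<close>

text \<open>A certificate that \<open>[w]\<close> is dispensable: by
  \<open>lyndon_element_exchange\<close> such an \<open>x\<close> rewrites \<open>[w]\<close> modulo
  the kernel through larger words. Membership in the span of degree \<open>mset w\<close> keeps the
  rewriting inside a finite set of words.\<close>

definition null_leading :: "'i list \<Rightarrow> bool" where
  "null_leading w \<longleftrightarrow> (\<exists>x\<in>null_ideal. x \<in> lie_span \<Psi> (super_lyndon_words \<Psi> (mset w)) \<and>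
     leading_word (series \<Psi> x) w)"

lemma lie_ideal_null: "lie_superalgebra_ideal \<Psi> \<subseteq> null_ideal"
  unfolding lie_superalgebra_ideal_def
proof (rule generated_ideal_least)
  show "algebra_ideal free_algebra null_ideal"
    by (rule algebra_ideal_free_algebraI) (simp_all add: null_ideal_subspace null_ideal_mult)
  show "lie_superalgebra_relations \<Psi> \<subseteq> null_ideal" using lie_superalgebra_relations_null by blast
qed

lemma null_leadingE:
  assumes "null_leading u"
  obtains x where "x \<in> null_ideal" "x \<in> lie_span \<Psi> (super_lyndon_words \<Psi> (mset u))" "leading_word (series \<Psi> x) u"
  using assms unfolding null_leading_def by blast

lemma null_leading_magma_mult:
  assumes "x \<in> lie_span \<Psi> (super_lyndon_words \<Psi> (mset u))" "y \<in> lie_span \<Psi> (super_lyndon_words \<Psi> (mset v))"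
    and "x \<in> null_ideal \<or> y \<in> null_ideal"
    and "leading_word (super_bracket \<Psi> (series \<Psi> x) (series \<Psi> y)) (u @ v)"
  shows "null_leading (u @ v)"
  unfolding null_leading_def
proof (intro bexI conjI)
  show "magma_mult x y \<in> null_ideal" using assms(3) null_ideal_mult by blast
  show "magma_mult x y \<in> lie_span \<Psi> (super_lyndon_words \<Psi> (mset (u @ v)))"
    using lie_span_mult[OF assms(1,2)] by simp
  show "leading_word (series \<Psi> (magma_mult x y)) (u @ v)" unfolding series_mult by (rule assms(4))
qed

lemma null_leading_mult_right:
  assumes "null_leading u" "super_lyndon_word \<Psi> v" "u @ v < v @ u"
  shows "null_leading (u @ v)"
  using null_leadingE[OF assms(1)]
    null_leading_magma_mult[OF _ lyndon_element_in_degree[OF assms(2)], of _ u]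
    leading_word_bracket[OF _ leading_word_lyndon_element[OF assms(2)] assms(3)] by metis

lemma null_leading_mult_left:
  assumes "super_lyndon_word \<Psi> u" "null_leading v" "u @ v < v @ u"
  shows "null_leading (u @ v)"
  using null_leadingE[OF assms(2)]
    null_leading_magma_mult[OF lyndon_element_in_degree[OF assms(1)], of _ v]
    leading_word_bracket[OF leading_word_lyndon_element[OF assms(1)] _ assms(3)] by metis

text \<open>The kernel element for \<open>k\<close> is bracketed with \<open>[k]\<close>; both have
  leading word \<open>k\<close>, and oddness prevents cancellation.\<close>

lemma null_leading_square:
  assumes "null_leading k" "lyndon_word k" "odd_word \<Psi> k"
  shows "null_leading (k @ k)"
proof -
  have k: "super_lyndon_word \<Psi> k" using assms(2) by (simp add: super_lyndon_word_def)
  show ?thesis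
    using null_leadingE[OF assms(1)]
      null_leading_magma_mult[OF _ lyndon_element_in_degree[OF k], of _ k]
      leading_word_square[OF _ leading_word_lyndon_element[OF k] assms(3)] by metis
qed

text \<open>Bracketing with \<open>b\<close> acts as a superderivation, up to sign, and kills every
  leaf; the Jacobi identity propagates this through the tree.\<close>

lemma tree_commuting_letter_null:
  "(\<And>c. c \<in># leaves t \<Longrightarrow> indep c b) \<Longrightarrow> tree (Br t (Gen b)) \<in> null_ideal"
proof (induction t)
  case (Gen i)
  then show ?case by (intro commuting_generators_null) simp
next
  case (Br s r)
  have "magma_mult (tree s) (tree (Br r (Gen b))) \<in> null_ideal" "magma_mult (tree r) (tree (Br s (Gen b))) \<in> null_ideal"
    using Br by (auto intro!: null_ideal_mult)
  then show ?case
    unfolding magma_mult_tree by (rule subspace_tree_jacobi[OF null_ideal_subspace lie_ideal_null])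
qed

text \<open>The condition \<open>b < c\<close> from \<open>not_standardE\<close> is used here: all
  letters of \<open>u\<close> exceed \<open>a\<close>, so \<open>a # u\<close> is Lyndon and has a
  bracketing with known leading word.\<close>

lemma null_leading_descending:
  assumes "a < b" "indep b a" "\<And>c. c \<in> set u \<Longrightarrow> indep b c \<and> b < c"
  shows "null_leading (a # u @ [b])"
  unfolding null_leading_def
proof (intro bexI conjI)
  have "a < c" if "c \<in> set u" for c using assms(1) assms(3)[OF that] by (blast intro: order.strict_trans)
  then have au: "super_lyndon_word \<Psi> (a # u)" using lyndon_word_Cons_least by (auto simp: super_lyndon_word_def)
  have b: "super_lyndon_word \<Psi> [b]" by (simp add: super_lyndon_word_def)
  have lb: "lyndon_element [b] = tree (Gen b)" by (simp add: lyndon_element_def)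
  let ?x = "magma_mult (lyndon_element (a # u)) (lyndon_element [b])"
  have "indep c b" if "c \<in># leaves (bracketing (a # u))" for c
    using that assms(2,3) indep_sym by (auto simp: leaves_bracketing)
  then have "tree (Br (bracketing (a # u)) (Gen b)) \<in> null_ideal" by (rule tree_commuting_letter_null)
  then show "?x \<in> null_ideal" unfolding lb by (simp add: lyndon_element_def magma_mult_tree)
  have "mset (a # u @ [b]) = mset (a # u) + mset [b]" by simp
  then show "?x \<in> lie_span \<Psi> (super_lyndon_words \<Psi> (mset (a # u @ [b])))"
    using lie_span_mult[OF lyndon_element_in_degree[OF au] lyndon_element_in_degree[OF b]] by (simp only:)
  have "(a # u) @ [b] < [b] @ (a # u)" using assms(1) by simp
  then show "leading_word (series \<Psi> ?x) (a # u @ [b])"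
    unfolding series_mult
    using leading_word_bracket[OF leading_word_lyndon_element[OF au] leading_word_lyndon_element[OF b]] by simp
qed

text \<open>The word \<open>q\<close> is cut into Lyndon words above \<open>v @ q\<close>, which are
  attached on the right one at a time. Each longer prefix is again a leading word, since
  \<open>u @ x\<close> is below \<open>x\<close> at a differing letter and hence below
  \<open>x @ u\<close>.\<close>

lemma null_leading_prefix:
  assumes w: "lyndon_word (v @ q)" and v: "null_leading v" "v \<noteq> []"
  shows "null_leading (v @ q)"
proof (cases "q = []")
  case True
  then show ?thesis using v by simp
next
  case False
  let ?w = "v @ q"
  have "?w < min_suffix q"
  proof -
    obtain p where "q = p @ min_suffix q" using min_suffix(1)[OF False] by (auto simp: suffix_def)
    then have "?w = (v @ p) @ min_suffix q" by simp
    then show ?thesis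
      using lyndon_wordD[of "v @ p" "min_suffix q"] w v(2) min_suffix(2)[OF False] by simp
  qed
  then obtain qs where qs: "concat qs = q" "\<And>x. x \<in> set qs \<Longrightarrow> lyndon_word x \<and> ?w < x"
    using lyndon_decomposition[OF False] by blast
  have "null_leading (u @ concat xs)"
    if "null_leading u" "u @ concat xs = ?w" "\<And>x. x \<in> set xs \<Longrightarrow> lyndon_word x \<and> ?w < x" for u xs
    using that
  proof (induction xs arbitrary: u)
    case Nil
    then show ?case by simp
  next
    case (Cons x xs)
    have x: "lyndon_word x" "?w < x" using Cons.prems(3) by auto
    have eq: "?w = (u @ x) @ concat xs" using Cons.prems(2) by simp
    then have "length x \<le> length ?w" by (metis length_append trans_le_add1 trans_le_add2 order.refl)
    \<comment> \<open>As \<open>x\<close> is no longer than \<open>?w\<close>, the two differ at a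
      letter; its position lies inside \<open>x\<close>, hence inside the prefix
      \<open>u @ x\<close> of \<open>?w\<close>.\<close>
    then have "lex_below ?w x" using x(2) by (rule lex_belowI[rotated])
    then obtain z a b w' x' where z: "?w = z @ a # w'" "x = z @ b # x'" "a < b"
      unfolding lex_below_def by blast
    have len: "length (z @ [a]) \<le> length (u @ x)" using z(2) by simp
    have "take (length (z @ [a])) ?w = z @ [a]" using z(1) by simp
    then have "take (length (z @ [a])) (u @ x) = z @ [a]" using eq len by simp
    then obtain y where y: "u @ x = (z @ [a]) @ y" by (metis append_take_drop_id)
    have "lex_below (u @ x) x" unfolding lex_below_def using y z(2,3) by auto
    then have "u @ x < x @ u" using lex_below_append_less[of "u @ x" x "[]" u] by simp
    then have "null_leading (u @ x)"
      using null_leading_mult_right Cons.prems(1) x(1) by (simp add: super_lyndon_word_def)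
    then have "null_leading ((u @ x) @ concat xs)" using Cons.IH[of "u @ x"] Cons.prems eq by auto
    then show ?case by simp
  qed
  then show ?thesis using v(1) qs by blast
qed

text \<open>Shirshov's special bracketing, relative to a Lyndon factor of a Lyndon word.\<close>

lemma null_leading_factor:
  assumes v: "lyndon_word v" "null_leading v" and w: "lyndon_word (p @ v @ q)"
  shows "null_leading (p @ v @ q)"
  using w
proof (induction "length (p @ v @ q)" arbitrary: p q rule: less_induct)
  case less
  have v_ne: "v \<noteq> []" using v(1) by (rule lyndon_word_nonempty)
  show ?case
  proof (cases "p = []")
    case True
    then show ?thesis using null_leading_prefix[OF _ v(2) v_ne] less.prems by simp
  next
    case p: False
    let ?w = "p @ v @ q"
    have len: "2 \<le> length ?w" using p v_ne by (cases p; cases v) auto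
    define l r where "l = left_factor ?w" and "r = right_factor ?w"
    have lr: "l @ r = ?w" "l \<noteq> []" "r \<noteq> []"
      using factors_append[OF len] left_factor_nonempty[OF len] right_factor_nonempty[OF len] by (auto simp: l_def r_def)
    have lyn: "lyndon_word l" "lyndon_word r"
      using lyndon_word_left_factor[OF len less.prems] lyndon_word_right_factor[OF len] by (auto simp: l_def r_def)
    have swap: "l @ r < r @ l" using lyndon_word_swap[of l r] less.prems lr by simp
    have lens: "length l < length ?w" "length r < length ?w"
      using arg_cong[OF lr(1), of length] lr(2,3) by (auto simp flip: length_greater_0_conv)
    from lr(1) consider us where "l = p @ us" "v @ q = us @ r" | us where "p = l @ us" "r = us @ v @ q"
      unfolding append_eq_append_conv2[of l r] by auto
    then show ?thesis
    proof cases
      case (1 us)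
      from 1(2) consider q' where "us = v @ q'" "q = q' @ r" | v2 where "v = us @ v2" "r = v2 @ q" "v2 \<noteq> []"
        unfolding append_eq_append_conv2[of v q] by force
      then show ?thesis
      proof cases
        case (1 q')
        then have l: "l = p @ v @ q'" using \<open>l = p @ us\<close> by simp
        then have "null_leading l" using less.hyps[of p q'] lens lyn by simp
        then have "null_leading (l @ r)"
          using null_leading_mult_right swap lyn by (simp add: super_lyndon_word_def)
        then show ?thesis using lr by simp
      next
        case (2 v2)
        show ?thesis
        proof (cases "us = []")
          case True
          then have "null_leading r" using less.hyps[of "[]" q] lens lyn 2 p by simp
          then have "null_leading (l @ r)"
            using null_leading_mult_left swap lyn by (simp add: super_lyndon_word_def)
          then show ?thesis using lr by simp
        next
          case False
          \<comment> \<open>The standard factorization cannot cut strictly inside \<open>v\<close>: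
            the Lyndon word \<open>v\<close> is below its proper suffix \<open>v2\<close>, so
            \<open>v @ q\<close> would be a proper suffix smaller than \<open>r\<close>.\<close>
          have "r \<le> v @ q"
            unfolding r_def using right_factor_le[OF len, of p "v @ q"] p v_ne by simp
          moreover have "lex_below v v2" using lyndon_word_below[of us v2] v(1) 2 False by simp
          then have "v @ q < r" using lex_below_append_less[of v v2 q q] 2 by simp
          ultimately show ?thesis by simp
        qed
      qed
    next
      case (2 us)
      then have "null_leading r" using less.hyps[of us q] lens lyn by simp
      then have "null_leading (l @ r)"
        using null_leading_mult_left swap lyn by (simp add: super_lyndon_word_def)
      then show ?thesis using lr by simp
    qed
  qed
qed

lemma null_leading_not_standard_lyndon:
  assumes "lyndon_word w" "\<not> standard w" shows "null_leading w"
proof -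
  obtain x a u b y where w: "w = x @ a # u @ b # y" "a < b" "indep b a"
    "\<And>c. c \<in> set u \<Longrightarrow> indep b c \<and> b < c" using assms(2) by (rule not_standardE) blast
  have "a < c" if "c \<in> set (u @ [b])" for c
    using that w(2,4) by (auto intro: order.strict_trans)
  then have "lyndon_word (a # u @ [b])" by (rule lyndon_word_Cons_least)
  moreover have "null_leading (a # u @ [b])" using w by (intro null_leading_descending)
  ultimately show ?thesis using null_leading_factor[of "a # u @ [b]" x y] assms(1) w(1) by simp
qed

lemma null_leading_not_standard:
  assumes "super_lyndon_word \<Psi> w" "\<not> standard w" shows "null_leading w"
proof (cases "lyndon_word w")
  case True
  then show ?thesis using null_leading_not_standard_lyndon assms by blast
next
  case False
  then obtain k where k: "lyndon_word k" "odd_word \<Psi> k" "w = k @ k"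
    using assms(1) unfolding super_lyndon_word_def by blast
  then have "\<not> standard k" using standard_square assms(2) by blast
  then show ?thesis using null_leading_square null_leading_not_standard_lyndon k by blast
qed

section \<open>Standard super Lyndon words span modulo the kernel and are independent\<close>

definition standard_lyndon_words :: "'i list set" where
  "standard_lyndon_words = {w. super_lyndon_word \<Psi> w \<and> standard w}"

abbreviation standard_span :: "('i magma \<Rightarrow>\<^sub>0 complex) set" where
  "standard_span \<equiv> vec.span (null_ideal \<union> lyndon_element ` standard_lyndon_words)"

text \<open>Inside one multidegree each exchange leads to larger words only, and the number of super
  Lyndon words above them decreases.\<close>

lemma lyndon_element_in_standard_span:
  assumes "w \<in> super_lyndon_words \<Psi> d" shows "lyndon_element w \<in> standard_span"
  using assms
proof (induction "card {h \<in> super_lyndon_words \<Psi> d. w < h}" arbitrary: w rule: less_induct)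
  case less
  have w: "super_lyndon_word \<Psi> w" "mset w = d" using less.prems by (auto simp: super_lyndon_words_def)
  show ?case
  proof (cases "standard w")
    case True
    then show ?thesis using w by (intro vec.span_base) (auto simp: standard_lyndon_words_def)
  next
    case False
    then obtain x where x: "x \<in> null_ideal" "x \<in> lie_span \<Psi> (super_lyndon_words \<Psi> (mset w))"
      "leading_word (series \<Psi> x) w" using null_leading_not_standard[OF w(1)] by (auto simp: null_leading_def)
    have "lyndon_element h \<in> standard_span" if h: "h \<in> super_lyndon_words \<Psi> d" "w < h" for h
    proof (rule less.hyps[OF _ h(1)])
      have "{g \<in> super_lyndon_words \<Psi> d. h < g} \<subseteq> {g \<in> super_lyndon_words \<Psi> d. w < g}"
        using h(2) by (auto intro: order.strict_trans)
      moreover have "h \<in> {g \<in> super_lyndon_words \<Psi> d. w < g}" "h \<notin> {g \<in> super_lyndon_words \<Psi> d. h < g}"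
        using h by auto
      ultimately have "{g \<in> super_lyndon_words \<Psi> d. h < g} \<subset> {g \<in> super_lyndon_words \<Psi> d. w < g}" by blast
      then show "card {g \<in> super_lyndon_words \<Psi> d. h < g} < card {g \<in> super_lyndon_words \<Psi> d. w < g}"
        by (rule psubset_card_mono[rotated]) (simp add: finite_super_lyndon_words)
    qed
    moreover have "y \<in> standard_span" if "y \<in> null_ideal" for y
      using that by (intro vec.span_base) blast
    ultimately have "insert x (lie_superalgebra_ideal \<Psi> \<union> lyndon_element ` {h \<in> super_lyndon_words \<Psi> (mset w). w < h})
        \<subseteq> standard_span" using x(1) lie_ideal_null w(2) by blast
    then have "vec.span (insert x (lie_superalgebra_ideal \<Psi> \<union> lyndon_element ` {h \<in> super_lyndon_words \<Psi> (mset w). w < h}))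
        \<subseteq> standard_span" by (rule vec.span_minimal) simp
    then show ?thesis using lyndon_element_exchange[OF w(1) x(2,3)] by blast
  qed
qed

lemma standard_span_UNIV: "x \<in> standard_span"
proof -
  have "tree t \<in> standard_span" for t
  proof -
    have "lie_superalgebra_ideal \<Psi> \<union> lyndon_element ` super_lyndon_words \<Psi> (leaves t) \<subseteq> standard_span"
      using lie_ideal_null lyndon_element_in_standard_span vec.span_superset by blast
    then have "lie_span \<Psi> (super_lyndon_words \<Psi> (leaves t)) \<subseteq> standard_span"
      unfolding lie_span_def by (rule vec.span_minimal) simp
    then show ?thesis using tree_in_lie_span by blast
  qed
  then have "(\<Sum>t\<in>Poly_Mapping.keys x. scale (Poly_Mapping.lookup x t) (tree t)) \<in> standard_span"
    by (intro vec.span_sum vec.span_scale)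
  moreover have "(\<Sum>t\<in>Poly_Mapping.keys x. scale (Poly_Mapping.lookup x t) (tree t)) = x"
    by (intro poly_mapping_eqI)
       (simp add: lookup_sum lookup_smult lookup_single when_def in_keys_iff if_distrib cong: if_cong)
  ultimately show ?thesis by simp
qed

text \<open>Applying the signed sum over the heap of the smallest occurring word isolates its coefficient.\<close>

lemma standard_lyndon_independent:
  assumes fin: "finite A" and A: "A \<subseteq> standard_lyndon_words"
    and null: "(\<Sum>w\<in>A. scale (c w) (lyndon_element w)) \<in> null_ideal"
  shows "\<forall>w\<in>A. c w = 0"
proof (rule ccontr)
  assume "\<not> (\<forall>w\<in>A. c w = 0)"
  then have ne: "{w \<in> A. c w \<noteq> 0} \<noteq> {}" by blast
  define w where "w = Min {w \<in> A. c w \<noteq> 0}"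
  have "w \<in> {w \<in> A. c w \<noteq> 0}" unfolding w_def using fin ne by (intro Min_in) auto
  then have w: "w \<in> A" "c w \<noteq> 0" by auto
  have least: "w \<le> v" if "v \<in> A" "c v \<noteq> 0" for v unfolding w_def using fin that by (intro Min_le) auto
  have st: "standard w" using w A by (auto simp: standard_lyndon_words_def)
  have lead: "leading_word (series \<Psi> (lyndon_element v)) v" if "v \<in> A" for v
    using that A leading_word_lyndon_element by (auto simp: standard_lyndon_words_def)
  have "0 = heap_sum (series \<Psi> (\<Sum>w\<in>A. scale (c w) (lyndon_element w))) w"
    using heap_sum_null[OF null] by simp
  also have "\<dots> = (\<Sum>v\<in>A. c v * heap_sum (series \<Psi> (lyndon_element v)) w)"
    unfolding heap_sum_def series_sum series_smult sum_distrib_left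
    by (subst sum.swap) (simp add: mult.left_commute)
  also have "\<dots> = (\<Sum>v\<in>{w}. c v * heap_sum (series \<Psi> (lyndon_element v)) w)"
  proof (rule sum.mono_neutral_right[OF fin])
    show "\<forall>v\<in>A - {w}. c v * heap_sum (series \<Psi> (lyndon_element v)) w = 0"
    proof
      fix v assume v: "v \<in> A - {w}"
      show "c v * heap_sum (series \<Psi> (lyndon_element v)) w = 0"
      proof (cases "c v = 0")
        case False
        then have "w < v" using least[of v] v by auto
        then have "heap_sum (series \<Psi> (lyndon_element v)) w = 0"
          using leading_wordD(4)[OF lead[of v]] v by (intro heap_sum_above[OF st]) (auto intro: less_le_trans)
        then show ?thesis by simp
      qed simp
    qed
  qed (use w in simp)
  finally show False using heap_sum_leading[OF lead[OF w(1)] st] w(2) by simp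
qed

section \<open>The elements \<open>\<Lambda>(E)\<close>\<close>

lemma odd_heap_heap_of: "odd_heap \<Psi> (heap_of adj w) \<longleftrightarrow> odd_word \<Psi> w"
proof -
  have "odd_word \<Psi> v \<longleftrightarrow> odd_word \<Psi> w" if "v \<in> heap_of adj w" for v
    using that heap_eq_mset[of w v] odd_word_mset_cong[of w v] by (simp add: mem_heap_of)
  moreover have "w \<in> heap_of adj w" by (simp add: mem_heap_of)
  ultimately show ?thesis unfolding odd_heap_def odd_word_def[symmetric] by blast
qed

lemma super_lyndon_heap_iff:
  "super_lyndon_heap adj \<Psi> E \<longleftrightarrow> (\<exists>w\<in>standard_lyndon_words. E = heap_of adj w)"
proof
  assume "super_lyndon_heap adj \<Psi> E"
  then consider "lyndon_heap adj E" | F where "lyndon_heap adj F" "odd_heap \<Psi> F" "E = superpose adj F F"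
    by (auto simp: super_lyndon_heap_def)
  then show "\<exists>w\<in>standard_lyndon_words. E = heap_of adj w"
  proof cases
    case 1
    then show ?thesis by (rule lyndon_heapE) (auto simp: standard_lyndon_words_def super_lyndon_word_def)
  next
    case (2 F)
    obtain k where k: "F = heap_of adj k" "standard k" "lyndon_word k" using 2(1) by (rule lyndon_heapE)
    then have "k @ k \<in> standard_lyndon_words"
      using 2(2) standard_square by (auto simp: standard_lyndon_words_def super_lyndon_word_def odd_heap_heap_of)
    then show ?thesis using 2(3) k(1) superpose_heap_of by blast
  qed
next
  assume "\<exists>w\<in>standard_lyndon_words. E = heap_of adj w"
  then obtain w where w: "E = heap_of adj w" "standard w" "super_lyndon_word \<Psi> w"
    by (auto simp: standard_lyndon_words_def)
  show "super_lyndon_heap adj \<Psi> E"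
  proof (cases "lyndon_word w")
    case True
    then show ?thesis using w lyndon_heap_of by (simp add: super_lyndon_heap_def)
  next
    case False
    then obtain k where k: "lyndon_word k" "odd_word \<Psi> k" "w = k @ k"
      using w(3) unfolding super_lyndon_word_def by blast
    have "standard k" using w(2) standard_prefix k(3) by blast
    then have "lyndon_heap adj (heap_of adj k)" "odd_heap \<Psi> (heap_of adj k)"
      using k lyndon_heap_of by (simp_all add: odd_heap_heap_of)
    then show ?thesis using w(1) k(3) superpose_heap_of unfolding super_lyndon_heap_def by metis
  qed
qed

lemma heap_eq_singleton: "w \<approx> [i] \<Longrightarrow> w = [i]"
  using heap_eq_mset[of w "[i]"] by simp

lemma standard_lyndon_factors:
  assumes "standard w" "lyndon_word w" "2 \<le> length w"
  shows "left_factor w \<in> standard_lyndon_words" "right_factor w \<in> standard_lyndon_words"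
proof -
  have "standard (left_factor w @ right_factor w)" using factors_append[OF assms(3)] assms(1) by simp
  then have "standard (left_factor w)" "standard (right_factor w)"
    by (rule standard_prefix, rule standard_suffix)
  then show "left_factor w \<in> standard_lyndon_words" "right_factor w \<in> standard_lyndon_words"
    using lyndon_word_left_factor[OF assms(3,2)] lyndon_word_right_factor[OF assms(3)]
    by (simp_all add: standard_lyndon_words_def super_lyndon_word_def)
qed

lemma LS_class_bracketing:
  "2 \<le> length w \<Longrightarrow> LS_class (lyndon_element w) =
     LS_class (lyndon_element (left_factor w)) \<otimes>\<^bsub>LS adj \<Psi>\<^esub> LS_class (lyndon_element (right_factor w))"
  by (simp add: lyndon_element_def bracketing_long magma_mult_tree flip: LS_class_mult)

lemma standard_lyndon_square:
  assumes "k @ k \<in> standard_lyndon_words" "lyndon_word k"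
  shows "k \<in> standard_lyndon_words"
  using assms standard_prefix[of k k] by (simp add: standard_lyndon_words_def super_lyndon_word_def)

text \<open>Needed for the definite description in \<open>Lambda\<close>. The heap determines its
  standard factorization, so every derivation in the graph follows the recursion of
  \<open>bracketing\<close> on the standard word.\<close>

lemma Lambda_graph_unique:
  assumes "Lambda_graph adj \<Psi> E x" "E = heap_of adj w" "w \<in> standard_lyndon_words"
  shows "x = LS_class (lyndon_element w)"
  using assms
proof (induction arbitrary: w rule: Lambda_graph.induct)
  case (piece i)
  then have "w = [i]" using heap_eq_singleton heap_eq_sym by (auto simp: heap_of_eq_iff)
  then show ?case by (simp add: lyndon_element_def LS_class_gen)
next
  case (bracket E F N x y)
  have w: "standard w" "super_lyndon_word \<Psi> w" using bracket.prems by (auto simp: standard_lyndon_words_def)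
  have f: "standard_factorization adj \<Psi> (heap_of adj w) F N" using bracket.hyps(1) bracket.prems(1) by simp
  show ?case
  proof (cases "lyndon_word w")
    case True
    note D = standard_factorization_lyndonD[OF w(1) True f]
    show ?thesis
      using bracket.IH(1)[OF D(2)] bracket.IH(2)[OF D(3)] standard_lyndon_factors[OF w(1) True D(1)]
      by (simp add: LS_class_bracketing[OF D(1)])
  next
    case False
    then obtain k where k: "lyndon_word k" "w = k @ k" using w(2) unfolding super_lyndon_word_def by blast
    then have "k \<in> standard_lyndon_words" using standard_lyndon_square bracket.prems(2) by blast
    moreover from this have "standard k" by (simp add: standard_lyndon_words_def)
    note D = standard_factorization_squareD[OF this k(1) f[unfolded k(2)]]
    ultimately have "x = LS_class (lyndon_element k)" "y = LS_class (lyndon_element k)"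
      using bracket.IH by blast+
    then show ?thesis
      using k by (simp add: lyndon_element_def bracketing_square magma_mult_tree flip: LS_class_mult)
  qed
qed

lemma Lambda_graph_lyndon:
  "standard w \<Longrightarrow> lyndon_word w \<Longrightarrow> Lambda_graph adj \<Psi> (heap_of adj w) (LS_class (lyndon_element w))"
proof (induction w rule: length_induct)
  case (1 w)
  show ?case
  proof (cases "2 \<le> length w")
    case True
    have st: "standard (left_factor w)" "standard (right_factor w)"
      using standard_lyndon_factors[OF 1(2,3) True] by (auto simp: standard_lyndon_words_def)
    have "length (left_factor w) + length (right_factor w) = length w"
      using factors_append[OF True] by (metis length_append)
    then have "length (left_factor w) < length w" "length (right_factor w) < length w"
      using left_factor_nonempty[OF True] right_factor_nonempty[OF True]
      by (auto simp flip: length_greater_0_conv)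
    then have "Lambda_graph adj \<Psi> (heap_of adj (left_factor w)) (LS_class (lyndon_element (left_factor w)))"
      "Lambda_graph adj \<Psi> (heap_of adj (right_factor w)) (LS_class (lyndon_element (right_factor w)))"
      using 1(1) st lyndon_word_left_factor[OF True 1(3)] lyndon_word_right_factor[OF True] by blast+
    then show ?thesis
      unfolding LS_class_bracketing[OF True]
      by (rule Lambda_graph.bracket[OF standard_factorization_lyndon[OF 1(2,3) True]])
  next
    case False
    then obtain a where "w = [a]" using lyndon_word_nonempty[OF 1(3)] by (cases w; cases "tl w") auto
    then show ?thesis using Lambda_graph.piece[of adj \<Psi> a] by (simp add: lyndon_element_def LS_class_gen)
  qed
qed

lemma Lambda_graph_exists:
  assumes "w \<in> standard_lyndon_words"
  shows "Lambda_graph adj \<Psi> (heap_of adj w) (LS_class (lyndon_element w))"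
proof (cases "lyndon_word w")
  case True
  then show ?thesis using Lambda_graph_lyndon assms by (simp add: standard_lyndon_words_def)
next
  case False
  then obtain k where k: "lyndon_word k" "odd_word \<Psi> k" "w = k @ k"
    using assms unfolding standard_lyndon_words_def super_lyndon_word_def by blast
  have st: "standard k"
    using standard_lyndon_square[of k] assms k(1,3) by (simp add: standard_lyndon_words_def)
  have "standard_factorization adj \<Psi> (superpose adj (heap_of adj k) (heap_of adj k)) (heap_of adj k) (heap_of adj k)"
    using st k lyndon_heap_of by (intro standard_factorization.square) (simp_all add: odd_heap_heap_of)
  then have "Lambda_graph adj \<Psi> (heap_of adj w)
      (LS_class (lyndon_element k) \<otimes>\<^bsub>LS adj \<Psi>\<^esub> LS_class (lyndon_element k))"
    unfolding k(3) superpose_heap_of using Lambda_graph_lyndon[OF st k(1)]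
    by (rule Lambda_graph.bracket[OF _ _ Lambda_graph_lyndon[OF st k(1)]])
  then show ?thesis
    using k by (simp add: lyndon_element_def bracketing_square magma_mult_tree flip: LS_class_mult)
qed

lemma Lambda_heap_of:
  "w \<in> standard_lyndon_words \<Longrightarrow> Lambda adj \<Psi> (heap_of adj w) = LS_class (lyndon_element w)"
  unfolding Lambda_def by (rule the_equality) (erule Lambda_graph_exists, rule Lambda_graph_unique[OF _ refl])

lemma Lambda_image:
  "Lambda adj \<Psi> ` {E. super_lyndon_heap adj \<Psi> E} = (\<lambda>w. LS_class (lyndon_element w)) ` standard_lyndon_words"
proof -
  have "{E. super_lyndon_heap adj \<Psi> E} = heap_of adj ` standard_lyndon_words"
    by (auto simp: super_lyndon_heap_iff)
  then show ?thesis by (simp add: image_image Lambda_heap_of)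
qed

lemma Lambda_basis: "vectorspace.basis class_ring (LS adj \<Psi>) (Lambda adj \<Psi> ` {E. super_lyndon_heap adj \<Psi> E})"
proof -
  interpret LS: vectorspace class_ring "LS adj \<Psi>" by (rule vectorspace_LS)
  let ?v = "\<lambda>w. LS_class (lyndon_element w)"
  let ?B = "?v ` standard_lyndon_words"
  have sub: "?B \<subseteq> carrier (LS adj \<Psi>)" by auto
  have "\<not> LS.lin_dep ?B"
  proof
    assume "LS.lin_dep ?B"
    then obtain A a u where A: "finite A" "A \<subseteq> ?B" "LS.lincomb a A = \<zero>\<^bsub>LS adj \<Psi>\<^esub>" "u \<in> A" "a u \<noteq> 0"
      unfolding LS.lin_dep_def by auto
    \<comment> \<open>Words are chosen on which \<open>?v\<close> is injective, so that coefficients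
      indexed by elements of \<open>LS\<close> carry over to words. Independence of the words then
      settles the set.\<close>
    obtain W where W: "W \<subseteq> standard_lyndon_words" "inj_on ?v W" "A = ?v ` W"
      using A(2) by (auto simp: subset_image_inj)
    have fin: "finite W" using W A(1) by (simp add: finite_image_iff)
    have "LS_class (\<Sum>w\<in>W. scale (a (?v w)) (lyndon_element w)) =
        (\<Oplus>\<^bsub>LS adj \<Psi>\<^esub>w\<in>W. a (?v w) \<odot>\<^bsub>LS adj \<Psi>\<^esub> ?v w)"
      by (simp add: LS_class_sum[OF fin] LS_class_smult)
    also have "\<dots> = LS.lincomb a A"
      unfolding LS.lincomb_def W(3)
      by (rule LS.finsum_reindex[OF _ W(2), symmetric]) (auto intro: LS.smult_closed)
    finally have "(\<Sum>w\<in>W. scale (a (?v w)) (lyndon_element w)) \<in> null_ideal"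
      using A(3) by (simp add: null_ideal_def)
    then have "\<forall>w\<in>W. a (?v w) = 0" by (rule standard_lyndon_independent[OF fin W(1)])
    then show False using A(4,5) W(3) by blast
  qed
  moreover have "LS.span ?B = carrier (LS adj \<Psi>)"
  proof
    show "LS.span ?B \<subseteq> carrier (LS adj \<Psi>)" by (rule LS.span_is_subset2[OF sub])
    have S: "submodule class_ring (LS.span ?B) (LS adj \<Psi>)" by (rule LS.span_is_submodule[OF sub])
    have own: "?B \<subseteq> LS.span ?B" by (rule LS.in_own_span[OF sub])
    show "carrier (LS adj \<Psi>) \<subseteq> LS.span ?B"
    proof
      fix X assume "X \<in> carrier (LS adj \<Psi>)"
      then obtain x where x: "X = LS_class x" by (auto simp: carrier_LS)
      have "LS_class x \<in> LS.span ?B"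
      proof (rule vec.span_induct[OF standard_span_UNIV[of x]])
        show "vec.subspace {x. LS_class x \<in> LS.span ?B}"
          using S unfolding vec.subspace_def LinearCombinations.submodule_def
          by (simp add: LS_class_zero LS_class_add LS_class_smult)
        fix y assume "y \<in> null_ideal \<union> lyndon_element ` standard_lyndon_words"
        then show "LS_class y \<in> LS.span ?B"
        proof
          assume "y \<in> null_ideal"
          then show ?thesis using S unfolding null_ideal_def LinearCombinations.submodule_def by simp
        next
          assume "y \<in> lyndon_element ` standard_lyndon_words"
          then show ?thesis using own by blast
        qed
      qed
      then show "X \<in> LS.span ?B" using x by simp
    qed
  qed
  ultimately show ?thesis unfolding Lambda_image LS.basis_def using sub by blast
qed

end

theorem theorem5:
  fixes adj :: "'i::{linorder, countable} \<Rightarrow> 'i \<Rightarrow> bool"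
    and \<Psi> :: "'i set"
  assumes "symp adj" and "irreflp adj"
  shows "vectorspace.basis class_ring (LS adj \<Psi>) (Lambda adj \<Psi> ` {E. super_lyndon_heap adj \<Psi> E})"
proof -
  interpret supergraph adj \<Psi> by unfold_locales (rule assms(1))
  show ?thesis by (rule Lambda_basis)
qed

end
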